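(* Let $G$ be a finite group, let $p$ be a prime number, and let $H=G'O^{p'}(G)$. Then: (1) $G$ has a $p$-block $B$ such that every ordinary irreducible character in $B$ is linear, i.e. $\mathrm{Irr}(B)\subseteq \mathrm{Lrr}(G)$, if and only if $G$ is a $p$-nilpotent group with an abelian Sylow $p$-subgroup. (2) $G$ has a $p$-block $B$ such that every irreducible Brauer character in $B$ is linear, i.e. $\mathrm{IBr}(B)\subseteq \mathrm{LBr}(G)$, if and only if $$O_{p'}(G)\lhd O_{p'p}(G)=HO_{p'}(G)=\mathrm{Ker}(B_0^{*})\lhd O_{p'pp'}(G)=G$$ (where $\lhd$ means normal subgroup, not necessarily proper).
   Context: $(K,R,F)$ is a splitting $p$-modular system for $G$: $R$ is a complete discrete valuation ring with maximal ideal $\pi$, $K$ is its quotient field (of characteristic $0$), $F=R/\pi$ has characteristic $p$, and $K$, $F$ are splitting fields. Blocks are $p$-blocks of $G$ (block algebras of $F[G]$). $\mathrm{Irr}(B)$ and $\mathrm{IBr}(B)$ are the sets of ordinary irreducible characters and of irreducible ($p$-)Brauer characters belonging to the block $B$. $\mathrm{Lrr}(G)$ is the set of linear (degree one) ordinary characters of $G$, and $\mathrm{LBr}(G)$ is the set of linear (degree one) Brauer characters of $G$. $G'$ is the derived subgroup of $G$, and $O^{p'}(G)$ is the subgroup generated by all $p$-elements of $G$. $O_{p'}(G)$ is the largest normal $p'$-subgroup of $G$; $O_{p'p}(G)$ is defined by $O_{p'p}(G)/O_{p'}(G)=O_p(G/O_{p'}(G))$, the largest normal $p$-subgroup of $G/O_{p'}(G)$;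 $O_{p'pp'}(G)$ is defined by $O_{p'pp'}(G)/O_{p'p}(G)=O_{p'}(G/O_{p'p}(G))$. $B_0$ is the principal block of $G$ (the block containing the trivial character), and $\mathrm{Ker}(B_0^{*})=\bigcap_{\varphi\in \mathrm{IBr}(B_0)}\mathrm{Ker}(V_\varphi)$, where $V_\varphi$ is the simple $F[G]$-module affording $\varphi$ and $\mathrm{Ker}(V_\varphi)$ is the subgroup of elements of $G$ acting trivially on $V_\varphi$. $G$ is $p$-nilpotent if it has a normal $p$-complement. *)

theory Defs
  imports
    "HOL-Algebra.Generated_Groups"
    "HOL-Algebra.Ring_Divisibility"
    "HOL-Algebra.Ideal_Product"
    "HOL-Algebra.Multiplicative_Group"
    "HOL-Algebra.Algebraic_Closure_Type"
    "Jordan_Normal_Form.Char_Poly"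
    "Jordan_Normal_Form.VS_Connect"
begin

hide_const (open) Multiset.mult Polynomial.order

section \<open>Subgroups attached to a prime\<close>

definition p_group_set :: "nat \<Rightarrow> 'g set \<Rightarrow> bool" where
  "p_group_set p A \<longleftrightarrow> finite A \<and> (\<exists>k. card A = p ^ k)"

definition p'_group_set :: "nat \<Rightarrow> 'g set \<Rightarrow> bool" where
  "p'_group_set p A \<longleftrightarrow> finite A \<and> \<not> p dvd card A"

definition largest_normal :: "('g, 'm) monoid_scheme \<Rightarrow> ('g set \<Rightarrow> bool) \<Rightarrow> 'g set" where
  "largest_normal G P =
     (THE N. N \<lhd> G \<and> P N \<and> (\<forall>M. M \<lhd> G \<and> P M \<longrightarrow> M \<subseteq> N))"

definition O_p :: "nat \<Rightarrow> ('g, 'm) monoid_scheme \<Rightarrow> 'g set" where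
  "O_p p G = largest_normal G (p_group_set p)"

definition O_p' :: "nat \<Rightarrow> ('g, 'm) monoid_scheme \<Rightarrow> 'g set" where
  "O_p' p G = largest_normal G (p'_group_set p)"

definition O_p'p :: "nat \<Rightarrow> ('g, 'm) monoid_scheme \<Rightarrow> 'g set" where
  "O_p'p p G = {g \<in> carrier G. O_p' p G #>\<^bsub>G\<^esub> g \<in> O_p p (G Mod O_p' p G)}"

definition O_p'pp' :: "nat \<Rightarrow> ('g, 'm) monoid_scheme \<Rightarrow> 'g set" where
  "O_p'pp' p G = {g \<in> carrier G. O_p'p p G #>\<^bsub>G\<^esub> g \<in> O_p' p (G Mod O_p'p p G)}"

text \<open>\<open>O\<close> with upper index \<open>p'\<close>: the subgroup generated by all \<open>p\<close>-elements.\<close>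

definition p'_residual :: "nat \<Rightarrow> ('g, 'm) monoid_scheme \<Rightarrow> 'g set" where
  "p'_residual p G = generate G {g \<in> carrier G. \<exists>k. group.ord G g = p ^ k}"

definition sylow_subgroup :: "nat \<Rightarrow> ('g, 'm) monoid_scheme \<Rightarrow> 'g set \<Rightarrow> bool" where
  "sylow_subgroup p G P \<longleftrightarrow> subgroup P G \<and> card P = p ^ multiplicity p (order G)"

definition p_nilpotent :: "nat \<Rightarrow> ('g, 'm) monoid_scheme \<Rightarrow> bool" where
  "p_nilpotent p G \<longleftrightarrow>
     (\<exists>N. N \<lhd> G \<and> \<not> p dvd card N \<and> (\<exists>k. card (rcosets\<^bsub>G\<^esub> N) = p ^ k))"


section \<open>Matrix representations\<close>

text \<open>
  Modules over \<open>A[G]\<close> that are free of rank \<open>n\<close> over \<open>A\<close> are given by matrix representations,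
  with \<open>G\<close> acting on column vectors.
\<close>

definition representation :: "('g, 'm) monoid_scheme \<Rightarrow> nat \<Rightarrow> ('g \<Rightarrow> 'a::comm_ring_1 mat) \<Rightarrow> bool" where
  "representation G n \<rho> \<longleftrightarrow>
     (\<forall>g \<in> carrier G. \<rho> g \<in> carrier_mat n n) \<and>
     \<rho> \<one>\<^bsub>G\<^esub> = 1\<^sub>m n \<and>
     (\<forall>g \<in> carrier G. \<forall>h \<in> carrier G. \<rho> (g \<otimes>\<^bsub>G\<^esub> h) = \<rho> g * \<rho> h)"

definition irreducible_rep :: "('g, 'm) monoid_scheme \<Rightarrow> nat \<Rightarrow> ('g \<Rightarrow> 'a::field mat) \<Rightarrow> bool" where
  "irreducible_rep G n \<rho> \<longleftrightarrow>
     representation G n \<rho> \<and> n > 0 \<and>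
     (\<forall>W. VectorSpace.subspace class_ring W (module_vec TYPE('a) n) \<and>
          (\<forall>g \<in> carrier G. \<forall>w \<in> W. \<rho> g *\<^sub>v w \<in> W)
        \<longrightarrow> W = {0\<^sub>v n} \<or> W = carrier_vec n)"

text \<open>A field is splitting for \<open>G\<close> if simple modules have only scalar endomorphisms.\<close>

definition splitting_field :: "'a::field itself \<Rightarrow> ('g, 'm) monoid_scheme \<Rightarrow> bool" where
  "splitting_field _ G \<longleftrightarrow>
     (\<forall>n (\<rho> :: 'g \<Rightarrow> 'a mat). irreducible_rep G n \<rho> \<longrightarrow>
        (\<forall>A \<in> carrier_mat n n. (\<forall>g \<in> carrier G. A * \<rho> g = \<rho> g * A)
           \<longrightarrow> (\<exists>c. A = c \<cdot>\<^sub>m 1\<^sub>m n)))"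

definition character :: "('g, 'm) monoid_scheme \<Rightarrow> ('g \<Rightarrow> 'a::field mat) \<Rightarrow> 'g \<Rightarrow> 'a" where
  "character G \<rho> = (\<lambda>g \<in> carrier G. \<Sum>i<dim_row (\<rho> g). \<rho> g $$ (i, i))"

definition Irr :: "('g, 'm) monoid_scheme \<Rightarrow> ('g \<Rightarrow> 'k::field_char_0) set" where
  "Irr G = {character G \<rho> | n \<rho>. irreducible_rep G n \<rho>}"

definition Lrr :: "('g, 'm) monoid_scheme \<Rightarrow> ('g \<Rightarrow> 'k::field_char_0) set" where
  "Lrr G = {\<chi> \<in> Irr G. \<chi> \<one>\<^bsub>G\<^esub> = 1}"


section \<open>Splitting modular systems\<close>

definition discrete_valuation_ring :: "('a, 'b) ring_scheme \<Rightarrow> 'a set \<Rightarrow> bool" where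
  "discrete_valuation_ring R \<pp> \<longleftrightarrow>
     principal_domain R \<and> maximalideal \<pp> R \<and> (\<forall>J. maximalideal J R \<longrightarrow> J = \<pp>) \<and>
     \<pp> \<noteq> {\<zero>\<^bsub>R\<^esub>}"

text \<open>The \<open>n\<close>-th power of an ideal is its power in the multiplicative monoid of ideals.\<close>

definition adically_complete :: "('a, 'b) ring_scheme \<Rightarrow> 'a set \<Rightarrow> bool" where
  "adically_complete R \<pp> \<longleftrightarrow>
     (\<forall>s :: nat \<Rightarrow> 'a. range s \<subseteq> carrier R \<and>
        (\<forall>n::nat. \<exists>N. \<forall>i\<ge>N. \<forall>j\<ge>N. s i \<ominus>\<^bsub>R\<^esub> s j \<in> \<pp> [^]\<^bsub>ideals_set R\<^esub> n)
      \<longrightarrow> (\<exists>x \<in> carrier R.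
            \<forall>n::nat. \<exists>N. \<forall>i\<ge>N. s i \<ominus>\<^bsub>R\<^esub> x \<in> \<pp> [^]\<^bsub>ideals_set R\<^esub> n))"

text \<open>
  \<open>R\<close> is the type \<open>'r\<close> with maximal ideal \<open>\<pp>\<close>, \<open>K\<close> the type \<open>'k\<close> and \<open>F\<close> the type \<open>'f\<close>;
  \<open>\<iota>\<close> embeds \<open>R\<close> into its quotient field \<open>K\<close> and \<open>red\<close> is the residue map of \<open>R\<close> onto \<open>F\<close>.
\<close>

definition splitting_p_modular_system ::
  "nat \<Rightarrow> 'r::idom set \<Rightarrow> ('r \<Rightarrow> 'k::field_char_0) \<Rightarrow> ('r \<Rightarrow> 'f::field)
     \<Rightarrow> ('g, 'm) monoid_scheme \<Rightarrow> bool" where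
  "splitting_p_modular_system p \<pp> \<iota> red G \<longleftrightarrow>
     discrete_valuation_ring (class_ring :: 'r ring) \<pp> \<and>
     adically_complete (class_ring :: 'r ring) \<pp> \<and>
     inj_comm_ring_hom \<iota> \<and> (\<forall>x. \<exists>a b. b \<noteq> 0 \<and> x = \<iota> a / \<iota> b) \<and>
     comm_ring_hom red \<and> surj red \<and> \<pp> = {a. red a = 0} \<and>
     CHAR('f) = p \<and>
     splitting_field TYPE('k) G \<and> splitting_field TYPE('f) G"


section \<open>Brauer characters\<close>

text \<open>
  \<open>L\<close> is the multiset of lifts of the eigenvalues of \<open>A\<close>: these are the \<open>p'\<close>-roots of unity of
  characteristic zero that reduce to the eigenvalues, with multiplicity. The fields \<open>K\<close> and
  \<open>F\<close> being splitting for \<open>G\<close> does not force the eigenvalues of the single elements of \<open>G\<close> to lie in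
  \<open>F\<close>, so \<open>L\<close> is taken in the algebraic closure of \<open>K\<close>, and reduction is
  expressed for the monic polynomial over \<open>R\<close> whose roots are the members of \<open>L\<close>. If the eigenvalues of \<open>A\<close>
  are \<open>p'\<close>-roots of unity then there is exactly one such \<open>L\<close>, since reduction is
  injective on \<open>p'\<close>-roots of unity.
\<close>

definition eigenvalue_lifts ::
  "nat \<Rightarrow> ('r::idom \<Rightarrow> 'k::field_char_0) \<Rightarrow> ('r \<Rightarrow> 'f::field) \<Rightarrow> 'f mat
     \<Rightarrow> 'k alg_closure multiset \<Rightarrow> bool" where
  "eigenvalue_lifts p \<iota> red A L \<longleftrightarrow>
     (\<forall>\<zeta> \<in># L. \<exists>m. m > 0 \<and> coprime m p \<and> \<zeta> ^ m = 1) \<and>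
     (\<exists>f. map_poly (\<lambda>a. to_ac (\<iota> a)) f = (\<Prod>\<zeta>\<in>#L. [:- \<zeta>, 1:]) \<and>
          map_poly red f = char_poly A)"

definition p_regular :: "nat \<Rightarrow> ('g, 'm) monoid_scheme \<Rightarrow> 'g set" where
  "p_regular p G = {g \<in> carrier G. \<not> p dvd group.ord G g}"

definition brauer_character ::
  "nat \<Rightarrow> ('r::idom \<Rightarrow> 'k::field_char_0) \<Rightarrow> ('r \<Rightarrow> 'f::field) \<Rightarrow> ('g, 'm) monoid_scheme
     \<Rightarrow> ('g \<Rightarrow> 'f mat) \<Rightarrow> 'g \<Rightarrow> 'k alg_closure" where
  "brauer_character p \<iota> red G \<rho> =
     (\<lambda>g \<in> p_regular p G. \<Sum>\<^sub># (THE L. eigenvalue_lifts p \<iota> red (\<rho> g) L))"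

definition IBr ::
  "nat \<Rightarrow> ('r::idom \<Rightarrow> 'k::field_char_0) \<Rightarrow> ('r \<Rightarrow> 'f::field) \<Rightarrow> ('g, 'm) monoid_scheme
     \<Rightarrow> ('g \<Rightarrow> 'k alg_closure) set" where
  "IBr p \<iota> red G = {brauer_character p \<iota> red G \<rho> | n \<rho>. irreducible_rep G n \<rho>}"

definition LBr ::
  "nat \<Rightarrow> ('r::idom \<Rightarrow> 'k::field_char_0) \<Rightarrow> ('r \<Rightarrow> 'f::field) \<Rightarrow> ('g, 'm) monoid_scheme
     \<Rightarrow> ('g \<Rightarrow> 'k alg_closure) set" where
  "LBr p \<iota> red G = {\<phi> \<in> IBr p \<iota> red G. \<phi> \<one>\<^bsub>G\<^esub> = 1}"


section \<open>Blocks\<close>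

text \<open>
  For finite \<open>G\<close>: elements of \<open>A[G]\<close> are coefficient functions vanishing outside \<open>carrier G\<close>,
  multiplied by convolution.
\<close>

definition group_algebra :: "('g, 'm) monoid_scheme \<Rightarrow> ('g \<Rightarrow> 'a::comm_ring_1) ring" where
  "group_algebra G =
     \<lparr>carrier = {a. \<forall>g. g \<notin> carrier G \<longrightarrow> a g = 0},
      mult = (\<lambda>a b g. if g \<in> carrier G
                      then \<Sum>h\<in>carrier G. a h * b (inv\<^bsub>G\<^esub> h \<otimes>\<^bsub>G\<^esub> g) else 0),
      one = (\<lambda>g. if g = \<one>\<^bsub>G\<^esub> then 1 else 0),
      zero = (\<lambda>_. 0),
      add = (\<lambda>a b g. a g + b g)\<rparr>"

definition central_idempotent :: "('a, 'b) ring_scheme \<Rightarrow> 'a \<Rightarrow> bool" where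
  "central_idempotent A e \<longleftrightarrow>
     e \<in> carrier A \<and> e \<otimes>\<^bsub>A\<^esub> e = e \<and> (\<forall>a \<in> carrier A. e \<otimes>\<^bsub>A\<^esub> a = a \<otimes>\<^bsub>A\<^esub> e)"

definition block_idempotent :: "('a, 'b) ring_scheme \<Rightarrow> 'a \<Rightarrow> bool" where
  "block_idempotent A e \<longleftrightarrow>
     central_idempotent A e \<and> e \<noteq> \<zero>\<^bsub>A\<^esub> \<and>
     \<not> (\<exists>e1 e2. central_idempotent A e1 \<and> central_idempotent A e2 \<and>
               e1 \<noteq> \<zero>\<^bsub>A\<^esub> \<and> e2 \<noteq> \<zero>\<^bsub>A\<^esub> \<and>
               e1 \<otimes>\<^bsub>A\<^esub> e2 = \<zero>\<^bsub>A\<^esub> \<and> e = e1 \<oplus>\<^bsub>A\<^esub> e2)"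

definition block_algebra :: "('a, 'b) ring_scheme \<Rightarrow> 'a \<Rightarrow> 'a set" where
  "block_algebra A e = {a \<otimes>\<^bsub>A\<^esub> e | a. a \<in> carrier A}"

definition blocks :: "('g, 'm) monoid_scheme \<Rightarrow> ('g \<Rightarrow> 'f::field) set set" where
  "blocks G = {block_algebra (group_algebra G) e | e. block_idempotent (group_algebra G) e}"

text \<open>The action of an element of the group algebra on the module given by \<open>\<rho>\<close>.\<close>

definition rep_algebra ::
  "('g, 'm) monoid_scheme \<Rightarrow> nat \<Rightarrow> ('g \<Rightarrow> 'a::comm_ring_1 mat) \<Rightarrow> ('g \<Rightarrow> 'a) \<Rightarrow> 'a mat" where
  "rep_algebra G n \<rho> a = mat n n (\<lambda>(i, j). \<Sum>g\<in>carrier G. a g * \<rho> g $$ (i, j))"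

text \<open>
  A block \<open>B\<close> contains exactly one block idempotent \<open>e\<close>, its identity element. A simple
  \<open>F[G]\<close>-module belongs to \<open>B\<close> if \<open>e\<close> acts on it as the identity; a simple \<open>K[G]\<close>-module belongs to
  \<open>B\<close> if the central idempotent of \<open>R[G]\<close> lifting \<open>e\<close> does.
\<close>

definition Irr_block ::
  "('r::idom \<Rightarrow> 'k::field_char_0) \<Rightarrow> ('r \<Rightarrow> 'f::field) \<Rightarrow> ('g, 'm) monoid_scheme
     \<Rightarrow> ('g \<Rightarrow> 'f) set \<Rightarrow> ('g \<Rightarrow> 'k) set" where
  "Irr_block \<iota> red G B =
     {character G \<rho> | n \<rho>. irreducible_rep G n \<rho> \<and>
        (\<exists>e \<in> B. block_idempotent (group_algebra G) e \<and>
          (\<exists>e' :: 'g \<Rightarrow> 'r. central_idempotent (group_algebra G) e' \<and> red \<circ> e' = e \<and>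
             rep_algebra G n \<rho> (\<iota> \<circ> e') = 1\<^sub>m n))}"

definition IBr_block ::
  "nat \<Rightarrow> ('r::idom \<Rightarrow> 'k::field_char_0) \<Rightarrow> ('r \<Rightarrow> 'f::field) \<Rightarrow> ('g, 'm) monoid_scheme
     \<Rightarrow> ('g \<Rightarrow> 'f) set \<Rightarrow> ('g \<Rightarrow> 'k alg_closure) set" where
  "IBr_block p \<iota> red G B =
     {brauer_character p \<iota> red G \<rho> | n \<rho>. irreducible_rep G n \<rho> \<and>
        (\<exists>e \<in> B. block_idempotent (group_algebra G) e \<and> rep_algebra G n \<rho> e = 1\<^sub>m n)}"

definition principal_block ::
  "('r::idom \<Rightarrow> 'k::field_char_0) \<Rightarrow> ('r \<Rightarrow> 'f::field) \<Rightarrow> ('g, 'm) monoid_scheme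
     \<Rightarrow> ('g \<Rightarrow> 'f) set" where
  "principal_block \<iota> red G =
     (THE B. B \<in> blocks G \<and> (\<lambda>g \<in> carrier G. 1) \<in> Irr_block \<iota> red G B)"

text \<open>
  The intersection of the kernels of the modules \<open>V\<^sub>\<phi>\<close> for \<open>\<phi>\<close> in \<open>IBr(B)\<close>. As \<open>V\<^sub>\<phi>\<close> is only
  determined up to isomorphism, \<open>\<rho>\<close> runs over all irreducible representations affording \<open>\<phi>\<close>.
\<close>

definition block_kernel ::
  "nat \<Rightarrow> ('r::idom \<Rightarrow> 'k::field_char_0) \<Rightarrow> ('r \<Rightarrow> 'f::field) \<Rightarrow> ('g, 'm) monoid_scheme
     \<Rightarrow> ('g \<Rightarrow> 'f) set \<Rightarrow> 'g set" where
  "block_kernel p \<iota> red G B =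
     {g \<in> carrier G. \<forall>\<phi> \<in> IBr_block p \<iota> red G B. \<forall>n \<rho>.
        irreducible_rep G n \<rho> \<and> brauer_character p \<iota> red G \<rho> = \<phi> \<longrightarrow> \<rho> g = 1\<^sub>m n}"

end

theory Submission
  imports
    Defs
    "HOL-Library.Function_Algebras"
    "HOL-Algebra.Sylow"
    "HOL-Algebra.SndIsomorphismGrp"
begin

text \<open>
  The theorem is read off from the translates \<open>x e\<close> of central idempotents \<open>e\<close> of the group algebra
  by group elements \<open>x\<close>. Two facts carry it.

  First, an element of \<open>A[G]\<close>, \<open>A\<close> a field, that is killed by all irreducible representations
  lowers a composition series and hence acts nilpotently on \<open>A[G]\<close>
  (\<open>nilpotent_if_irreducibles_vanish\<close>). If \<open>x\<close> acts trivially in every irreducible representation in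
  which \<open>e\<close> acts as the identity, this applies to \<open>(x - 1) e\<close> and gives \<open>(x - 1)\<^sup>k e = 0\<close>
  (\<open>unipotent_on_block\<close>). As \<open>x\<close> has finite order, it follows that \<open>x e = e\<close> in characteristic 0
  (\<open>unipotent_char_0\<close>), while in characteristic \<open>p\<close> some power of \<open>x\<close> with exponent a power of
  \<open>p\<close> fixes \<open>e\<close> (\<open>unipotent_char_p\<close>).

  Second, in characteristic \<open>p\<close> the stabilizer \<open>{x. x e = e}\<close> of a central idempotent \<open>e \<noteq> 0\<close> has
  order prime to \<open>p\<close>: the coefficients of \<open>e = e * e\<close> are sums of terms that are constant on its
  cosets, hence multiples of its order (\<open>stabilizer_order_invertible\<close>). In the other direction, let
  \<open>e\<^sub>0\<close> be the identity of the principal block. It is the only block idempotent of augmentation 1, and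
  \<open>e\<^sub>0 f = e\<^sub>0\<close> for every central idempotent \<open>f\<close> of augmentation 1
  (\<open>block_idempotent_one_augmentation_absorb\<close>). With \<open>f\<close> the average over a normal subgroup of order
  prime to \<open>p\<close> this shows that such a subgroup fixes \<open>e\<^sub>0\<close>.

  Part (1). The condition on \<open>G\<close> says that \<open>G'\<close> has order prime to \<open>p\<close>
  (\<open>p_nilpotent_abelian_sylow_iff\<close>). Suppose all ordinary characters in the block of \<open>e\<close> are linear,
  and lift \<open>e\<close> to a central idempotent \<open>e'\<close> of \<open>R[G]\<close> (\<open>lift_central_idempotent\<close>). Then \<open>G'\<close> acts trivially in all irreducible
  representations over \<open>K\<close> in which \<open>e'\<close> acts as the identity, so it fixes \<open>e'\<close> and its reduction \<open>e\<close>,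
  and its order is prime to \<open>p\<close>. Conversely, suppose the order of \<open>G'\<close> is prime to \<open>p\<close>. The average
  \<open>E\<close> over \<open>G'\<close> has coefficients in \<open>R\<close>, and the lift \<open>e'\<close> of \<open>e\<^sub>0\<close> satisfies \<open>e' E = e'\<close> because
  \<open>e' - e' E\<close> is an idempotent reducing to 0. So \<open>G'\<close> acts trivially in the irreducible
  representations over \<open>K\<close> of the principal block. Their operators commute, and as \<open>K\<close> is a splitting
  field they have degree 1.

  Part (2). Suppose all simple modules of the block of \<open>e\<close> are linear, and let \<open>l\<close> be the character of
  one of them. The twist of \<open>e\<close> by \<open>l\<close> has augmentation 1, so \<open>e\<^sub>0\<close> absorbs it; this means that
  twisting by \<open>l\<close> takes the simple modules of the principal block to modules of the block of \<open>e\<close>, and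
  so the former are linear too. Let \<open>D\<close> be the intersection of their kernels. It contains \<open>G'\<close>, all
  \<open>p\<close>-elements, since a field of characteristic \<open>p\<close> has no nontrivial roots of unity of \<open>p\<close>-power
  order, and \<open>O\<^sub>p\<^sub>'(G)\<close>, which fixes \<open>e\<^sub>0\<close>. Each \<open>x \<in> D\<close> has a power with exponent a power of \<open>p\<close> in the
  stabilizer of \<open>e\<^sub>0\<close>, a normal subgroup of order prime to \<open>p\<close>, hence in \<open>O\<^sub>p\<^sub>'(G)\<close>; therefore \<open>x\<close> is the
  product of a \<open>p\<close>-element and an element of \<open>O\<^sub>p\<^sub>'(G)\<close>. It follows that
  \<open>D = O\<^sub>p\<^sub>'\<^sub>p(G) = H O\<^sub>p\<^sub>'(G)\<close>, and \<open>G / D\<close> is a \<open>p'\<close>-group because \<open>D\<close> contains the \<open>p\<close>-elements.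
  The kernel of \<open>B\<^sub>0\<^sup>*\<close> involves all modules that afford the Brauer characters of the principal block. A
  linear Brauer character determines the values of its representation at \<open>p\<close>-regular elements, because
  a scalar matrix has only one multiset of lifted eigenvalues (\<open>eigenvalue_lifts_scalar\<close>); at \<open>p\<close>-elements
  these values are trivial. So this kernel is \<open>D\<close> as well. Conversely, if the kernel is
  \<open>H O\<^sub>p\<^sub>'(G)\<close> then it contains \<open>G'\<close>, and as \<open>F\<close> is a splitting field the simple modules of the
  principal block are linear.
\<close>

section \<open>Finite groups and a prime\<close>

locale finite_group = group G for G (structure) +
  assumes finite_carrier [simp]: "finite (carrier G)"

begin

lemma subgroup_finite: "subgroup S G \<Longrightarrow> finite S"
  using finite_carrier finite_subset subgroup.subset by metis

lemma subgroup_card_pos: "subgroup S G \<Longrightarrow> card S > 0"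
  using subgroup_finite subgroup.one_closed by (metis card_gt_0_iff empty_iff)

lemma subgroup_pow_card:
  assumes S: "subgroup S G" and x: "x \<in> S"
  shows "x [^] card S = \<one>"
proof -
  interpret S: group "G\<lparr>carrier := S\<rparr>" by (rule subgroup_imp_group[OF S])
  have "x [^]\<^bsub>G\<lparr>carrier := S\<rparr>\<^esub> order (G\<lparr>carrier := S\<rparr>) = \<one>"
    using S.pow_order_eq_1[of x] x by simp
  then show ?thesis by (simp add: Coset.order_def nat_pow_consistent[symmetric])
qed

lemma subgroup_nat_pow: "subgroup S G \<Longrightarrow> x \<in> S \<Longrightarrow> x [^] (n::nat) \<in> S"
  by (induction n) (auto simp: subgroup.one_closed subgroup.m_closed)

lemma mult_inv_cancel:
  assumes "x \<in> carrier G" "y \<in> carrier G"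
  shows "x \<otimes> (inv x \<otimes> y) = y" "inv x \<otimes> (x \<otimes> y) = y"
  using assms by (simp_all add: m_assoc[symmetric])

lemma eq_if_mult_inv_eq_one:
  assumes "x \<in> carrier G" "y \<in> carrier G" "x \<otimes> inv y = \<one>"
  shows "x = y"
  using inv_equality[OF assms(3)] assms(1,2) by simp

lemma eq_one_if_coprime_powers:
  assumes "x \<in> carrier G" "x [^] (m::nat) = \<one>" "x [^] (n::nat) = \<one>" "coprime m n"
  shows "x = \<one>"
proof -
  have "ord x dvd m" "ord x dvd n" using assms by (simp_all add: pow_eq_id)
  then have "ord x dvd 1" using assms(4) by (meson coprime_common_divisor)
  then show ?thesis using pow_ord_eq_1[OF assms(1)] assms(1) by simp
qed

lemma cauchy:
  assumes S: "subgroup S G" and q: "prime q" "q dvd card S"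
  obtains x where "x \<in> S" "x \<noteq> \<one>" "x [^] q = \<one>"
proof -
  obtain m where m: "card S = q ^ 1 * m" using q(2) by (auto elim: dvdE)
  have "\<exists>H. subgroup H (G\<lparr>carrier := S\<rparr>) \<and> card H = q ^ 1"
    by (rule sylow_thm[OF q(1) subgroup_imp_group[OF S], of 1 m]) (use m subgroup_finite[OF S] in \<open>auto simp: Coset.order_def\<close>)
  then obtain H where H: "subgroup H (G\<lparr>carrier := S\<rparr>)" "card H = q" by auto
  have HG: "subgroup H G" by (rule incl_subgroup[OF S H(1)])
  have "H \<noteq> {\<one>}" using H(2) prime_gt_1_nat[OF q(1)] by auto
  then obtain x where x: "x \<in> H" "x \<noteq> \<one>" using subgroup.one_closed[OF HG] by blast
  then show thesis using that subgroup_pow_card[OF HG] H subgroup.subset[OF H(1)] by auto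
qed

text \<open>
  By Cauchy's theorem, being a \<open>p\<close>-group or a \<open>p'\<close>-group can be tested on elements. In this form both
  properties pass to products and quotients by computing with powers.
\<close>

lemma card_prime_power_iff:
  assumes S: "subgroup S G" and p: "prime p"
  shows "(\<exists>k. card S = p ^ k) \<longleftrightarrow> (\<forall>x \<in> S. \<exists>k. x [^] (p ^ k) = \<one>)"
proof
  assume "\<exists>k. card S = p ^ k"
  then show "\<forall>x \<in> S. \<exists>k. x [^] (p ^ k) = \<one>" using subgroup_pow_card[OF S] by metis
next
  assume pow: "\<forall>x \<in> S. \<exists>k. x [^] (p ^ k) = \<one>"
  obtain m where m: "card S = p ^ multiplicity p (card S) * m" "\<not> p dvd m"
    using multiplicity_decompose'[of "card S" p] subgroup_card_pos[OF S] p
    by (metis not_prime_unit not_gr_zero)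
  have "m = 1"
  proof (rule ccontr)
    assume "m \<noteq> 1"
    then obtain q where q: "prime q" "q dvd m" using prime_factor_nat by blast
    then have "q dvd card S" using m(1) by (metis dvd_mult)
    from cauchy[OF S q(1) this] obtain x where x: "x \<in> S" "x \<noteq> \<one>" "x [^] q = \<one>" .
    obtain k where k: "x [^] (p ^ k) = \<one>" using pow x(1) by blast
    have "q \<noteq> p" using q m(2) by blast
    then have "coprime q (p ^ k)" using q(1) p by (simp add: primes_coprime)
    then have "x = \<one>"
      using eq_one_if_coprime_powers[OF _ x(3) k] subgroup.mem_carrier[OF S x(1)] by blast
    then show False using x(2) by blast
  qed
  then show "\<exists>k. card S = p ^ k" using m(1) by auto
qed

lemma prime_not_dvd_card_iff:
  assumes S: "subgroup S G" and p: "prime p"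
  shows "\<not> p dvd card S \<longleftrightarrow> (\<forall>x \<in> S. \<exists>m. \<not> p dvd m \<and> x [^] (m::nat) = \<one>)"
proof
  assume "\<not> p dvd card S"
  then show "\<forall>x \<in> S. \<exists>m. \<not> p dvd m \<and> x [^] (m::nat) = \<one>" using subgroup_pow_card[OF S] by metis
next
  assume pow: "\<forall>x \<in> S. \<exists>m. \<not> p dvd m \<and> x [^] (m::nat) = \<one>"
  show "\<not> p dvd card S"
  proof
    assume "p dvd card S"
    from cauchy[OF S p this] obtain x where x: "x \<in> S" "x \<noteq> \<one>" "x [^] p = \<one>" .
    obtain m where m: "\<not> p dvd m" "x [^] m = \<one>" using pow x(1) by blast
    have "coprime p m" using p m(1) by (simp add: prime_imp_coprime)
    then show False
      using eq_one_if_coprime_powers[OF _ x(3) m(2)] subgroup.mem_carrier[OF S x(1)] x(2) by blast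
  qed
qed

lemma pow_mult_normal:
  assumes N: "N \<lhd> G" and x: "x \<in> carrier G" and n: "n \<in> N"
  shows "\<exists>n' \<in> N. (x \<otimes> n) [^] (i::nat) = x [^] i \<otimes> n'"
proof (induction i)
  case 0
  then show ?case using normal_imp_subgroup[OF N] by (auto intro!: bexI[of _ \<one>] simp: subgroup.one_closed)
next
  case (Suc i)
  then obtain n' where n': "n' \<in> N" "(x \<otimes> n) [^] i = x [^] i \<otimes> n'" by blast
  note sN = normal_imp_subgroup[OF N]
  have c: "n \<in> carrier G" "n' \<in> carrier G" using n n' subgroup.mem_carrier[OF sN] by auto
  have "inv x \<otimes> n' \<otimes> x \<in> N" using normal.inv_op_closed1[OF N x n'(1)] .
  then have "inv x \<otimes> n' \<otimes> x \<otimes> n \<in> N" using n subgroup.m_closed[OF sN] by blast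
  moreover have "(x \<otimes> n) [^] Suc i = x [^] Suc i \<otimes> (inv x \<otimes> n' \<otimes> x \<otimes> n)"
  proof -
    have "x [^] Suc i \<otimes> (inv x \<otimes> n' \<otimes> x \<otimes> n) = x [^] i \<otimes> (x \<otimes> inv x) \<otimes> n' \<otimes> x \<otimes> n"
      using x c by (simp add: m_assoc mult_inv_cancel)
    then show ?thesis using x c n' by (simp add: m_assoc)
  qed
  ultimately show ?case by blast
qed

lemma normal_set_mult:
  assumes M: "M \<lhd> G" and N: "N \<lhd> G"
  shows "M <#> N \<lhd> G" "M \<subseteq> M <#> N" "N \<subseteq> M <#> N"
proof -
  note sM = normal_imp_subgroup[OF M] and sN = normal_imp_subgroup[OF N]
  interpret second_isomorphism_grp M G N
    using M sN by (simp add: second_isomorphism_grp_def second_isomorphism_grp_axioms_def)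
  have "x \<otimes> h \<otimes> inv x \<in> M <#> N" if x: "x \<in> carrier G" and h: "h \<in> M <#> N" for x h
  proof -
    obtain m n where mn: "m \<in> M" "n \<in> N" "h = m \<otimes> n" using h by (auto simp: set_mult_def)
    have c: "m \<in> carrier G" "n \<in> carrier G"
      using mn subgroup.mem_carrier[OF sM] subgroup.mem_carrier[OF sN] by auto
    have "x \<otimes> h \<otimes> inv x = (x \<otimes> m \<otimes> inv x) \<otimes> (x \<otimes> n \<otimes> inv x)"
    proof -
      have "(x \<otimes> m \<otimes> inv x) \<otimes> (x \<otimes> n \<otimes> inv x) = x \<otimes> m \<otimes> (inv x \<otimes> x) \<otimes> n \<otimes> inv x"
        using x c by (simp add: m_assoc mult_inv_cancel)
      then show ?thesis using x c mn by (simp add: m_assoc)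
    qed
    moreover have "x \<otimes> m \<otimes> inv x \<in> M" "x \<otimes> n \<otimes> inv x \<in> N"
      using normal.inv_op_closed2[OF M x mn(1)] normal.inv_op_closed2[OF N x mn(2)] by auto
    ultimately show ?thesis by (auto simp: set_mult_def)
  qed
  then show "M <#> N \<lhd> G" using normal_set_mult_subgroup by (simp add: normal_inv_iff)
  show "M \<subseteq> M <#> N" "N \<subseteq> M <#> N"
    using S_contained_in_set_mult H_contained_in_set_mult by auto
qed

text \<open>
  The product of two normal subgroups with property \<open>P\<close> has property \<open>P\<close> again, so one of maximal
  order contains all others.
\<close>

lemma largest_normal:
  assumes "P {\<one>}" and prod: "\<And>M N. M \<lhd> G \<Longrightarrow> N \<lhd> G \<Longrightarrow> P M \<Longrightarrow> P N \<Longrightarrow> P (M <#> N)"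
  shows "largest_normal G P \<lhd> G" "P (largest_normal G P)"
    "\<And>M. M \<lhd> G \<Longrightarrow> P M \<Longrightarrow> M \<subseteq> largest_normal G P"
proof -
  let ?Q = "\<lambda>N. N \<lhd> G \<and> P N"
  have "\<forall>N. ?Q N \<longrightarrow> card N < Suc (order G)"
    using card_mono[OF finite_carrier subgroup.subset[OF normal_imp_subgroup]]
    by (auto simp: Coset.order_def less_Suc_eq_le)
  moreover have "?Q {\<one>}" using one_is_normal assms(1) by blast
  ultimately have "\<exists>N. ?Q N \<and> (\<forall>M. ?Q M \<longrightarrow> card M \<le> card N)"
    using ex_has_greatest_nat[of ?Q "{\<one>}" card "Suc (order G)"] by blast
  then obtain N where N: "?Q N" and max: "\<And>M. ?Q M \<Longrightarrow> card M \<le> card N" by blast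
  have largest: "M \<subseteq> N" if M: "M \<lhd> G" "P M" for M
  proof -
    have Q: "?Q (N <#> M)" using N M prod normal_set_mult(1) by blast
    have fin: "finite (N <#> M)" using Q normal_imp_subgroup subgroup_finite by blast
    have "N = N <#> M"
      using card_subset_eq[OF fin normal_set_mult(2)] max[OF Q] card_mono[OF fin normal_set_mult(2)] N M(1)
      by (metis le_antisym)
    then show ?thesis using normal_set_mult(3)[of N M] N M(1) by blast
  qed
  have "largest_normal G P = N"
    unfolding largest_normal_def by (rule the_equality) (use N largest in \<open>auto intro!: equalityI\<close>)
  then show "largest_normal G P \<lhd> G" "P (largest_normal G P)"
    "\<And>M. M \<lhd> G \<Longrightarrow> P M \<Longrightarrow> M \<subseteq> largest_normal G P"
    using N largest by auto
qed

text \<open>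
  Modulo \<open>N\<close> the element \<open>x\<close> lies in the image of \<open>M\<close>, so its power with exponent \<open>card M\<close> lies in
  \<open>N\<close>.
\<close>

lemma set_mult_pow_card:
  assumes M: "M \<lhd> G" and N: "N \<lhd> G" and x: "x \<in> M <#> N"
  shows "x [^] (card M * card N) = \<one>"
proof -
  note sM = normal_imp_subgroup[OF M] and sN = normal_imp_subgroup[OF N]
  obtain m n where mn: "m \<in> M" "n \<in> N" "x = m \<otimes> n" using x by (auto simp: set_mult_def)
  have c: "m \<in> carrier G" "n \<in> carrier G"
    using mn subgroup.mem_carrier[OF sM] subgroup.mem_carrier[OF sN] by auto
  obtain n' where n': "n' \<in> N" "x [^] card M = m [^] card M \<otimes> n'"
    using pow_mult_normal[OF N c(1) mn(2), of "card M"] mn(3) by blast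
  then have "x [^] card M = n'" using subgroup_pow_card[OF sM mn(1)] subgroup.mem_carrier[OF sN] by simp
  then show ?thesis using subgroup_pow_card[OF sN n'(1)] c mn(3) by (simp add: nat_pow_pow[symmetric])
qed

lemma O_p_largest:
  assumes p: "prime p"
  shows "O_p p G \<lhd> G" "p_group_set p (O_p p G)" "\<And>M. M \<lhd> G \<Longrightarrow> p_group_set p M \<Longrightarrow> M \<subseteq> O_p p G"
proof -
  have one: "p_group_set p {\<one>}" by (auto simp: p_group_set_def intro!: exI[of _ 0])
  have prod: "p_group_set p (M <#> N)" if MN: "M \<lhd> G" "N \<lhd> G" "p_group_set p M" "p_group_set p N" for M N
  proof -
    have s: "subgroup (M <#> N) G" using normal_set_mult(1)[OF MN(1,2)] by (rule normal_imp_subgroup)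
    obtain i j where "card M = p ^ i" "card N = p ^ j" using MN(3,4) by (auto simp: p_group_set_def)
    then have "\<forall>x \<in> M <#> N. x [^] (p ^ (i + j)) = \<one>"
      using set_mult_pow_card[OF MN(1,2)] by (simp add: power_add)
    then show ?thesis using card_prime_power_iff[OF s p] subgroup_finite[OF s] by (auto simp: p_group_set_def)
  qed
  show "O_p p G \<lhd> G" "p_group_set p (O_p p G)" "\<And>M. M \<lhd> G \<Longrightarrow> p_group_set p M \<Longrightarrow> M \<subseteq> O_p p G"
    unfolding O_p_def using largest_normal[of "p_group_set p", OF one prod] by blast+
qed

lemma O_p'_largest:
  assumes p: "prime p"
  shows "O_p' p G \<lhd> G" "\<not> p dvd card (O_p' p G)" "\<And>M. M \<lhd> G \<Longrightarrow> \<not> p dvd card M \<Longrightarrow> M \<subseteq> O_p' p G"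
proof -
  have one: "p'_group_set p {\<one>}" using p by (auto simp: p'_group_set_def)
  have prod: "p'_group_set p (M <#> N)" if MN: "M \<lhd> G" "N \<lhd> G" "p'_group_set p M" "p'_group_set p N" for M N
  proof -
    have s: "subgroup (M <#> N) G" using normal_set_mult(1)[OF MN(1,2)] by (rule normal_imp_subgroup)
    have "\<not> p dvd card M * card N" using MN(3,4) p by (auto simp: p'_group_set_def prime_dvd_mult_iff)
    then have "\<not> p dvd card (M <#> N)"
      using set_mult_pow_card[OF MN(1,2)] prime_not_dvd_card_iff[OF s p] by blast
    then show ?thesis using subgroup_finite[OF s] by (auto simp: p'_group_set_def)
  qed
  note l = largest_normal[of "p'_group_set p", OF one prod, folded O_p'_def]
  show "O_p' p G \<lhd> G" using l(1) by blast
  show "\<not> p dvd card (O_p' p G)" using l(2) by (simp add: p'_group_set_def)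
  show "M \<subseteq> O_p' p G" if "M \<lhd> G" "\<not> p dvd card M" for M
  proof -
    have "p'_group_set p M"
      using that subgroup_finite[OF normal_imp_subgroup] by (simp add: p'_group_set_def)
    then show ?thesis using l(3)[of M] that(1) by blast
  qed
qed

lemma finite_group_Mod: "N \<lhd> G \<Longrightarrow> finite_group (G Mod N)"
  by (simp add: finite_group_def finite_group_axioms_def normal.factorgroup_is_group carrier_FactGroup)

lemma Mod_eq_one_iff: "N \<lhd> G \<Longrightarrow> x \<in> carrier G \<Longrightarrow> N #> x = N \<longleftrightarrow> x \<in> N"
  using coset_join1 coset_join2 normal_imp_subgroup by metis

lemma Mod_pow_eq_one_iff:
  assumes "N \<lhd> G" "x \<in> carrier G"
  shows "(N #> x) [^]\<^bsub>G Mod N\<^esub> (k::nat) = \<one>\<^bsub>G Mod N\<^esub> \<longleftrightarrow> x [^] k \<in> N"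
  using assms by (simp add: normal.FactGroup_pow Mod_eq_one_iff)

lemma normal_image_Mod:
  assumes N: "N \<lhd> G" and D: "D \<lhd> G"
  shows "(\<lambda>x. N #> x) ` D \<lhd> G Mod N"
proof -
  interpret Q: finite_group "G Mod N" by (rule finite_group_Mod[OF N])
  interpret group_hom G "G Mod N" "\<lambda>x. N #> x"
    by (intro group_hom.intro group_hom_axioms.intro is_group Q.is_group normal.r_coset_hom_Mod[OF N])
  note sD = normal_imp_subgroup[OF D]
  have "U \<otimes>\<^bsub>G Mod N\<^esub> V \<otimes>\<^bsub>G Mod N\<^esub> inv\<^bsub>G Mod N\<^esub> U \<in> (\<lambda>x. N #> x) ` D"
    if U: "U \<in> carrier (G Mod N)" and V: "V \<in> (\<lambda>x. N #> x) ` D" for U V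
  proof -
    obtain x y where xy: "x \<in> carrier G" "y \<in> D" "U = N #> x" "V = N #> y"
      using U V by (auto simp: carrier_FactGroup)
    have c: "y \<in> carrier G" "x \<otimes> y \<in> carrier G" "inv x \<in> carrier G"
      using xy subgroup.mem_carrier[OF sD] by auto
    have "U \<otimes>\<^bsub>G Mod N\<^esub> V \<otimes>\<^bsub>G Mod N\<^esub> inv\<^bsub>G Mod N\<^esub> U = N #> (x \<otimes> y \<otimes> inv x)"
      unfolding xy(3,4) by (simp only: hom_mult hom_inv xy(1) c)
    moreover have "x \<otimes> y \<otimes> inv x \<in> D" using normal.inv_op_closed2[OF D xy(1,2)] .
    ultimately show ?thesis by blast
  qed
  then show ?thesis using subgroup_img_is_subgroup[OF sD] by (simp add: Q.normal_inv_iff)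
qed

lemma normal_preimage_Mod:
  assumes N: "N \<lhd> G" and D: "D \<lhd> G Mod N"
  shows "{x \<in> carrier G. N #> x \<in> D} \<lhd> G"
proof -
  interpret Q: finite_group "G Mod N" by (rule finite_group_Mod[OF N])
  interpret group_hom G "G Mod N" "\<lambda>x. N #> x"
    by (intro group_hom.intro group_hom_axioms.intro is_group Q.is_group normal.r_coset_hom_Mod[OF N])
  note sD = normal_imp_subgroup[OF D]
  have "subgroup {x \<in> carrier G. N #> x \<in> D} G"
  proof (rule subgroup.intro)
    show "\<one> \<in> {x \<in> carrier G. N #> x \<in> D}" using subgroup.one_closed[OF sD] hom_one by (simp del: one_FactGroup)
    fix x assume x: "x \<in> {x \<in> carrier G. N #> x \<in> D}"
    then have "inv\<^bsub>G Mod N\<^esub> (N #> x) \<in> D" using subgroup.m_inv_closed[OF sD] by blast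
    then show "inv x \<in> {x \<in> carrier G. N #> x \<in> D}" using x by (simp add: hom_inv)
  next
    fix x y assume xy: "x \<in> {x \<in> carrier G. N #> x \<in> D}" "y \<in> {x \<in> carrier G. N #> x \<in> D}"
    then have "(N #> x) \<otimes>\<^bsub>G Mod N\<^esub> (N #> y) \<in> D" using subgroup.m_closed[OF sD] by blast
    then show "x \<otimes> y \<in> {x \<in> carrier G. N #> x \<in> D}"
      using xy by (simp only: hom_mult[symmetric] mem_Collect_eq m_closed simp_thms)
  qed auto
  moreover have "x \<otimes> h \<otimes> inv x \<in> {x \<in> carrier G. N #> x \<in> D}"
    if x: "x \<in> carrier G" and h: "h \<in> {x \<in> carrier G. N #> x \<in> D}" for x h
  proof -
    have hc: "h \<in> carrier G" "x \<otimes> h \<in> carrier G" "inv x \<in> carrier G" using x h by auto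
    have "N #> (x \<otimes> h \<otimes> inv x) = (N #> x) \<otimes>\<^bsub>G Mod N\<^esub> (N #> h) \<otimes>\<^bsub>G Mod N\<^esub> inv\<^bsub>G Mod N\<^esub> (N #> x)"
      by (simp only: hom_mult hom_inv x hc)
    also have "\<dots> \<in> D" using normal.inv_op_closed2[OF D hom_closed[OF x]] h by blast
    finally show ?thesis using x h by simp
  qed
  ultimately show ?thesis by (simp add: normal_inv_iff)
qed

lemma O_p'p_normal: "prime p \<Longrightarrow> O_p'p p G \<lhd> G"
  unfolding O_p'p_def
  by (intro normal_preimage_Mod O_p'_largest(1) finite_group.O_p_largest(1) finite_group_Mod)

text \<open>
  This lemma and the next describe \<open>O\<^sub>p\<^sub>'\<^sub>p(G)\<close> by its elements: it is the largest normal subgroup in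
  which every element has a power with exponent a power of \<open>p\<close> in \<open>O\<^sub>p\<^sub>'(G)\<close>.
\<close>

lemma O_p'p_power:
  assumes p: "prime p" and x: "x \<in> O_p'p p G"
  shows "x \<in> carrier G" "\<exists>k. x [^] (p ^ k) \<in> O_p' p G"
proof -
  let ?N = "O_p' p G"
  note N = O_p'_largest(1)[OF p]
  interpret Q: finite_group "G Mod ?N" by (rule finite_group_Mod[OF N])
  show xc: "x \<in> carrier G" using x by (simp add: O_p'p_def)
  have "\<exists>k. (?N #> x) [^]\<^bsub>G Mod ?N\<^esub> (p ^ k) = \<one>\<^bsub>G Mod ?N\<^esub>"
    using Q.card_prime_power_iff[OF normal_imp_subgroup[OF Q.O_p_largest(1)[OF p]] p] Q.O_p_largest(2)[OF p] x
    by (auto simp: p_group_set_def O_p'p_def)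
  then show "\<exists>k. x [^] (p ^ k) \<in> O_p' p G" by (simp only: Mod_pow_eq_one_iff[OF N xc])
qed

lemma subset_O_p'pI:
  assumes p: "prime p" and D: "D \<lhd> G" and pow: "\<And>x. x \<in> D \<Longrightarrow> \<exists>k. x [^] (p ^ k) \<in> O_p' p G"
  shows "D \<subseteq> O_p'p p G"
proof -
  let ?N = "O_p' p G"
  note N = O_p'_largest(1)[OF p]
  interpret Q: finite_group "G Mod ?N" by (rule finite_group_Mod[OF N])
  let ?D = "(\<lambda>x. ?N #> x) ` D"
  note nD = normal_image_Mod[OF N D] and Dc = subgroup.mem_carrier[OF normal_imp_subgroup[OF D]]
  have "\<forall>U \<in> ?D. \<exists>k. U [^]\<^bsub>G Mod ?N\<^esub> (p ^ k) = \<one>\<^bsub>G Mod ?N\<^esub>"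
  proof
    fix U assume "U \<in> ?D"
    then obtain x where U: "U = ?N #> x" and x: "x \<in> D" by (rule imageE)
    show "\<exists>k. U [^]\<^bsub>G Mod ?N\<^esub> (p ^ k) = \<one>\<^bsub>G Mod ?N\<^esub>"
      unfolding U Mod_pow_eq_one_iff[OF N Dc[OF x]] by (rule pow[OF x])
  qed
  then have "\<exists>k. card ?D = p ^ k"
    by (simp only: Q.card_prime_power_iff[OF normal_imp_subgroup[OF nD] p])
  then have "p_group_set p ?D"
    using Q.subgroup_finite[OF normal_imp_subgroup[OF nD]] by (simp only: p_group_set_def simp_thms)
  then have "?D \<subseteq> O_p p (G Mod ?N)" using Q.O_p_largest(3)[OF p nD] by blast
  then show ?thesis using Dc by (auto simp: O_p'p_def)
qed

text \<open>
  Let \<open>m\<close> be the order of \<open>N\<close>. As \<open>m\<close> is prime to \<open>p\<close>, Bezout's identity writes \<open>x\<close> as the product of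
  a power of the \<open>p\<close>-element \<open>x\<^sup>m\<close> and a power of \<open>x\<^bsup>p^k\<^esup> \<in> N\<close>.
\<close>

lemma p_part_decomposition:
  assumes p: "prime p" and N: "subgroup N G" "\<not> p dvd card N"
    and x: "x \<in> carrier G" "x [^] (p ^ k) \<in> N"
  shows "x \<in> p'_residual p G <#> N"
proof -
  let ?m = "card N"
  have "(x [^] ?m) [^] (p ^ k) = (x [^] (p ^ k)) [^] ?m" using x(1) by (simp add: nat_pow_pow mult.commute)
  also have "\<dots> = \<one>" by (rule subgroup_pow_card[OF N(1) x(2)])
  finally have "ord (x [^] ?m) dvd p ^ k" using x(1) by (simp add: pow_eq_id)
  then obtain j where "ord (x [^] ?m) = p ^ j" using divides_primepow_nat[OF p] by blast
  then have xm: "x [^] ?m \<in> p'_residual p G"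
    unfolding p'_residual_def using x(1) by (intro generate.incl) auto
  have sR: "subgroup (p'_residual p G) G" unfolding p'_residual_def by (rule generate_is_subgroup) auto
  have "coprime ?m (p ^ k)" using prime_imp_coprime[OF p N(2)] by (simp add: coprime_commute)
  moreover have "?m \<noteq> 0" using subgroup_card_pos[OF N(1)] by simp
  ultimately obtain u v where uv: "?m * u = p ^ k * v + 1" using bezout_nat[of ?m "p ^ k"] by (auto simp: coprime_iff_gcd_eq_1)
  have "x [^] (?m * u) = (x [^] (p ^ k)) [^] v \<otimes> x"
    unfolding uv using x(1) by (simp add: nat_pow_pow nat_pow_mult[symmetric])
  moreover have "(x [^] (p ^ k)) [^] v \<in> carrier G" using x(1) by simp
  moreover have "x \<otimes> (x [^] (p ^ k)) [^] v = (x [^] (p ^ k)) [^] v \<otimes> x"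
    using x(1) nat_pow_Suc2[OF x(1), of "p ^ k * v"] by (simp add: nat_pow_pow)
  ultimately have "x = (x [^] ?m) [^] u \<otimes> inv ((x [^] (p ^ k)) [^] v)"
    using x(1) by (simp add: nat_pow_pow inv_solve_right)
  moreover have "(x [^] ?m) [^] u \<in> p'_residual p G" by (rule subgroup_nat_pow[OF sR xm])
  moreover have "inv ((x [^] (p ^ k)) [^] v) \<in> N"
    by (rule subgroup.m_inv_closed[OF N(1) subgroup_nat_pow[OF N(1) x(2)]])
  ultimately show ?thesis unfolding set_mult_def by blast
qed

lemma prime_to_p_part:
  assumes p: "prime p" and x: "x \<in> carrier G"
  obtains k m where "ord x = p ^ k * m" "\<not> p dvd m"
    "(x [^] (p ^ k)) [^] m = \<one>" "\<exists>j. ord (x [^] m) = p ^ j"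
proof -
  have "ord x \<noteq> 0" using ord_ge_1[OF finite_carrier x] by simp
  then obtain m where m: "ord x = p ^ multiplicity p (ord x) * m" "\<not> p dvd m"
    using multiplicity_decompose'[of "ord x" p] p by (metis not_prime_unit)
  let ?k = "multiplicity p (ord x)"
  have one: "x [^] (p ^ ?k * m) = \<one>" using x m(1) by (metis pow_ord_eq_1)
  have "(x [^] m) [^] (p ^ ?k) = \<one>" using one x by (simp add: nat_pow_pow mult.commute)
  then have "ord (x [^] m) dvd p ^ ?k" using x by (simp add: pow_eq_id)
  then have "\<exists>j. ord (x [^] m) = p ^ j" using divides_primepow_nat[OF p] by blast
  then show thesis using that[OF m] one x by (simp add: nat_pow_pow)
qed

text \<open>
  Every element has a power with exponent prime to \<open>p\<close> that is a \<open>p\<close>-element, so the quotient by a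
  normal subgroup containing the \<open>p\<close>-elements is a \<open>p'\<close>-group.
\<close>

lemma O_p'pp'_eq_carrier:
  assumes p: "prime p" and sub: "p'_residual p G \<subseteq> O_p'p p G"
  shows "O_p'pp' p G = carrier G"
proof -
  let ?D = "O_p'p p G"
  note D = O_p'p_normal[OF p]
  interpret Q: finite_group "G Mod ?D" by (rule finite_group_Mod[OF D])
  have "\<exists>m. \<not> p dvd m \<and> U [^]\<^bsub>G Mod ?D\<^esub> (m::nat) = \<one>\<^bsub>G Mod ?D\<^esub>" if U: "U \<in> carrier (G Mod ?D)" for U
  proof -
    obtain x where x: "x \<in> carrier G" "U = ?D #> x" using U by (auto simp: carrier_FactGroup)
    from prime_to_p_part[OF p x(1)] obtain k m where m: "\<not> p dvd m" "\<exists>j. ord (x [^] m) = p ^ j" by metis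
    have "x [^] m \<in> p'_residual p G"
      unfolding p'_residual_def using x(1) m(2) by (intro generate.incl) auto
    then have "U [^]\<^bsub>G Mod ?D\<^esub> m = \<one>\<^bsub>G Mod ?D\<^esub>" unfolding x(2) Mod_pow_eq_one_iff[OF D x(1)] using sub by blast
    then show ?thesis using m(1) by blast
  qed
  then have "\<not> p dvd card (carrier (G Mod ?D))"
    using Q.prime_not_dvd_card_iff[OF Q.subgroup_self p] by blast
  then have "carrier (G Mod ?D) \<subseteq> O_p' p (G Mod ?D)"
    using Q.O_p'_largest(3)[OF p] Q.normal_inv_iff Q.subgroup_self by (metis Q.m_closed Q.inv_closed)
  then show ?thesis by (auto simp: O_p'pp'_def carrier_FactGroup)
qed

lemma coset_eq_iff_normal:
  assumes N: "N \<lhd> G" and x: "x \<in> carrier G" and y: "y \<in> carrier G"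
  shows "N #> x = N #> y \<longleftrightarrow> x \<otimes> inv y \<in> N"
proof -
  note sN = normal_imp_subgroup[OF N]
  have "N #> x = N #> y \<longleftrightarrow> x \<in> N #> y"
    using repr_independence[OF _ y sN] rcos_self[OF x sN] by metis
  also have "\<dots> \<longleftrightarrow> x \<otimes> inv y \<in> N"
  proof
    assume "x \<in> N #> y"
    then obtain n where "n \<in> N" "x = n \<otimes> y" by (auto simp: r_coset_def)
    then show "x \<otimes> inv y \<in> N" using subgroup.mem_carrier[OF sN] y by (simp add: m_assoc)
  next
    assume a: "x \<otimes> inv y \<in> N"
    have "x = (x \<otimes> inv y) \<otimes> y" using x y by (simp add: m_assoc)
    then show "x \<in> N #> y" using a by (auto simp: r_coset_def)
  qed
  finally show ?thesis .
qed

text \<open>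
  If \<open>N\<close> is a normal \<open>p\<close>-complement, a Sylow \<open>p\<close>-subgroup maps isomorphically onto \<open>G / N\<close>; if it is
  abelian, then \<open>N\<close> contains \<open>G'\<close>, whose order is thus prime to \<open>p\<close>. Conversely, suppose that the order
  of \<open>G'\<close> is prime to \<open>p\<close>. The elements whose order modulo \<open>G'\<close> is prime to \<open>p\<close> form a normal
  \<open>p\<close>-complement, and the Sylow \<open>p\<close>-subgroups meet \<open>G'\<close> trivially, so they embed into the abelian group
  \<open>G / G'\<close>.
\<close>

lemma p_nilpotent_abelian_sylow_iff:
  assumes p: "prime p"
  shows "p_nilpotent p G \<and> (\<exists>P. sylow_subgroup p G P \<and> comm_group (G\<lparr>carrier := P\<rparr>))
    \<longleftrightarrow> \<not> p dvd card (derived G (carrier G))"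
proof
  assume asm: "p_nilpotent p G \<and> (\<exists>P. sylow_subgroup p G P \<and> comm_group (G\<lparr>carrier := P\<rparr>))"
  then obtain N k where N: "N \<lhd> G" "\<not> p dvd card N" and k: "card (rcosets N) = p ^ k"
    by (auto simp: p_nilpotent_def)
  obtain P where P: "subgroup P G" "card P = p ^ multiplicity p (order G)"
    and comm: "comm_group (G\<lparr>carrier := P\<rparr>)" using asm by (auto simp: sylow_subgroup_def)
  note sN = normal_imp_subgroup[OF N(1)]
  have "order G = p ^ k * card N" using lagrange[OF sN] k by simp
  then have "multiplicity p (order G) = k"
    using N(2) p subgroup_card_pos[OF sN]
    by (simp add: prime_elem_multiplicity_mult_distrib not_dvd_imp_multiplicity_0 multiplicity_same_power)
  then have cP: "card P = p ^ k" using P(2) by simp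
  \<comment> \<open>\<open>P\<close> and \<open>N\<close> have coprime orders, so \<open>P\<close> injects into \<open>G / N\<close>, and it has the right size.\<close>
  have "inj_on (\<lambda>x. N #> x) P"
  proof (rule inj_onI)
    fix x y assume xy: "x \<in> P" "y \<in> P" "N #> x = N #> y"
    have c: "x \<in> carrier G" "y \<in> carrier G" using xy subgroup.mem_carrier[OF P(1)] by auto
    have "x \<otimes> inv y \<in> N" using xy(3) coset_eq_iff_normal[OF N(1) c] by blast
    moreover have "x \<otimes> inv y \<in> P" using xy P(1) by (simp add: subgroup.m_closed subgroup.m_inv_closed)
    moreover have "coprime (card N) (card P)"
      using prime_imp_coprime[OF p N(2)] by (simp add: cP coprime_commute)
    ultimately have "x \<otimes> inv y = \<one>"
      using eq_one_if_coprime_powers[of "x \<otimes> inv y"] subgroup_pow_card[OF sN] subgroup_pow_card[OF P(1)] c by blast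
    then show "x = y" by (rule eq_if_mult_inv_eq_one[OF c])
  qed
  then have "card ((\<lambda>x. N #> x) ` P) = card (rcosets N)" using k cP by (simp add: card_image)
  moreover have "(\<lambda>x. N #> x) ` P \<subseteq> rcosets N" using subgroup.mem_carrier[OF P(1)] by (auto simp: RCOSETS_def)
  moreover have "finite (rcosets N)" by (auto simp: RCOSETS_def)
  ultimately have surj: "(\<lambda>x. N #> x) ` P = rcosets N" by (metis card_subset_eq)
  have "g \<otimes> h \<otimes> inv g \<otimes> inv h \<in> N" if g: "g \<in> carrier G" and h: "h \<in> carrier G" for g h
  proof -
    have "N #> g \<in> rcosets N" "N #> h \<in> rcosets N" using g h by (auto simp: RCOSETS_def)
    then obtain x y where xy: "x \<in> P" "N #> g = N #> x" "y \<in> P" "N #> h = N #> y" unfolding surj[symmetric] by auto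
    have c: "x \<in> carrier G" "y \<in> carrier G" using xy subgroup.mem_carrier[OF P(1)] by auto
    have xyc: "x \<otimes> y = y \<otimes> x" using comm_groupE(4)[OF comm] xy by simp
    have "N #> (g \<otimes> h) = N #> (h \<otimes> g)"
      using xyc by (simp add: normal.rcos_sum[OF N(1), symmetric] g h xy(2,4)) (simp add: normal.rcos_sum[OF N(1)] c)
    then have "(g \<otimes> h) \<otimes> inv (h \<otimes> g) \<in> N" using coset_eq_iff_normal[OF N(1)] g h by simp
    then show ?thesis using g h by (simp add: inv_mult_group m_assoc)
  qed
  then have "derived G (carrier G) \<subseteq> N"
    unfolding derived_def by (intro generate_subgroup_incl[OF _ sN]) blast
  then show "\<not> p dvd card (derived G (carrier G))"
    using N(2) prime_not_dvd_card_iff[OF sN p] prime_not_dvd_card_iff[OF derived_is_subgroup[of "carrier G"] p] by blast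
next
  let ?D = "derived G (carrier G)"
  assume D': "\<not> p dvd card ?D"
  have D: "?D \<lhd> G" by (rule derived_is_normal) (simp add: normal_inv_iff subgroup_self)
  note sD = normal_imp_subgroup[OF D]
  interpret Q: comm_group "G Mod ?D" by (rule derived_quot_is_comm_group)
  interpret group_hom G "G Mod ?D" "\<lambda>x. ?D #> x"
    by (intro group_hom.intro group_hom_axioms.intro is_group Q.is_group normal.r_coset_hom_Mod[OF D])
  define N where "N = {x \<in> carrier G. \<exists>m. \<not> p dvd m \<and> x [^] (m::nat) \<in> ?D}"
  have comm: "?D #> (x \<otimes> y) = ?D #> (y \<otimes> x)" if "x \<in> carrier G" "y \<in> carrier G" for x y
    using that Q.m_comm[of "?D #> x" "?D #> y"] by (simp only: hom_mult[symmetric] hom_closed)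
  have sN: "subgroup N G"
  proof (rule subgroup.intro)
    show "N \<subseteq> carrier G" by (auto simp: N_def)
    show "\<one> \<in> N" using p subgroup.one_closed[OF sD] by (auto simp: N_def intro!: exI[of _ 1])
    fix x assume x: "x \<in> N"
    then obtain m where m: "x \<in> carrier G" "\<not> p dvd m" "x [^] m \<in> ?D" by (auto simp: N_def)
    then have "inv x [^] m \<in> ?D" using subgroup.m_inv_closed[OF sD] by (simp add: nat_pow_inv)
    then show "inv x \<in> N" using m by (auto simp: N_def)
    fix y assume y: "y \<in> N"
    then obtain m' where m': "y \<in> carrier G" "\<not> p dvd m'" "y [^] m' \<in> ?D" by (auto simp: N_def)
    have "((?D #> x) \<otimes>\<^bsub>G Mod ?D\<^esub> (?D #> y)) [^]\<^bsub>G Mod ?D\<^esub> (m * m')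
        = (?D #> x) [^]\<^bsub>G Mod ?D\<^esub> (m * m') \<otimes>\<^bsub>G Mod ?D\<^esub> (?D #> y) [^]\<^bsub>G Mod ?D\<^esub> (m * m')"
      by (rule Q.pow_mult_distrib[OF Q.m_comm]) (use m m' in auto)
    moreover have "(?D #> x) [^]\<^bsub>G Mod ?D\<^esub> (m * m') = \<one>\<^bsub>G Mod ?D\<^esub>"
      unfolding Mod_pow_eq_one_iff[OF D m(1)] using subgroup_nat_pow[OF sD m(3), of m'] m(1) by (simp add: nat_pow_pow)
    moreover have "(?D #> y) [^]\<^bsub>G Mod ?D\<^esub> (m * m') = \<one>\<^bsub>G Mod ?D\<^esub>"
      unfolding Mod_pow_eq_one_iff[OF D m'(1)] using subgroup_nat_pow[OF sD m'(3), of m] m'(1)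
      by (simp add: nat_pow_pow mult.commute)
    ultimately have "(?D #> (x \<otimes> y)) [^]\<^bsub>G Mod ?D\<^esub> (m * m') = \<one>\<^bsub>G Mod ?D\<^esub>"
      using m(1) m'(1) by (simp only: hom_mult Q.l_one Q.one_closed)
    then have "(x \<otimes> y) [^] (m * m') \<in> ?D" using Mod_pow_eq_one_iff[OF D] m(1) m'(1) by blast
    moreover have "\<not> p dvd m * m'" using m m' p by (simp add: prime_dvd_mult_iff)
    ultimately show "x \<otimes> y \<in> N" using m(1) m'(1) by (auto simp: N_def)
  qed
  have "x \<otimes> h \<otimes> inv x \<in> N" if x: "x \<in> carrier G" and h: "h \<in> N" for x h
  proof -
    obtain m where m: "h \<in> carrier G" "\<not> p dvd m" "h [^] m \<in> ?D" using h by (auto simp: N_def)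
    have "?D #> (x \<otimes> h \<otimes> inv x) = ?D #> (inv x \<otimes> (x \<otimes> h))"
      by (rule comm) (use x m in auto)
    also have "inv x \<otimes> (x \<otimes> h) = h" using x m by (simp add: m_assoc[symmetric])
    finally have "(x \<otimes> h \<otimes> inv x) [^] m \<in> ?D"
      using Mod_pow_eq_one_iff[OF D, of h m] Mod_pow_eq_one_iff[OF D, of "x \<otimes> h \<otimes> inv x" m] m x by simp
    then show ?thesis using m x by (auto simp: N_def)
  qed
  then have N: "N \<lhd> G" using sN by (simp add: normal_inv_iff)
  have "\<exists>j. \<not> p dvd j \<and> x [^] (j::nat) = \<one>" if x: "x \<in> N" for x
  proof -
    obtain m where m: "x \<in> carrier G" "\<not> p dvd m" "x [^] m \<in> ?D" using x by (auto simp: N_def)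
    have "x [^] (m * card ?D) = \<one>" using subgroup_pow_card[OF sD m(3)] m(1) by (simp add: nat_pow_pow)
    moreover have "\<not> p dvd m * card ?D" using m D' p by (simp add: prime_dvd_mult_iff)
    ultimately show ?thesis by blast
  qed
  then have N': "\<not> p dvd card N" using prime_not_dvd_card_iff[OF sN p] by blast
  interpret QN: finite_group "G Mod N" by (rule finite_group_Mod[OF N])
  have "\<exists>k. U [^]\<^bsub>G Mod N\<^esub> (p ^ k) = \<one>\<^bsub>G Mod N\<^esub>" if U: "U \<in> carrier (G Mod N)" for U
  proof -
    obtain x where x: "x \<in> carrier G" "U = N #> x" using U by (auto simp: carrier_FactGroup)
    from prime_to_p_part[OF p x(1)] obtain k m where m: "\<not> p dvd m" "(x [^] (p ^ k)) [^] m = \<one>" by metis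
    then have "x [^] (p ^ k) \<in> N" using x(1) subgroup.one_closed[OF sD] by (auto simp: N_def)
    then show ?thesis unfolding x(2) Mod_pow_eq_one_iff[OF N x(1)] by blast
  qed
  then have "\<exists>k. card (carrier (G Mod N)) = p ^ k"
    using QN.card_prime_power_iff[OF QN.subgroup_self p] by blast
  then have nil: "p_nilpotent p G" using N N' by (auto simp: p_nilpotent_def FactGroup_def)
  obtain m where "order G = p ^ multiplicity p (order G) * m"
    using multiplicity_dvd[of p "order G"] by (auto elim: dvdE)
  from sylow_thm[OF p is_group this finite_carrier]
  obtain P where P: "subgroup P G" "card P = p ^ multiplicity p (order G)" by blast
  have Pc: "x \<in> carrier G" if "x \<in> P" for x using subgroup.mem_carrier[OF P(1) that] .
  have "x \<otimes> y = y \<otimes> x" if xy: "x \<in> P" "y \<in> P" for x y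
  proof -
    note c = Pc[OF xy(1)] Pc[OF xy(2)]
    let ?z = "(x \<otimes> y) \<otimes> inv (y \<otimes> x)"
    have c2: "x \<otimes> y \<in> carrier G" "y \<otimes> x \<in> carrier G" "?z \<in> carrier G" using c by auto
    have "?z \<in> ?D" using comm[OF c] unfolding coset_eq_iff_normal[OF D c2(1,2)] .
    moreover have "?z \<in> P" using xy P(1) by (simp add: subgroup.m_closed subgroup.m_inv_closed)
    moreover have "coprime (card ?D) (card P)"
      using prime_imp_coprime[OF p D'] by (simp add: P(2) coprime_commute)
    ultimately have "?z = \<one>"
      using eq_one_if_coprime_powers[of ?z] subgroup_pow_card[OF sD] subgroup_pow_card[OF P(1)] c2(3) by blast
    then show ?thesis by (rule eq_if_mult_inv_eq_one[OF c2(1,2)])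
  qed
  then have "comm_group (G\<lparr>carrier := P\<rparr>)"
    by (intro group.group_comm_groupI subgroup_imp_group[OF P(1)]) auto
  then show "p_nilpotent p G \<and> (\<exists>P. sylow_subgroup p G P \<and> comm_group (G\<lparr>carrier := P\<rparr>))"
    using nil P by (auto simp: sylow_subgroup_def)
qed

end

section \<open>Idempotents of a ring\<close>

lemma (in ring) central_closed:
  assumes x: "x \<in> carrier R" "\<forall>y \<in> carrier R. x \<otimes> y = y \<otimes> x"
    and z: "z \<in> carrier R" "\<forall>y \<in> carrier R. z \<otimes> y = y \<otimes> z"
  shows "\<forall>y \<in> carrier R. (x \<ominus> z) \<otimes> y = y \<otimes> (x \<ominus> z)"
    and "\<forall>y \<in> carrier R. (x \<oplus> z) \<otimes> y = y \<otimes> (x \<oplus> z)"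
    and "\<forall>y \<in> carrier R. (x \<otimes> z) \<otimes> y = y \<otimes> (x \<otimes> z)"
proof -
  show "\<forall>y \<in> carrier R. (x \<ominus> z) \<otimes> y = y \<otimes> (x \<ominus> z)"
  proof
    fix y assume y: "y \<in> carrier R"
    have "(x \<ominus> z) \<otimes> y = x \<otimes> y \<ominus> z \<otimes> y" using x(1) z(1) y by (simp add: minus_eq l_distr l_minus)
    also have "\<dots> = y \<otimes> x \<ominus> y \<otimes> z" using x(2) z(2) y by metis
    also have "\<dots> = y \<otimes> (x \<ominus> z)" using x(1) z(1) y by (simp add: minus_eq r_distr r_minus)
    finally show "(x \<ominus> z) \<otimes> y = y \<otimes> (x \<ominus> z)" .
  qed
  show "\<forall>y \<in> carrier R. (x \<oplus> z) \<otimes> y = y \<otimes> (x \<oplus> z)"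
  proof
    fix y assume y: "y \<in> carrier R"
    have "(x \<oplus> z) \<otimes> y = x \<otimes> y \<oplus> z \<otimes> y" using x(1) z(1) y by (simp add: l_distr)
    also have "\<dots> = y \<otimes> x \<oplus> y \<otimes> z" using x(2) z(2) y by metis
    also have "\<dots> = y \<otimes> (x \<oplus> z)" using x(1) z(1) y by (simp add: r_distr)
    finally show "(x \<oplus> z) \<otimes> y = y \<otimes> (x \<oplus> z)" .
  qed
  show "\<forall>y \<in> carrier R. (x \<otimes> z) \<otimes> y = y \<otimes> (x \<otimes> z)"
    using x z by (metis m_assoc)
qed

lemma (in ring) central_idempotent_mult:
  assumes e: "central_idempotent R e" and f: "central_idempotent R f"
  shows "central_idempotent R (e \<otimes> f)"
proof -
  have ec: "e \<in> carrier R" and ee: "e \<otimes> e = e" and ez: "\<forall>a \<in> carrier R. e \<otimes> a = a \<otimes> e"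
    and fc: "f \<in> carrier R" and ff: "f \<otimes> f = f" and fz: "\<forall>a \<in> carrier R. f \<otimes> a = a \<otimes> f"
    using e f unfolding central_idempotent_def by blast+
  have "(e \<otimes> f) \<otimes> (e \<otimes> f) = e \<otimes> (f \<otimes> e) \<otimes> f" using ec fc by (simp add: m_assoc)
  also have "f \<otimes> e = e \<otimes> f" using fz ec by blast
  also have "e \<otimes> (e \<otimes> f) \<otimes> f = (e \<otimes> e) \<otimes> (f \<otimes> f)"
    using ec fc by (simp only: m_assoc m_closed)
  finally have "(e \<otimes> f) \<otimes> (e \<otimes> f) = e \<otimes> f" by (simp only: ee ff)
  then show ?thesis
    unfolding central_idempotent_def by (intro conjI m_closed ec fc central_closed(3)[OF ec ez fc fz])
qed

lemma (in ring) central_idempotent_diff: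
  assumes e: "central_idempotent R e" and f: "central_idempotent R f"
  shows "central_idempotent R (e \<ominus> e \<otimes> f)" "(e \<otimes> f) \<otimes> (e \<ominus> e \<otimes> f) = \<zero>"
proof -
  have ec: "e \<in> carrier R" and ee: "e \<otimes> e = e" and ez: "\<forall>a \<in> carrier R. e \<otimes> a = a \<otimes> e"
    and fc: "f \<in> carrier R" using e f unfolding central_idempotent_def by blast+
  let ?a = "e \<otimes> f"
  have ac: "?a \<in> carrier R" and aa: "?a \<otimes> ?a = ?a" and az: "\<forall>x \<in> carrier R. ?a \<otimes> x = x \<otimes> ?a"
    using central_idempotent_mult[OF e f] unfolding central_idempotent_def by blast+
  have ea: "e \<otimes> ?a = ?a" using ec fc ee by (simp add: m_assoc[symmetric])
  have ae: "?a \<otimes> e = ?a" using ez ea ac by metis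
  have bb: "(e \<ominus> ?a) \<otimes> (e \<ominus> ?a) = e \<ominus> ?a"
    using ec ac by (simp add: minus_eq l_distr r_distr r_minus l_minus aa ae ea ee) (simp add: a_assoc r_neg l_neg)
  show "central_idempotent R (e \<ominus> ?a)"
    unfolding central_idempotent_def by (intro conjI minus_closed ec ac bb central_closed(1)[OF ec ez ac az])
  show "?a \<otimes> (e \<ominus> ?a) = \<zero>" using ec ac by (simp add: minus_eq r_distr r_minus aa ae r_neg)
qed

text \<open>
  Otherwise \<open>e f\<close> and \<open>e - e f\<close> would split \<open>e\<close>.
\<close>

lemma (in ring) block_idempotent_absorb:
  assumes e: "block_idempotent R e" and f: "central_idempotent R f" and nz: "e \<otimes> f \<noteq> \<zero>"
  shows "e \<otimes> f = e"
proof (rule ccontr)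
  assume ne: "e \<otimes> f \<noteq> e"
  have ce: "central_idempotent R e" using e by (simp add: block_idempotent_def)
  have ec: "e \<in> carrier R" and ac: "e \<otimes> f \<in> carrier R"
    using ce central_idempotent_mult[OF ce f] unfolding central_idempotent_def by blast+
  have "e = e \<otimes> f \<oplus> (e \<ominus> e \<otimes> f)"
    using ec ac a_comm[OF ac minus_closed[OF ec ac]] by (simp add: minus_eq a_assoc l_neg)
  moreover have "e \<ominus> e \<otimes> f \<noteq> \<zero>" using ne unfolding r_right_minus_eq[OF ec ac] by metis
  ultimately have "\<exists>e1 e2. central_idempotent R e1 \<and> central_idempotent R e2 \<and> e1 \<noteq> \<zero> \<and> e2 \<noteq> \<zero> \<and>
      e1 \<otimes> e2 = \<zero> \<and> e = e1 \<oplus> e2"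
    using nz central_idempotent_mult[OF ce f] central_idempotent_diff[OF ce f]
    by (intro exI[of _ "e \<otimes> f"] exI[of _ "e \<ominus> e \<otimes> f"] conjI)
  then show False using e unfolding block_idempotent_def by blast
qed

text \<open>
  A block determines its block idempotent: a nonzero central idempotent \<open>f\<close> in the block of \<open>e\<close>
  satisfies \<open>f e = f\<close>, while \<open>e\<close> absorbs it.
\<close>

lemma (in ring) block_idempotent_in_block:
  assumes e: "block_idempotent R e" and f: "block_idempotent R f" and fe: "f \<in> block_algebra R e"
  shows "f = e"
proof -
  have c: "e \<in> carrier R" "f \<in> carrier R" "e \<otimes> e = e" "f \<noteq> \<zero>" "e \<otimes> f = f \<otimes> e"
    and ce: "central_idempotent R e" "central_idempotent R f"
    using e f unfolding block_idempotent_def central_idempotent_def by blast+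
  obtain a where a: "a \<in> carrier R" "f = a \<otimes> e" using fe by (auto simp: block_algebra_def)
  have fe: "f \<otimes> e = f" unfolding a(2) using a(1) c(1,3) by (simp only: m_assoc)
  then have "e \<otimes> f \<noteq> \<zero>" using c(4,5) by metis
  from block_idempotent_absorb[OF e ce(2) this] show ?thesis using fe c(5) by metis
qed

text \<open>
  The Newton step \<open>a \<mapsto> 3a\<^sup>2 - 2a\<^sup>3\<close> for the equation \<open>X\<^sup>2 = X\<close>. The derivative \<open>2a - 1\<close> is its own
  inverse modulo the defect \<open>t = a\<^sup>2 - a\<close>, since \<open>(2a - 1)\<^sup>2 = 4t + 1\<close>. The new defect is
  \<open>t\<^sup>2 (4t - 3)\<close>; here \<open>q = 4t\<close>, and both factors on the right are divisible by \<open>t\<close>.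
\<close>

lemma (in ring) newton_idempotent:
  assumes a: "a \<in> carrier R"
  defines "t \<equiv> a \<otimes> a \<ominus> a"
  defines "b \<equiv> a \<ominus> (a \<oplus> a \<ominus> \<one>) \<otimes> t"
  defines "q \<equiv> t \<oplus> t \<oplus> t \<oplus> t"
  shows "b \<otimes> b \<ominus> b = t \<otimes> ((q \<oplus> \<one>) \<otimes> t \<ominus> q)"
proof -
  define u where "u = a \<oplus> a \<ominus> \<one>"
  define v where "v = u \<otimes> t"
  have t: "t \<in> carrier R" and u: "u \<in> carrier R" and v: "v \<in> carrier R"
    using a by (simp_all add: t_def u_def v_def)
  have b: "b = a \<ominus> v" by (simp add: b_def u_def v_def)
  have ut': "a \<otimes> t = t \<otimes> a" and ua: "a \<otimes> u = u \<otimes> a"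
    using a by (simp_all add: t_def u_def minus_eq l_distr r_distr l_minus r_minus m_assoc)
  have ut: "u \<otimes> t = t \<otimes> u"
    using a t by (simp add: u_def minus_eq l_distr r_distr l_minus r_minus ut')
  have "a \<otimes> v = u \<otimes> (a \<otimes> t)" using a u t by (simp add: v_def ua m_assoc[symmetric])
  then have va: "a \<otimes> v = v \<otimes> a" using a u t by (simp add: v_def ut' m_assoc)
  have q: "q \<in> carrier R" and tq: "t \<otimes> q = q \<otimes> t" using t by (simp_all add: q_def l_distr r_distr)
  have "u \<otimes> u = (a \<otimes> a \<ominus> a) \<oplus> (a \<otimes> a \<ominus> a) \<oplus> (a \<otimes> a \<ominus> a) \<oplus> (a \<otimes> a \<ominus> a) \<oplus> \<one>"
    using a by (simp add: u_def minus_eq l_distr r_distr l_minus r_minus a_ac minus_add)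
  then have uu: "u \<otimes> u = q \<oplus> \<one>" by (simp only: q_def t_def)
  have "v \<otimes> v = u \<otimes> (t \<otimes> u) \<otimes> t" using u t by (simp add: v_def m_assoc)
  also have "\<dots> = u \<otimes> u \<otimes> t \<otimes> t" using u t by (simp add: ut[symmetric] m_assoc)
  finally have vv: "v \<otimes> v = (q \<oplus> \<one>) \<otimes> t \<otimes> t" by (simp only: uu)
  have "u \<otimes> v = u \<otimes> u \<otimes> t" using u t by (simp add: v_def m_assoc)
  then have uv: "u \<otimes> v = (q \<oplus> \<one>) \<otimes> t" by (simp only: uu)
  have "b \<otimes> b \<ominus> b = t \<ominus> (a \<otimes> v \<oplus> v \<otimes> a \<ominus> v) \<oplus> v \<otimes> v"
    using a v unfolding b t_def minus_eq by algebra
  also have "a \<otimes> v \<oplus> v \<otimes> a \<ominus> v = u \<otimes> v"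
    unfolding va[symmetric] u_def minus_eq using a v by (simp add: l_distr l_minus)
  also have "t \<ominus> u \<otimes> v \<oplus> v \<otimes> v = (q \<oplus> \<one>) \<otimes> t \<otimes> t \<ominus> q \<otimes> t"
    unfolding uv vv using t q unfolding minus_eq by algebra
  also have "\<dots> = t \<otimes> ((q \<oplus> \<one>) \<otimes> t \<ominus> q)"
    using t q tq by (simp add: minus_eq r_distr r_minus l_distr m_assoc[symmetric])
  finally show ?thesis .
qed

section \<open>The group algebra\<close>

context finite_group begin

abbreviation (input) GA :: "('a \<Rightarrow> 'c::comm_ring_1) ring" where "GA \<equiv> group_algebra G"

abbreviation convolution :: "('a \<Rightarrow> 'c::comm_ring_1) \<Rightarrow> ('a \<Rightarrow> 'c) \<Rightarrow> 'a \<Rightarrow> 'c" (infixl "\<star>" 70) where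
  "a \<star> b \<equiv> a \<otimes>\<^bsub>group_algebra G\<^esub> b"

definition delta :: "'a \<Rightarrow> 'a \<Rightarrow> 'c::comm_ring_1" where
  "delta x = (\<lambda>g. if g = x then 1 else 0)"

lemma sum_left_translate:
  assumes "x \<in> carrier G"
  shows "(\<Sum>g\<in>carrier G. f (x \<otimes> g)) = (\<Sum>g\<in>carrier G. f g)"
proof (rule sum.reindex_bij_betw)
  show "bij_betw (\<lambda>g. x \<otimes> g) (carrier G) (carrier G)"
    by (rule bij_betw_byWitness[where f' = "\<lambda>g. inv x \<otimes> g"])
       (use assms in \<open>auto simp: m_assoc[symmetric]\<close>)
qed

lemma sum_inv_translate:
  assumes "x \<in> carrier G"
  shows "(\<Sum>g\<in>carrier G. f (x \<otimes> inv g)) = (\<Sum>g\<in>carrier G. f g)"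
proof (rule sum.reindex_bij_betw)
  show "bij_betw (\<lambda>g. x \<otimes> inv g) (carrier G) (carrier G)"
    by (rule bij_betw_byWitness[where f' = "\<lambda>g. inv g \<otimes> x"])
       (use assms in \<open>auto simp: m_assoc inv_mult_group\<close>, simp_all add: m_assoc[symmetric])
qed

lemma carrier_GA: "a \<in> carrier GA \<longleftrightarrow> (\<forall>g. g \<notin> carrier G \<longrightarrow> a g = 0)"
  by (simp add: group_algebra_def)

lemma GA_eqI:
  assumes "a \<in> carrier GA" "b \<in> carrier GA" "\<And>g. g \<in> carrier G \<Longrightarrow> a g = b g"
  shows "a = b"
  using assms by (auto simp: carrier_GA fun_eq_iff) metis

lemma GA_add: "(a \<oplus>\<^bsub>GA\<^esub> b) = (\<lambda>g. a g + b g)"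
  and GA_zero: "\<zero>\<^bsub>GA\<^esub> = (\<lambda>_. 0)"
  and GA_one: "\<one>\<^bsub>GA\<^esub> = delta \<one>"
  by (simp_all add: group_algebra_def delta_def fun_eq_iff)

lemma GA_mult:
  "g \<in> carrier G \<Longrightarrow> (a \<star> b) g = (\<Sum>h\<in>carrier G. a h * b (inv h \<otimes> g))"
  by (simp add: group_algebra_def)

lemma GA_mult_closed: "a \<star> b \<in> carrier GA"
  by (simp add: group_algebra_def)

lemma delta_closed: "x \<in> carrier G \<Longrightarrow> delta x \<in> carrier GA"
  by (auto simp: carrier_GA delta_def)

lemma delta_mult:
  assumes "x \<in> carrier G" "g \<in> carrier G"
  shows "(delta x \<star> a) g = a (inv x \<otimes> g)"
proof -
  have "(delta x \<star> a) g = (\<Sum>h\<in>carrier G. if h = x then a (inv h \<otimes> g) else 0)"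
    unfolding GA_mult[OF assms(2)] by (intro sum.cong) (auto simp: delta_def)
  also have "\<dots> = a (inv x \<otimes> g)" using assms by (simp add: sum.delta)
  finally show ?thesis .
qed

lemma GA_mult':
  assumes "g \<in> carrier G"
  shows "(a \<star> b) g = (\<Sum>h\<in>carrier G. a (g \<otimes> inv h) * b h)"
proof -
  have "(\<Sum>h\<in>carrier G. a (g \<otimes> inv h) * b (inv (g \<otimes> inv h) \<otimes> g)) = (a \<star> b) g"
    unfolding GA_mult[OF assms] by (rule sum_inv_translate[OF assms])
  moreover have "inv (g \<otimes> inv h) \<otimes> g = h" if "h \<in> carrier G" for h
    using assms that by (simp add: inv_mult_group m_assoc)
  ultimately show ?thesis by simp
qed

lemma mult_delta:
  assumes "x \<in> carrier G" "g \<in> carrier G"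
  shows "(a \<star> delta x) g = a (g \<otimes> inv x)"
proof -
  have "(a \<star> delta x) g = (\<Sum>h\<in>carrier G. if h = x then a (g \<otimes> inv h) else 0)"
    unfolding GA_mult'[OF assms(2)] by (intro sum.cong) (auto simp: delta_def)
  also have "\<dots> = a (g \<otimes> inv x)" using assms by (simp add: sum.delta)
  finally show ?thesis .
qed

lemma ring_GA: "ring (GA :: ('a \<Rightarrow> 'c::comm_ring_1) ring)"
proof (rule ringI)
  show "abelian_group (GA :: ('a \<Rightarrow> 'c) ring)"
  proof (rule abelian_groupI)
    fix a :: "'a \<Rightarrow> 'c" assume a: "a \<in> carrier GA"
    show "\<exists>y\<in>carrier GA. y \<oplus>\<^bsub>GA\<^esub> a = \<zero>\<^bsub>GA\<^esub>"
      by (rule bexI[of _ "\<lambda>g. - a g"]) (use a in \<open>auto simp: GA_add GA_zero carrier_GA\<close>)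
  qed (auto simp: GA_add GA_zero carrier_GA algebra_simps)
  show "monoid (GA :: ('a \<Rightarrow> 'c) ring)"
  proof (rule monoidI)
    fix a b c :: "'a \<Rightarrow> 'c"
    assume "a \<in> carrier GA" "b \<in> carrier GA" "c \<in> carrier GA"
    show "a \<star> b \<star> c = a \<star> (b \<star> c)"
    proof (rule GA_eqI)
      fix g assume g: "g \<in> carrier G"
      have "(a \<star> b \<star> c) g
          = (\<Sum>h\<in>carrier G. \<Sum>k\<in>carrier G. a k * (b (inv k \<otimes> h) * c (inv h \<otimes> g)))"
        unfolding GA_mult[OF g] by (intro sum.cong) (simp_all add: GA_mult sum_distrib_right mult.assoc)
      also have "\<dots> = (\<Sum>k\<in>carrier G. \<Sum>h\<in>carrier G. a k * (b (inv k \<otimes> h) * c (inv h \<otimes> g)))"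
        by (rule sum.swap)
      also have "\<dots> = (\<Sum>k\<in>carrier G. a k * (b \<star> c) (inv k \<otimes> g))"
      proof (rule sum.cong[OF refl])
        fix k assume k: "k \<in> carrier G"
        have "(\<Sum>h\<in>carrier G. a k * (b (inv k \<otimes> h) * c (inv h \<otimes> g)))
            = (\<Sum>h\<in>carrier G. a k * (b (inv k \<otimes> (k \<otimes> h)) * c (inv (k \<otimes> h) \<otimes> g)))"
          by (rule sum_left_translate[OF k, symmetric])
        also have "\<dots> = (\<Sum>h\<in>carrier G. a k * (b h * c (inv h \<otimes> (inv k \<otimes> g))))"
          by (rule sum.cong) (use g k in \<open>auto simp: inv_mult_group m_assoc[symmetric]\<close>)
        also have "\<dots> = a k * (b \<star> c) (inv k \<otimes> g)"
          using g k by (simp add: GA_mult sum_distrib_left)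
        finally show "(\<Sum>h\<in>carrier G. a k * (b (inv k \<otimes> h) * c (inv h \<otimes> g)))
            = a k * (b \<star> c) (inv k \<otimes> g)" .
      qed
      also have "\<dots> = (a \<star> (b \<star> c)) g" by (simp add: GA_mult[OF g])
      finally show "(a \<star> b \<star> c) g = (a \<star> (b \<star> c)) g" .
    qed (rule GA_mult_closed)+
  next
    fix a :: "'a \<Rightarrow> 'c" assume a: "a \<in> carrier GA"
    show "\<one>\<^bsub>GA\<^esub> \<star> a = a"
      by (rule GA_eqI[OF GA_mult_closed a]) (simp add: GA_one delta_mult)
    show "a \<star> \<one>\<^bsub>GA\<^esub> = a"
      by (rule GA_eqI[OF GA_mult_closed a]) (simp add: GA_one mult_delta)
  qed (auto simp: GA_mult_closed GA_one delta_closed)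
  fix a b c :: "'a \<Rightarrow> 'c"
  assume abc: "a \<in> carrier GA" "b \<in> carrier GA" "c \<in> carrier GA"
  show "(a \<oplus>\<^bsub>GA\<^esub> b) \<star> c = a \<star> c \<oplus>\<^bsub>GA\<^esub> b \<star> c"
    by (auto simp: group_algebra_def fun_eq_iff distrib_right sum.distrib)
  show "c \<star> (a \<oplus>\<^bsub>GA\<^esub> b) = c \<star> a \<oplus>\<^bsub>GA\<^esub> c \<star> b"
    by (auto simp: group_algebra_def fun_eq_iff distrib_left sum.distrib)
qed

sublocale GA: ring "group_algebra G" by (rule ring_GA)

lemma delta_mult_delta:
  assumes "x \<in> carrier G" "y \<in> carrier G"
  shows "delta x \<star> delta y = delta (x \<otimes> y)"
proof (rule GA_eqI[OF GA_mult_closed])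
  fix g assume g: "g \<in> carrier G"
  have "inv x \<otimes> g = y \<longleftrightarrow> g = x \<otimes> y" 
    using assms g by (metis inv_solve_left)
  then show "(delta x \<star> delta y) g = delta (x \<otimes> y) g"
    using assms g by (simp add: delta_mult) (simp add: delta_def)
qed (use assms in \<open>simp add: delta_closed\<close>)

lemma GA_minus:
  assumes "a \<in> carrier GA" "b \<in> carrier GA"
  shows "a \<ominus>\<^bsub>GA\<^esub> b = (\<lambda>g. a g - b g)"
proof -
  have "\<ominus>\<^bsub>GA\<^esub> b = (\<lambda>g. - b g)"
    by (rule GA.minus_equality) (use assms(2) in \<open>auto simp: GA_add GA_zero carrier_GA\<close>)
  then show ?thesis by (simp add: a_minus_def GA_add)
qed

text \<open>
  Commuting with the group element \<open>inv g\<close> means \<open>a (g h) = a (h g)\<close> for all \<open>h\<close>, so the centre of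
  the group algebra consists of the class functions.
\<close>

lemma central_iff_class_function:
  fixes a :: "'a \<Rightarrow> 'c::comm_ring_1"
  assumes a: "a \<in> carrier GA"
  shows "(\<forall>b \<in> carrier GA. a \<star> b = b \<star> a)
    \<longleftrightarrow> (\<forall>g \<in> carrier G. \<forall>h \<in> carrier G. a (g \<otimes> h) = a (h \<otimes> g))"
proof (intro iffI ballI)
  fix g h assume c: "\<forall>b \<in> carrier GA. a \<star> b = b \<star> a"
    and g: "g \<in> carrier G" and h: "h \<in> carrier G"
  have "(a \<star> delta (inv g)) h = (delta (inv g) \<star> a) h"
    using c delta_closed[of "inv g"] g by auto
  then show "a (g \<otimes> h) = a (h \<otimes> g)" using g h by (simp add: delta_mult mult_delta)
next
  fix b :: "'a \<Rightarrow> 'c" assume c: "\<forall>g \<in> carrier G. \<forall>h \<in> carrier G. a (g \<otimes> h) = a (h \<otimes> g)"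
    and b: "b \<in> carrier GA"
  show "a \<star> b = b \<star> a"
  proof (rule GA_eqI[OF GA_mult_closed GA_mult_closed])
    fix g assume g: "g \<in> carrier G"
    show "(a \<star> b) g = (b \<star> a) g"
      unfolding GA_mult[OF g, of b] GA_mult'[OF g, of a]
      by (rule sum.cong) (use c g in \<open>auto simp: mult.commute\<close>)
  qed
qed

lemma central_idempotent_class_function:
  assumes "central_idempotent GA e" "g \<in> carrier G" "h \<in> carrier G"
  shows "e (g \<otimes> h) = e (h \<otimes> g)"
  using assms central_iff_class_function[of e] by (auto simp: central_idempotent_def)

lemma map_coeff_mult:
  assumes "comm_ring_hom f"
  shows "f \<circ> (a \<star> b) = (f \<circ> a) \<star> (f \<circ> b)"
proof -
  interpret f: comm_ring_hom f by fact
  show ?thesis by (auto simp: group_algebra_def fun_eq_iff hom_distribs)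
qed

lemma map_coeff_closed:
  assumes "comm_ring_hom f" "a \<in> carrier GA"
  shows "f \<circ> a \<in> carrier GA"
proof -
  interpret f: comm_ring_hom f by fact
  show ?thesis using assms(2) by (auto simp: carrier_GA)
qed

lemma map_coeff_minus:
  assumes "comm_ring_hom f" "a \<in> carrier GA" "b \<in> carrier GA"
  shows "f \<circ> (a \<ominus>\<^bsub>GA\<^esub> b) = (f \<circ> a) \<ominus>\<^bsub>GA\<^esub> (f \<circ> b)"
proof -
  interpret f: comm_ring_hom f by fact
  show ?thesis using assms by (simp add: GA_minus map_coeff_closed fun_eq_iff hom_distribs)
qed

lemma map_coeff_central_idempotent:
  assumes f: "comm_ring_hom f" and e: "central_idempotent GA e"
  shows "central_idempotent GA (f \<circ> e)"
proof -
  have ec: "e \<in> carrier GA" using e by (simp add: central_idempotent_def)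
  have "\<forall>b \<in> carrier GA. (f \<circ> e) \<star> b = b \<star> (f \<circ> e)"
    unfolding central_iff_class_function[OF map_coeff_closed[OF f ec]]
    using central_idempotent_class_function[OF e] by simp
  then show ?thesis
    using e map_coeff_closed[OF f ec] by (simp add: central_idempotent_def map_coeff_mult[OF f, symmetric])
qed

text \<open>
  For a one-dimensional representation \<open>l\<close> this is the scalar by which \<open>a\<close> acts.
\<close>

definition eval_linear :: "('a \<Rightarrow> 'c::comm_ring_1) \<Rightarrow> ('a \<Rightarrow> 'c) \<Rightarrow> 'c" where
  "eval_linear l a = (\<Sum>g\<in>carrier G. a g * l g)"

lemma eval_linear_mult:
  assumes l: "\<And>g h. g \<in> carrier G \<Longrightarrow> h \<in> carrier G \<Longrightarrow> l (g \<otimes> h) = l g * l h"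
  shows "eval_linear l (a \<star> b) = eval_linear l a * eval_linear l b"
proof -
  have "eval_linear l (a \<star> b) = (\<Sum>g\<in>carrier G. \<Sum>h\<in>carrier G. a h * b (inv h \<otimes> g) * l g)"
    unfolding eval_linear_def by (intro sum.cong) (simp_all add: GA_mult sum_distrib_right)
  also have "\<dots> = (\<Sum>h\<in>carrier G. \<Sum>g\<in>carrier G. a h * b (inv h \<otimes> g) * l g)"
    by (rule sum.swap)
  also have "\<dots> = (\<Sum>h\<in>carrier G. \<Sum>g\<in>carrier G. a h * b (inv h \<otimes> (h \<otimes> g)) * l (h \<otimes> g))"
    by (intro sum.cong[OF refl] sum_left_translate[symmetric])
  also have "\<dots> = (\<Sum>h\<in>carrier G. \<Sum>g\<in>carrier G. (a h * l h) * (b g * l g))"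
    by (intro sum.cong[OF refl]) (simp add: l m_assoc[symmetric] mult_ac)
  also have "\<dots> = eval_linear l a * eval_linear l b"
    by (simp add: eval_linear_def sum_product)
  finally show ?thesis .
qed

lemma eval_linear_add:
  "eval_linear l (a \<oplus>\<^bsub>GA\<^esub> b) = eval_linear l a + eval_linear l b"
  by (simp add: eval_linear_def GA_add distrib_right sum.distrib)

lemma eval_linear_delta: "x \<in> carrier G \<Longrightarrow> eval_linear l (delta x) = l x"
  by (simp add: eval_linear_def delta_def if_distrib[of "\<lambda>c. c * _"] cong: if_cong)

abbreviation augmentation :: "('a \<Rightarrow> 'c::comm_ring_1) \<Rightarrow> 'c" where
  "augmentation \<equiv> eval_linear (\<lambda>_. 1)"

lemma augmentation_mult: "augmentation (a \<star> b) = augmentation a * augmentation b"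
  by (rule eval_linear_mult) simp

lemma augmentation_map: "comm_ring_hom f \<Longrightarrow> augmentation (f \<circ> a) = f (augmentation a)"
proof -
  assume "comm_ring_hom f"
  then interpret f: comm_ring_hom f .
  show ?thesis by (simp add: eval_linear_def f.hom_sum)
qed

section \<open>Representations\<close>

lemma representation_carrier: "representation G n \<rho> \<Longrightarrow> g \<in> carrier G \<Longrightarrow> \<rho> g \<in> carrier_mat n n"
  by (simp add: representation_def)

lemma rep_algebra_carrier: "rep_algebra G n \<rho> a \<in> carrier_mat n n"
  by (simp add: rep_algebra_def)

lemma rep_algebra_index:
  "i < n \<Longrightarrow> j < n \<Longrightarrow> rep_algebra G n \<rho> a $$ (i, j) = (\<Sum>g\<in>carrier G. a g * \<rho> g $$ (i, j))"
  by (simp add: rep_algebra_def)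

lemma rep_algebra_mult:
  fixes \<rho> :: "'a \<Rightarrow> 'c::comm_ring_1 mat"
  assumes \<rho>: "representation G n \<rho>"
  shows "rep_algebra G n \<rho> (a \<star> b) = rep_algebra G n \<rho> a * rep_algebra G n \<rho> b"
proof (rule eq_matI)
  note rc = representation_carrier[OF \<rho>]
  fix i j assume "i < dim_row (rep_algebra G n \<rho> a * rep_algebra G n \<rho> b)"
    "j < dim_col (rep_algebra G n \<rho> a * rep_algebra G n \<rho> b)"
  then have ij: "i < n" "j < n" by (auto simp: rep_algebra_def)
  have prod: "\<rho> (h \<otimes> g) $$ (i, j) = (\<Sum>k<n. \<rho> h $$ (i, k) * \<rho> g $$ (k, j))"
    if "g \<in> carrier G" "h \<in> carrier G" for g h
  proof -
    have "\<rho> (h \<otimes> g) = \<rho> h * \<rho> g" using \<rho> that by (simp add: representation_def)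
    then show ?thesis using rc[OF that(1)] rc[OF that(2)] ij
      by (simp add: scalar_prod_def lessThan_atLeast0)
  qed
  have "rep_algebra G n \<rho> (a \<star> b) $$ (i, j)
      = (\<Sum>g\<in>carrier G. \<Sum>h\<in>carrier G. a h * b (inv h \<otimes> g) * \<rho> g $$ (i, j))"
    unfolding rep_algebra_index[OF ij] by (intro sum.cong) (simp_all add: GA_mult sum_distrib_right)
  also have "\<dots> = (\<Sum>h\<in>carrier G. \<Sum>g\<in>carrier G. a h * b (inv h \<otimes> g) * \<rho> g $$ (i, j))"
    by (rule sum.swap)
  also have "\<dots> = (\<Sum>h\<in>carrier G. \<Sum>g\<in>carrier G. a h * b (inv h \<otimes> (h \<otimes> g)) * \<rho> (h \<otimes> g) $$ (i, j))"
    by (intro sum.cong[OF refl] sum_left_translate[symmetric])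
  also have "\<dots> = (\<Sum>h\<in>carrier G. \<Sum>g\<in>carrier G. \<Sum>k<n. (a h * \<rho> h $$ (i, k)) * (b g * \<rho> g $$ (k, j)))"
    by (intro sum.cong[OF refl]) (simp add: prod m_assoc[symmetric] sum_distrib_left mult_ac)
  also have "\<dots> = (\<Sum>k<n. \<Sum>h\<in>carrier G. \<Sum>g\<in>carrier G. (a h * \<rho> h $$ (i, k)) * (b g * \<rho> g $$ (k, j)))"
    by (subst sum.swap[of _ "{..<n}" "carrier G"], subst (2) sum.swap, simp)
  also have "\<dots> = (\<Sum>k<n. rep_algebra G n \<rho> a $$ (i, k) * rep_algebra G n \<rho> b $$ (k, j))"
    using ij by (intro sum.cong[OF refl]) (simp add: rep_algebra_index sum_product)
  also have "\<dots> = (rep_algebra G n \<rho> a * rep_algebra G n \<rho> b) $$ (i, j)"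
    using ij by (simp add: rep_algebra_def scalar_prod_def lessThan_atLeast0)
  finally show "rep_algebra G n \<rho> (a \<star> b) $$ (i, j) = (rep_algebra G n \<rho> a * rep_algebra G n \<rho> b) $$ (i, j)" .
qed (simp_all add: rep_algebra_def)

lemma rep_algebra_delta:
  assumes \<rho>: "representation G n \<rho>" and x: "x \<in> carrier G"
  shows "rep_algebra G n \<rho> (delta x) = \<rho> x"
  using representation_carrier[OF \<rho> x] x
  by (intro eq_matI) (auto simp: rep_algebra_def delta_def if_distrib[of "\<lambda>c. c * _"] cong: if_cong)

lemma rep_algebra_minus:
  assumes "a \<in> carrier GA" "b \<in> carrier GA"
  shows "rep_algebra G n \<rho> (a \<ominus>\<^bsub>GA\<^esub> b) = rep_algebra G n \<rho> a - rep_algebra G n \<rho> b"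
  by (rule eq_matI) (auto simp: rep_algebra_def GA_minus[OF assms] left_diff_distrib sum_subtractf)

lemma rep_algebra_linear_entry:
  assumes "\<And>g. g \<in> carrier G \<Longrightarrow> \<rho> g $$ (0, 0) = l g"
  shows "rep_algebra G 1 \<rho> a $$ (0, 0) = eval_linear l a"
  using assms by (simp add: rep_algebra_def eval_linear_def)

lemma trivial_rep: "representation G 1 (\<lambda>_. 1\<^sub>m 1)"
  by (simp add: representation_def)

lemma character_one:
  assumes "representation G n \<rho>"
  shows "character G \<rho> \<one> = of_nat n"
  using assms by (simp add: character_def representation_def)

end

lemma subspace_module_vecI:
  fixes W :: "'c::field vec set"
  assumes "W \<subseteq> carrier_vec n" "0\<^sub>v n \<in> W"
    "\<And>v w. v \<in> W \<Longrightarrow> w \<in> W \<Longrightarrow> v + w \<in> W"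
    "\<And>c v. v \<in> W \<Longrightarrow> c \<cdot>\<^sub>v v \<in> W"
  shows "VectorSpace.subspace class_ring W (module_vec TYPE('c) n)"
proof (rule subspace.intro)
  show "vectorspace class_ring (module_vec TYPE('c) n)" by (rule vec_vs)
  then have "Module.module class_ring (module_vec TYPE('c) n)" by (simp add: vectorspace_def)
  then show "submodule class_ring W (module_vec TYPE('c) n)"
    using assms by (intro submodule.intro) (auto simp: module_vec_simps)
qed

lemma subspace_module_vecD:
  fixes W :: "'c::field vec set"
  assumes "VectorSpace.subspace class_ring W (module_vec TYPE('c) n)"
  shows "W \<subseteq> carrier_vec n" "0\<^sub>v n \<in> W"
    "\<And>v w. v \<in> W \<Longrightarrow> w \<in> W \<Longrightarrow> v + w \<in> W"
    "\<And>c v. v \<in> W \<Longrightarrow> c \<cdot>\<^sub>v v \<in> W"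
proof -
  have s: "submodule class_ring W (module_vec TYPE('c) n)"
    using assms by (rule subspace.submod)
  show "W \<subseteq> carrier_vec n" "0\<^sub>v n \<in> W"
    "\<And>v w. v \<in> W \<Longrightarrow> w \<in> W \<Longrightarrow> v + w \<in> W"
    "\<And>c v. v \<in> W \<Longrightarrow> c \<cdot>\<^sub>v v \<in> W"
    using submodule.subset[OF s] submodule.zero_closed[OF s] submodule.m_closed[OF s]
      submodule.smult_closed[OF s] by (auto simp: module_vec_simps)
qed

lemma mult_one_vec_eqI:
  fixes A :: "'c::comm_ring_1 mat"
  assumes "A \<in> carrier_mat n n" "B \<in> carrier_mat n n"
    and "\<And>v. v \<in> carrier_vec n \<Longrightarrow> A *\<^sub>v v = B *\<^sub>v v"
  shows "A = B"
proof (rule eq_matI)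
  fix i j assume "i < dim_row B" "j < dim_col B"
  then have ij: "i < n" "j < n" using assms(2) by auto
  have "(A *\<^sub>v unit_vec n j) $ i = (B *\<^sub>v unit_vec n j) $ i" using assms(3)[of "unit_vec n j"] by simp
  then show "A $$ (i, j) = B $$ (i, j)" using assms(1,2) ij by simp
qed (use assms in auto)

lemma root_of_unity_char_p:
  fixes c :: "'c::field"
  assumes p: "prime p" and char: "CHAR('c) = p" and c: "c ^ (p ^ k) = 1"
  shows "c = 1"
proof -
  have "((c - 1) + 1) ^ (p ^ k) = (c - 1) ^ (p ^ k) + 1 ^ (p ^ k)"
    by (rule freshmans_dream') (use p char in auto)
  then have "(c - 1) ^ (p ^ k) = 0" using c by simp
  then show ?thesis by simp
qed

context finite_group begin

lemma irreducible_repD: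
  assumes "irreducible_rep G n \<rho>"
  shows "representation G n \<rho>" "n > 0"
  using assms by (auto simp: irreducible_rep_def)

lemma irreducible_invariant:
  fixes \<rho> :: "'a \<Rightarrow> 'c::field mat"
  assumes "irreducible_rep G n \<rho>" "W \<subseteq> carrier_vec n" "0\<^sub>v n \<in> W"
    "\<And>v w. v \<in> W \<Longrightarrow> w \<in> W \<Longrightarrow> v + w \<in> W"
    "\<And>c v. v \<in> W \<Longrightarrow> c \<cdot>\<^sub>v v \<in> W"
    "\<And>g w. g \<in> carrier G \<Longrightarrow> w \<in> W \<Longrightarrow> \<rho> g *\<^sub>v w \<in> W"
  shows "W = {0\<^sub>v n} \<or> W = carrier_vec n"
  using assms subspace_module_vecI[OF assms(2-5)] unfolding irreducible_rep_def by blast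

lemma representation_mult:
  "representation G n \<rho> \<Longrightarrow> g \<in> carrier G \<Longrightarrow> h \<in> carrier G \<Longrightarrow> \<rho> (g \<otimes> h) = \<rho> g * \<rho> h"
  by (simp add: representation_def)

text \<open>Schur's lemma for central idempotents: the fixed vectors form an invariant subspace.\<close>

lemma central_idempotent_rep:
  fixes \<rho> :: "'a \<Rightarrow> 'c::field mat"
  assumes \<rho>: "irreducible_rep G n \<rho>" and e: "central_idempotent GA e"
  shows "rep_algebra G n \<rho> e = 1\<^sub>m n \<or> rep_algebra G n \<rho> e = 0\<^sub>m n n"
proof -
  note rep = irreducible_repD(1)[OF \<rho>]
  let ?E = "rep_algebra G n \<rho> e"
  note Ec = rep_algebra_carrier[of n \<rho> e]
  have EE: "?E * ?E = ?E"
    using e by (simp add: central_idempotent_def rep_algebra_mult[OF rep, symmetric])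
  have comm: "?E * \<rho> g = \<rho> g * ?E" if "g \<in> carrier G" for g
  proof -
    have "e \<star> delta g = delta g \<star> e"
      using e delta_closed[OF that] by (auto simp: central_idempotent_def)
    then show ?thesis
      using that by (simp add: rep_algebra_mult[OF rep, symmetric] flip: rep_algebra_delta[OF rep])
  qed
  let ?W = "{v \<in> carrier_vec n. ?E *\<^sub>v v = v}"
  have "?W = {0\<^sub>v n} \<or> ?W = carrier_vec n"
  proof (rule irreducible_invariant[OF \<rho>])
    fix g w assume g: "g \<in> carrier G" and w: "w \<in> ?W"
    note gc = representation_carrier[OF rep g]
    have "?E *\<^sub>v (\<rho> g *\<^sub>v w) = (?E * \<rho> g) *\<^sub>v w"
      using w by (simp add: assoc_mult_mat_vec[OF Ec gc])
    also have "\<dots> = \<rho> g *\<^sub>v (?E *\<^sub>v w)"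
      using w by (simp add: comm[OF g] assoc_mult_mat_vec[OF gc Ec])
    finally show "\<rho> g *\<^sub>v w \<in> ?W" using w gc by auto
  next
    fix v w assume "v \<in> ?W" "w \<in> ?W"
    then show "v + w \<in> ?W" using Ec by (simp add: mult_add_distrib_mat_vec)
  next
    fix c v assume "v \<in> ?W"
    then show "c \<cdot>\<^sub>v v \<in> ?W" using Ec by (simp add: mult_mat_vec)
  qed (use Ec in auto)
  then show ?thesis
  proof
    assume W: "?W = {0\<^sub>v n}"
    have "?E = 0\<^sub>m n n"
    proof (rule mult_one_vec_eqI[OF Ec])
      fix v :: "'c vec" assume v: "v \<in> carrier_vec n"
      have "?E *\<^sub>v v \<in> ?W"
        using v Ec EE assoc_mult_mat_vec[OF Ec Ec v] by auto
      then show "?E *\<^sub>v v = 0\<^sub>m n n *\<^sub>v v" using W v by auto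
    qed simp
    then show ?thesis by simp
  next
    assume W: "?W = carrier_vec n"
    have "?E = 1\<^sub>m n"
      by (rule mult_one_vec_eqI[OF Ec]) (use W in auto)
    then show ?thesis by simp
  qed
qed

text \<open>
  Each operator commutes with all others and is therefore a scalar, so that a coordinate axis is
  invariant.
\<close>

lemma splitting_commuting_imp_linear:
  fixes \<rho> :: "'a \<Rightarrow> 'c::field mat"
  assumes split: "splitting_field TYPE('c) G" and \<rho>: "irreducible_rep G n \<rho>"
    and comm: "\<And>g h. g \<in> carrier G \<Longrightarrow> h \<in> carrier G \<Longrightarrow> \<rho> g * \<rho> h = \<rho> h * \<rho> g"
  shows "n = 1"
proof -
  note rep = irreducible_repD(1)[OF \<rho>] and n0 = irreducible_repD(2)[OF \<rho>]
  have scalar: "\<exists>c. \<rho> h = c \<cdot>\<^sub>m 1\<^sub>m n" if "h \<in> carrier G" for h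
    using split \<rho> representation_carrier[OF rep that] comm[OF that]
    unfolding splitting_field_def by blast
  let ?W = "{v :: 'c vec. v \<in> carrier_vec n \<and> (\<forall>i<n. i \<noteq> 0 \<longrightarrow> v $ i = 0)}"
  have "?W = {0\<^sub>v n} \<or> ?W = carrier_vec n"
  proof (rule irreducible_invariant[OF \<rho>])
    fix g w assume g: "g \<in> carrier G" and w: "w \<in> ?W"
    obtain c where c: "\<rho> g = c \<cdot>\<^sub>m 1\<^sub>m n" using scalar[OF g] by blast
    have "\<rho> g *\<^sub>v w = c \<cdot>\<^sub>v w"
      unfolding c using w by (intro eq_vecI) auto
    then show "\<rho> g *\<^sub>v w \<in> ?W" using w by auto
  qed auto
  then show "n = 1"
  proof
    assume W: "?W = {0\<^sub>v n}"
    have "unit_vec n 0 \<in> ?W" using n0 by auto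
    then have "unit_vec n 0 = (0\<^sub>v n :: 'c vec)" using W by blast
    then have "unit_vec n 0 $ 0 = (0\<^sub>v n :: 'c vec) $ 0" by simp
    then show ?thesis using n0 by simp
  next
    assume W: "?W = carrier_vec n"
    show ?thesis
    proof (rule ccontr)
      assume "n \<noteq> 1"
      then have n: "1 < n" using n0 by simp
      have "unit_vec n 1 \<in> ?W" using W by auto
      then have "unit_vec n 1 $ 1 = (0 :: 'c)" using n by auto
      then show False using n by simp
    qed
  qed
qed

lemma subgroup_rep_kernel:
  assumes rep: "representation G n \<rho>"
  shows "subgroup {x \<in> carrier G. \<rho> x = 1\<^sub>m n} G"
proof (rule subgroup.intro)
  fix x assume x: "x \<in> {x \<in> carrier G. \<rho> x = 1\<^sub>m n}"
  then have "\<rho> \<one> = \<rho> (inv x) * 1\<^sub>m n"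
    using representation_mult[OF rep, of "inv x" x] by simp
  then show "inv x \<in> {x \<in> carrier G. \<rho> x = 1\<^sub>m n}"
    using x rep right_mult_one_mat[OF representation_carrier[OF rep, of "inv x"]]
    by (auto simp: representation_def)
qed (use rep in \<open>auto simp: representation_def\<close>)

lemma derived_in_kernel:
  assumes rep: "representation G n \<rho>"
    and comm: "\<And>g h. g \<in> carrier G \<Longrightarrow> h \<in> carrier G \<Longrightarrow> \<rho> g * \<rho> h = \<rho> h * \<rho> g"
    and x: "x \<in> derived G (carrier G)"
  shows "\<rho> x = 1\<^sub>m n"
proof -
  let ?K = "{x \<in> carrier G. \<rho> x = 1\<^sub>m n}"
  have "g \<otimes> h \<otimes> inv g \<otimes> inv h \<in> ?K" if g: "g \<in> carrier G" and h: "h \<in> carrier G" for g h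
  proof -
    have "\<rho> (g \<otimes> h \<otimes> (inv g \<otimes> inv h)) = \<rho> g * \<rho> h * \<rho> (inv g \<otimes> inv h)"
      using rep g h by (simp add: representation_def)
    also have "\<dots> = \<rho> (h \<otimes> g \<otimes> (inv g \<otimes> inv h))"
      using rep g h by (simp add: representation_def comm[OF g h])
    also have "h \<otimes> g \<otimes> (inv g \<otimes> inv h) = \<one>"
      using g h by (metis inv_mult_group m_closed r_inv)
    finally show ?thesis using rep g h by (simp add: representation_def m_assoc)
  qed
  then have "(\<Union>g \<in> carrier G. \<Union>h \<in> carrier G. {g \<otimes> h \<otimes> inv g \<otimes> inv h}) \<subseteq> ?K" by blast
  then have "derived G (carrier G) \<subseteq> ?K"
    unfolding derived_def by (rule generate_subgroup_incl[OF _ subgroup_rep_kernel[OF rep]])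
  then show ?thesis using x by blast
qed

lemma commuting_if_trivial_on_derived:
  assumes \<rho>: "representation G n \<rho>" and triv: "\<And>x. x \<in> derived G (carrier G) \<Longrightarrow> \<rho> x = 1\<^sub>m n"
    and g: "g \<in> carrier G" and h: "h \<in> carrier G"
  shows "\<rho> g * \<rho> h = \<rho> h * \<rho> g"
proof -
  let ?z = "g \<otimes> h \<otimes> inv g \<otimes> inv h"
  have z: "?z \<in> derived G (carrier G)" unfolding derived_def using g h by (intro generate.incl) blast
  have "?z \<otimes> (h \<otimes> g) = g \<otimes> h" using g h by (simp add: m_assoc mult_inv_cancel)
  then have "\<rho> (g \<otimes> h) = \<rho> ?z * \<rho> (h \<otimes> g)"
    using representation_mult[OF \<rho>, of ?z "h \<otimes> g"] g h by simp
  also have "\<dots> = \<rho> (h \<otimes> g)"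
    using triv[OF z] representation_carrier[OF \<rho>, of "h \<otimes> g"] g h by simp
  finally show ?thesis using representation_mult[OF \<rho>] g h by simp
qed

lemma irreducible_linear_rep:
  fixes \<rho> :: "'a \<Rightarrow> 'c::field mat"
  assumes "representation G 1 \<rho>"
  shows "irreducible_rep G 1 \<rho>"
  unfolding irreducible_rep_def
proof (intro conjI allI impI)
  fix W :: "'c vec set"
  assume "VectorSpace.subspace class_ring W (module_vec TYPE('c) 1) \<and> (\<forall>g\<in>carrier G. \<forall>w\<in>W. \<rho> g *\<^sub>v w \<in> W)"
  note W = subspace_module_vecD[OF conjunct1[OF this]]
  show "W = {0\<^sub>v 1} \<or> W = carrier_vec 1"
  proof (cases "W \<subseteq> {0\<^sub>v 1}")
    case True
    then show ?thesis using W(2) by blast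
  next
    case False
    then obtain w where w: "w \<in> W" "w \<noteq> 0\<^sub>v 1" by blast
    have wc: "w \<in> carrier_vec 1" using w W(1) by blast
    have w0: "w $ 0 \<noteq> 0" using w(2) wc by (auto simp: vec_eq_iff)
    have "v \<in> W" if v: "v \<in> carrier_vec 1" for v
    proof -
      have "v = (v $ 0 / w $ 0) \<cdot>\<^sub>v w" using v wc w0 by (intro eq_vecI) auto
      then show ?thesis using W(4)[OF w(1)] by metis
    qed
    then show ?thesis using W(1) by blast
  qed
qed (use assms in auto)

lemma linear_rep_commute:
  assumes "representation G 1 \<rho>" "g \<in> carrier G" "h \<in> carrier G"
  shows "\<rho> g * \<rho> h = \<rho> h * \<rho> g"
  using representation_carrier[OF assms(1) assms(2)] representation_carrier[OF assms(1) assms(3)]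
  by (intro eq_matI) (auto simp: scalar_prod_def mult.commute)

lemma linear_rep_pow:
  fixes \<rho> :: "'a \<Rightarrow> 'c::comm_ring_1 mat"
  assumes \<rho>: "representation G 1 \<rho>" and x: "x \<in> carrier G"
  shows "\<rho> (x [^] (k::nat)) = \<rho> x $$ (0, 0) ^ k \<cdot>\<^sub>m 1\<^sub>m 1"
proof (induction k)
  case 0
  then show ?case using \<rho> by (auto simp: representation_def)
next
  case (Suc k)
  have "\<rho> (x [^] Suc k) = \<rho> (x [^] k) * \<rho> x"
    using representation_mult[OF \<rho>, of "x [^] k" x] x by simp
  also have "\<dots> = \<rho> x $$ (0, 0) ^ Suc k \<cdot>\<^sub>m 1\<^sub>m 1"
    unfolding Suc.IH using representation_carrier[OF \<rho> x]
    by (intro eq_matI) (auto simp: scalar_prod_def)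
  finally show ?case .
qed

text \<open>
  A \<open>p\<close>-element acts by a root of unity of \<open>p\<close>-power order, which is 1 in characteristic \<open>p\<close>.
\<close>

lemma residual_in_linear_kernel:
  fixes \<rho> :: "'a \<Rightarrow> 'c::field mat"
  assumes p: "prime p" "CHAR('c) = p" and \<rho>: "representation G 1 \<rho>" and x: "x \<in> p'_residual p G"
  shows "\<rho> x = 1\<^sub>m 1"
proof -
  let ?K = "{x \<in> carrier G. \<rho> x = 1\<^sub>m 1}"
  have "g \<in> ?K" if g: "g \<in> carrier G" and k: "ord g = p ^ k" for g k
  proof -
    note pow = linear_rep_pow[OF \<rho> g]
    have "g [^] (p ^ k) = \<one>" using g k by (metis pow_ord_eq_1)
    then have "\<rho> g $$ (0, 0) ^ (p ^ k) \<cdot>\<^sub>m 1\<^sub>m 1 = (1\<^sub>m 1 :: 'c mat)"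
      using pow[of "p ^ k"] \<rho> by (simp add: representation_def)
    then have "\<rho> g $$ (0, 0) ^ (p ^ k) = 1" by (auto dest!: arg_cong[of _ _ "\<lambda>A. A $$ (0, 0)"])
    then have "\<rho> g $$ (0, 0) = 1" by (rule root_of_unity_char_p[OF p])
    then have "\<rho> g = 1 \<cdot>\<^sub>m 1\<^sub>m 1" using pow[of 1] g by simp
    also have "\<dots> = 1\<^sub>m 1" by (intro eq_matI) auto
    finally show ?thesis using g by simp
  qed
  then have "p'_residual p G \<subseteq> ?K"
    unfolding p'_residual_def by (intro generate_subgroup_incl[OF _ subgroup_rep_kernel[OF \<rho>]]) blast
  then show ?thesis using x by blast
qed

end

section \<open>Elements killed by all irreducible representations\<close>

text \<open>
  Adapted coordinates on a finite-dimensional space \<open>W\<close> relative to a subspace \<open>W'\<close>: the functionals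
  \<open>f i\<close> are coordinates on \<open>W / W'\<close>. They are linear on the whole space, being coordinates with
  respect to a basis of everything.
\<close>

lemma (in vector_space) quotient_coordinates:
  assumes W': "module.subspace scale W'" and W: "module.subspace scale W" and "W' \<subseteq> W"
    and S: "finite S" "W \<subseteq> span S"
  obtains d :: nat and f :: "nat \<Rightarrow> 'b \<Rightarrow> 'a" and c :: "nat \<Rightarrow> 'b"
  where "\<And>i. Vector_Spaces.linear scale (*) (f i)"
    and "\<And>i. i < d \<Longrightarrow> c i \<in> W"
    and "\<And>i j. i < d \<Longrightarrow> j < d \<Longrightarrow> f i (c j) = (if i = j then 1 else 0)"
    and "W' = {w \<in> W. \<forall>i<d. f i w = 0}"
    and "dim W = dim W' + d"
proof -
  obtain B' where B': "B' \<subseteq> W'" "independent B'" "W' \<subseteq> span B'" "card B' = dim W'"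
    using basis_exists by blast
  obtain B where B: "B' \<subseteq> B" "B \<subseteq> W" "independent B" "W \<subseteq> span B"
    using maximal_independent_subset_extend[of B' W] B' \<open>W' \<subseteq> W\<close> by blast
  have finB: "finite B" using independent_span_bound[OF S(1) B(3)] B(2) S(2) by blast
  let ?C = "extend_basis B"
  have C: "independent ?C" "span ?C = UNIV" "B \<subseteq> ?C"
    using independent_extend_basis[OF B(3)] span_extend_basis[OF B(3)] extend_basis_superset[OF B(3)] by auto
  define d where "d = card (B - B')"
  obtain c where c: "bij_betw c {..<d} (B - B')"
    using ex_bij_betw_nat_finite[of "B - B'"] finB by (auto simp: d_def lessThan_atLeast0)
  define f where "f i w = representation ?C w (c i)" for i w
  have lin: "Vector_Spaces.linear scale (*) (f i)" for i
    unfolding f_def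
    by (unfold_locales) (auto simp: representation_add[OF C(1)] representation_scale[OF C(1)] C(2) algebra_simps)
  have cW: "c i \<in> B - B'" if "i < d" for i using c that by (auto simp: bij_betw_def)
  then have cW': "c i \<in> W" if "i < d" for i using B(2) that by blast
  have fc: "f i (c j) = (if i = j then 1 else 0)" if "i < d" "j < d" for i j
  proof -
    have "c j \<in> ?C" using cW[OF that(2)] C(3) by blast
    then have "f i (c j) = (if c i = c j then 1 else 0)"
      unfolding f_def by (simp add: representation_basis[OF C(1)])
    also have "c i = c j \<longleftrightarrow> i = j" using c that by (auto simp: bij_betw_def inj_on_def)
    finally show ?thesis .
  qed
  have ker: "W' = {w \<in> W. \<forall>i<d. f i w = 0}"
  proof safe
    fix w assume w: "w \<in> W'"
    then show "w \<in> W" using \<open>W' \<subseteq> W\<close> by blast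
    fix i assume i: "i < d"
    have "representation ?C w = representation B' w"
      by (rule representation_extend[OF C(1)]) (use w B' B C in auto)
    then show "f i w = 0" using cW[OF i] representation_ne_zero[of B' w "c i"] by (auto simp: f_def)
  next
    fix w assume w: "w \<in> W" and 0: "\<forall>i<d. f i w = 0"
    have r: "representation ?C w = representation B w"
      by (rule representation_extend[OF C(1)]) (use w B C in auto)
    have z: "representation B w b = 0" if b: "b \<in> B - B'" for b
    proof -
      obtain i where "i < d" "b = c i" using c b by (auto simp: bij_betw_def)
      then show ?thesis using 0 by (auto simp: f_def r)
    qed
    have "w = (\<Sum>b\<in>B. representation B w b *s b)"
      using sum_representation_eq[OF B(3) _ finB subset_refl, of w] w B(4) by auto
    also have "\<dots> = (\<Sum>b\<in>B'. representation B w b *s b)"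
      by (rule sum.mono_neutral_right[OF finB B(1)]) (simp add: z)
    also have "\<dots> \<in> W'"
      by (rule subspace_sum[OF W']) (use B'(1) W' in \<open>auto intro: subspace_scale\<close>)
    finally show "w \<in> W'" .
  qed
  have dimW: "dim W = dim W' + d"
  proof -
    have "dim W = card B" using basis_card_eq_dim[of B W] B by simp
    moreover have "card B' \<le> card B" "card (B - B') = card B - card B'"
      using finB B(1) by (auto intro: card_mono card_Diff_subset finite_subset)
    ultimately show ?thesis using B'(4) by (simp add: d_def)
  qed
  show thesis by (rule that[of f d c, OF lin cW' fc ker dimW])
qed

interpretation fun_vs: vector_space "\<lambda>(c::'c::field) (f::'a \<Rightarrow> 'c) x. c * f x"
  by unfold_locales (auto simp: fun_eq_iff algebra_simps)

context finite_group begin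

text \<open>These are the left ideals, since the group elements span the group algebra.\<close>

definition invariant_subspace :: "('a \<Rightarrow> 'c::field) set \<Rightarrow> bool" where
  "invariant_subspace W \<longleftrightarrow> fun_vs.subspace W \<and> W \<subseteq> carrier GA \<and>
     (\<forall>x \<in> carrier G. \<forall>w \<in> W. delta x \<star> w \<in> W)"

lemma linear_GA_mult:
  "Vector_Spaces.linear (\<lambda>(c::'c::field) f x. c * f x) (\<lambda>c f x. c * f x) (\<lambda>v. a \<star> v)"
  by unfold_locales (auto simp: group_algebra_def fun_eq_iff distrib_left sum.distrib sum_distrib_left mult_ac)

lemma GA_mult_sum_delta:
  "a \<star> w = (\<Sum>x\<in>carrier G. (\<lambda>g. a x * (delta x \<star> w) g))"
proof
  fix g
  have "(\<Sum>x\<in>carrier G. (\<lambda>g. a x * (delta x \<star> w) g)) g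
      = (\<Sum>x\<in>carrier G. a x * (delta x \<star> w) g)"
    by (induction rule: infinite_finite_induct) auto
  also have "\<dots> = (a \<star> w) g"
  proof (cases "g \<in> carrier G")
    case True
    then have "a x * (delta x \<star> w) g = a x * w (inv x \<otimes> g)" if "x \<in> carrier G" for x
      using that by (simp only: delta_mult)
    then show ?thesis using True by (simp add: GA_mult)
  qed (simp add: group_algebra_def)
  finally show "(a \<star> w) g = (\<Sum>x\<in>carrier G. (\<lambda>g. a x * (delta x \<star> w) g)) g" ..
qed

lemma carrier_GA_subspace: "fun_vs.subspace (carrier (GA :: ('a \<Rightarrow> 'c::field) ring))"
  by (rule fun_vs.subspaceI) (auto simp: carrier_GA)

lemma carrier_GA_span: "carrier (GA :: ('a \<Rightarrow> 'c::field) ring) \<subseteq> fun_vs.span (delta ` carrier G)"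
proof
  fix v :: "'a \<Rightarrow> 'c" assume v: "v \<in> carrier GA"
  have "v = v \<star> delta \<one>" using GA.r_one[OF v] by (simp add: GA_one)
  also have "\<dots> = (\<Sum>x\<in>carrier G. (\<lambda>g. v x * delta x g))"
    unfolding GA_mult_sum_delta[of v] by (intro sum.cong) (simp_all add: delta_mult_delta)
  also have "\<dots> \<in> fun_vs.span (delta ` carrier G)"
    by (intro fun_vs.span_sum fun_vs.span_scale fun_vs.span_base) auto
  finally show "v \<in> fun_vs.span (delta ` carrier G)" .
qed

lemma invariant_subspace_coordinates:
  fixes W' W :: "('a \<Rightarrow> 'c::field) set"
  assumes "fun_vs.subspace W'" "fun_vs.subspace W" "W' \<subseteq> W" "W \<subseteq> carrier GA"
  obtains d :: nat and f :: "nat \<Rightarrow> ('a \<Rightarrow> 'c) \<Rightarrow> 'c" and c :: "nat \<Rightarrow> 'a \<Rightarrow> 'c"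
  where "\<And>i. Vector_Spaces.linear (\<lambda>c f x. c * f x) (*) (f i)"
    and "\<And>i. i < d \<Longrightarrow> c i \<in> W"
    and "\<And>i j. i < d \<Longrightarrow> j < d \<Longrightarrow> f i (c j) = (if i = j then 1 else 0)"
    and "W' = {w \<in> W. \<forall>i<d. f i w = 0}"
    and "fun_vs.dim W = fun_vs.dim W' + d"
proof -
  have "finite (delta ` carrier G :: ('a \<Rightarrow> 'c) set)" "W \<subseteq> fun_vs.span (delta ` carrier G)"
    using carrier_GA_span assms(4) by auto
  then show thesis by (rule fun_vs.quotient_coordinates[OF assms(1-3)]) (rule that)
qed

lemma dim_strict_mono:
  fixes W' W :: "('a \<Rightarrow> 'c::field) set"
  assumes "fun_vs.subspace W'" "fun_vs.subspace W" "W' \<subset> W" "W \<subseteq> carrier GA"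
  shows "fun_vs.dim W' < fun_vs.dim W"
proof -
  obtain d :: nat and f :: "nat \<Rightarrow> ('a \<Rightarrow> 'c) \<Rightarrow> 'c" and c :: "nat \<Rightarrow> 'a \<Rightarrow> 'c"
    where "W' = {w \<in> W. \<forall>i<d. f i w = 0}" "fun_vs.dim W = fun_vs.dim W' + d"
    by (rule invariant_subspace_coordinates[OF assms(1,2) psubset_imp_subset[OF assms(3)] assms(4)])
  then show ?thesis using assms(3) by (cases d) auto
qed

text \<open>
  The action on a simple quotient \<open>W / W'\<close>, written in adapted coordinates, is an irreducible matrix
  representation.
\<close>

lemma simple_quotient_rep:
  fixes W' W :: "('a \<Rightarrow> 'c::field) set"
  assumes W': "invariant_subspace W'" and W: "invariant_subspace W" and sub: "W' \<subset> W"
    and simple: "\<And>U. invariant_subspace U \<Longrightarrow> W' \<subseteq> U \<Longrightarrow> U \<subseteq> W \<Longrightarrow> U = W' \<or> U = W"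
  obtains n and \<sigma> :: "'a \<Rightarrow> 'c mat" where "irreducible_rep G n \<sigma>"
    and "\<And>a w. rep_algebra G n \<sigma> a = 0\<^sub>m n n \<Longrightarrow> w \<in> W \<Longrightarrow> a \<star> w \<in> W'"
proof -
  have sW: "fun_vs.subspace W" "W \<subseteq> carrier GA" and sW': "fun_vs.subspace W'"
    and iW: "\<And>x w. x \<in> carrier G \<Longrightarrow> w \<in> W \<Longrightarrow> delta x \<star> w \<in> W"
    and iW': "\<And>x w. x \<in> carrier G \<Longrightarrow> w \<in> W' \<Longrightarrow> delta x \<star> w \<in> W'"
    using W W' by (auto simp: invariant_subspace_def)
  obtain d :: nat and f :: "nat \<Rightarrow> ('a \<Rightarrow> 'c) \<Rightarrow> 'c" and c :: "nat \<Rightarrow> 'a \<Rightarrow> 'c"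
    where lin: "\<And>i. Vector_Spaces.linear (\<lambda>c f x. c * f x) (*) (f i)"
      and cW: "\<And>i. i < d \<Longrightarrow> c i \<in> W"
      and fc: "\<And>i j. i < d \<Longrightarrow> j < d \<Longrightarrow> f i (c j) = (if i = j then 1 else 0)"
      and ker: "W' = {w \<in> W. \<forall>i<d. f i w = 0}"
    by (rule invariant_subspace_coordinates[OF sW' sW(1) psubset_imp_subset[OF sub] sW(2)]) (rule that)
  define comb where "comb a = (\<Sum>j<d. (\<lambda>x. a j * c j x))" for a
  have combW: "comb a \<in> W" for a
    unfolding comb_def by (intro fun_vs.subspace_sum[OF sW(1)] fun_vs.subspace_scale[OF sW(1)]) (simp add: cW)
  have f_add: "f i (v + w) = f i v + f i w" and f_scale: "f i (\<lambda>x. r * v x) = r * f i v" for i v w r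
  proof -
    interpret l: Vector_Spaces.linear "\<lambda>c f x. c * f x" "(*)" "f i" by (rule lin)
    show "f i (v + w) = f i v + f i w" "f i (\<lambda>x. r * v x) = r * f i v" by (simp_all add: l.add l.scale)
  qed
  have f_sum: "f i (\<Sum>y\<in>carrier G. (\<lambda>x. a y * b y x)) = (\<Sum>y\<in>carrier G. a y * f i (b y))"
    for i a and b :: "'a \<Rightarrow> 'a \<Rightarrow> 'c"
  proof -
    interpret l: Vector_Spaces.linear "\<lambda>c f x. c * f x" "(*)" "f i" by (rule lin)
    show ?thesis by (simp add: l.sum l.scale)
  qed
  have f_sum': "f i (\<Sum>j<d. (\<lambda>x. a j * b j x)) = (\<Sum>j<d. a j * f i (b j))" for i a and b :: "nat \<Rightarrow> 'a \<Rightarrow> 'c"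
  proof -
    interpret l: Vector_Spaces.linear "\<lambda>c f x. c * f x" "(*)" "f i" by (rule lin)
    show ?thesis by (simp add: l.sum l.scale)
  qed
  have fcomb: "f i (comb a) = a i" if "i < d" for i a
    using that unfolding comb_def f_sum' by (simp add: fc if_distrib cong: if_cong)
  \<comment> \<open>An element of \<open>W\<close> and the combination of the \<open>c j\<close> with the same coordinates differ by an element
     of \<open>W'\<close>, which \<open>delta x\<close> preserves.\<close>
  have act: "f i (delta x \<star> w) = (\<Sum>j<d. f i (delta x \<star> c j) * f j w)"
    if x: "x \<in> carrier G" and w: "w \<in> W" and i: "i < d" for x w i
  proof -
    interpret dx: Vector_Spaces.linear "\<lambda>(c::'c) f x. c * f x" "\<lambda>c f x. c * f x" "\<lambda>v. delta x \<star> v"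
      by (rule linear_GA_mult)
    let ?v = "comb (\<lambda>j. f j w)"
    let ?r = "w + (\<lambda>x. (- 1) * ?v x)"
    have "?r \<in> W"
      by (rule fun_vs.subspace_add[OF sW(1) w fun_vs.subspace_scale[OF sW(1) combW]])
    moreover have "f j ?r = 0" if "j < d" for j
      unfolding f_add f_scale fcomb[OF that] by simp
    ultimately have "?r \<in> W'" unfolding ker by blast
    then have "f i (delta x \<star> ?r) = 0" using iW'[OF x] i unfolding ker by blast
    then have "f i (delta x \<star> w) = f i (delta x \<star> ?v)"
      by (simp only: dx.add dx.scale f_add f_scale) simp
    also have "delta x \<star> ?v = (\<Sum>j<d. (\<lambda>y. f j w * (delta x \<star> c j) y))"
      unfolding comb_def dx.sum by (simp only: dx.scale)
    finally show ?thesis unfolding f_sum' by (simp add: mult.commute)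
  qed
  define \<sigma> where "\<sigma> x = mat d d (\<lambda>(i, j). f i (delta x \<star> c j))" for x
  define \<phi> where "\<phi> w = vec d (\<lambda>i. f i w)" for w
  have \<phi>_act: "\<sigma> x *\<^sub>v \<phi> w = \<phi> (delta x \<star> w)" if "x \<in> carrier G" "w \<in> W" for x w
    by (rule eq_vecI) (use act[OF that] in \<open>auto simp: \<sigma>_def \<phi>_def scalar_prod_def lessThan_atLeast0\<close>)
  have rep: "representation G d \<sigma>"
    unfolding representation_def
  proof (intro conjI ballI)
    show "\<sigma> \<one> = 1\<^sub>m d"
    proof (rule eq_matI)
      fix i j assume "i < dim_row (1\<^sub>m d :: 'c mat)" "j < dim_col (1\<^sub>m d :: 'c mat)"
      then have ij: "i < d" "j < d" by auto
      have "delta \<one> \<star> c j = c j"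
        using GA.l_one[of "c j"] cW[OF ij(2)] sW(2) by (auto simp: GA_one)
      then show "\<sigma> \<one> $$ (i, j) = 1\<^sub>m d $$ (i, j)" using ij by (simp add: \<sigma>_def fc)
    qed (auto simp: \<sigma>_def)
    fix x y assume x: "x \<in> carrier G" and y: "y \<in> carrier G"
    show "\<sigma> (x \<otimes> y) = \<sigma> x * \<sigma> y"
    proof (rule eq_matI)
      fix i j assume "i < dim_row (\<sigma> x * \<sigma> y)" "j < dim_col (\<sigma> x * \<sigma> y)"
      then have ij: "i < d" "j < d" by (auto simp: \<sigma>_def)
      have "delta (x \<otimes> y) \<star> c j = delta x \<star> (delta y \<star> c j)"
        using cW[OF ij(2)] sW(2) x y
        by (subst GA.m_assoc[symmetric]) (auto simp: delta_mult_delta intro: delta_closed)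
      then have "\<sigma> (x \<otimes> y) $$ (i, j) = f i (delta x \<star> (delta y \<star> c j))"
        using ij by (simp add: \<sigma>_def)
      also have "\<dots> = (\<Sum>k<d. f i (delta x \<star> c k) * f k (delta y \<star> c j))"
        by (rule act[OF x iW[OF y cW[OF ij(2)]] ij(1)])
      finally show "\<sigma> (x \<otimes> y) $$ (i, j) = (\<sigma> x * \<sigma> y) $$ (i, j)"
        using ij by (simp add: \<sigma>_def scalar_prod_def lessThan_atLeast0)
    qed (auto simp: \<sigma>_def)
  qed (simp add: \<sigma>_def)
  have d0: "d > 0" using sub ker by (cases d) auto
  have "irreducible_rep G d \<sigma>"
    unfolding irreducible_rep_def
  proof (intro conjI allI impI rep d0)
    fix Z :: "'c vec set"
    assume Z: "VectorSpace.subspace class_ring Z (module_vec TYPE('c) d) \<and>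
      (\<forall>g\<in>carrier G. \<forall>w\<in>Z. \<sigma> g *\<^sub>v w \<in> Z)"
    note Zs = subspace_module_vecD[OF conjunct1[OF Z]]
    \<comment> \<open>Invariant subspaces of the matrix representation correspond to left ideals between \<open>W'\<close> and \<open>W\<close>.\<close>
    let ?U = "{w \<in> W. \<phi> w \<in> Z}"
    have surj: "\<phi> (comb (\<lambda>i. z $ i)) = z" if "z \<in> carrier_vec d" for z
      using that by (intro eq_vecI) (auto simp: \<phi>_def fcomb)
    have \<phi>_add: "\<phi> (v + w) = \<phi> v + \<phi> w" and \<phi>_scale: "\<phi> (\<lambda>x. r * v x) = r \<cdot>\<^sub>v \<phi> v"
      and \<phi>_0: "\<phi> 0 = 0\<^sub>v d" for v w r
      using f_scale[of _ 0 0] by (auto simp: \<phi>_def f_add f_scale zero_fun_def)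
    have "fun_vs.subspace ?U"
      using Zs sW(1) \<phi>_0 by (auto intro!: fun_vs.subspaceI simp: \<phi>_add \<phi>_scale fun_vs.subspace_0
          fun_vs.subspace_add fun_vs.subspace_scale)
    then have "invariant_subspace ?U"
      using sW(2) iW conjunct2[OF Z] unfolding invariant_subspace_def by (auto simp: \<phi>_act[symmetric])
    moreover have "W' \<subseteq> ?U"
    proof
      fix w assume w: "w \<in> W'"
      then have "\<phi> w = 0\<^sub>v d" unfolding ker \<phi>_def by auto
      then show "w \<in> ?U" using w Zs(2) ker by auto
    qed
    ultimately consider "?U = W'" | "?U = W" using simple[of ?U] by blast
    then show "Z = {0\<^sub>v d} \<or> Z = carrier_vec d"
    proof cases
      case 1
      have "z = 0\<^sub>v d" if z: "z \<in> Z" for z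
      proof -
        have zc: "z \<in> carrier_vec d" using z Zs(1) by blast
        then have "comb (\<lambda>i. z $ i) \<in> W'" using surj z combW 1 by auto
        then have "\<phi> (comb (\<lambda>i. z $ i)) = 0\<^sub>v d" unfolding ker \<phi>_def by auto
        then show ?thesis using surj[OF zc] by simp
      qed
      then show ?thesis using Zs(2) by blast
    next
      case 2
      have "z \<in> Z" if "z \<in> carrier_vec d" for z using surj[OF that] combW[of "\<lambda>i. z $ i"] 2 by (metis (mono_tags, lifting) mem_Collect_eq)
      then show ?thesis using Zs(1) by blast
    qed
  qed
  moreover have "a \<star> w \<in> W'" if 0: "rep_algebra G d \<sigma> a = 0\<^sub>m d d" and w: "w \<in> W" for a w
  proof -
    have "a \<star> w \<in> W"
      unfolding GA_mult_sum_delta[of a]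
      by (intro fun_vs.subspace_sum[OF sW(1)] fun_vs.subspace_scale[OF sW(1)] iW w)
    moreover have "f i (a \<star> w) = 0" if i: "i < d" for i
    proof -
      have "f i (a \<star> w) = (\<Sum>x\<in>carrier G. a x * f i (delta x \<star> w))"
        by (subst GA_mult_sum_delta, rule f_sum)
      also have "\<dots> = (\<Sum>x\<in>carrier G. \<Sum>j<d. a x * \<sigma> x $$ (i, j) * f j w)"
        by (intro sum.cong[OF refl]) (simp add: act[OF _ w i] \<sigma>_def i sum_distrib_left mult.assoc)
      also have "\<dots> = (\<Sum>j<d. \<Sum>x\<in>carrier G. a x * \<sigma> x $$ (i, j) * f j w)" by (rule sum.swap)
      also have "\<dots> = (\<Sum>j<d. rep_algebra G d \<sigma> a $$ (i, j) * f j w)"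
        by (intro sum.cong[OF refl]) (simp add: rep_algebra_index i sum_distrib_right)
      finally show ?thesis using i by (simp add: 0)
    qed
    ultimately show ?thesis unfolding ker by blast
  qed
  ultimately show thesis by (rule that)
qed

text \<open>
  An element killed by all irreducible representations maps every left ideal into a maximal proper left
  subideal, and thus goes down a composition series.
\<close>

lemma nilpotent_if_irreducibles_vanish:
  fixes a :: "'a \<Rightarrow> 'c::field"
  assumes a: "\<And>n \<sigma> :: 'a \<Rightarrow> 'c mat. irreducible_rep G n \<sigma> \<Longrightarrow> rep_algebra G n \<sigma> a = 0\<^sub>m n n"
    and W: "invariant_subspace W"
  shows "\<exists>k. \<forall>w \<in> W. ((\<lambda>v. a \<star> v) ^^ k) w = 0"
  using W
proof (induction "fun_vs.dim W" arbitrary: W rule: less_induct)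
  case less
  have sW: "fun_vs.subspace W" "W \<subseteq> carrier GA" using less.prems by (auto simp: invariant_subspace_def)
  show ?case
  proof (cases "W = {0}")
    case True
    then show ?thesis by (intro exI[of _ 0]) auto
  next
    case False
    let ?P = "\<lambda>U. invariant_subspace U \<and> U \<subset> W"
    have dim_less: "fun_vs.dim U < fun_vs.dim V"
      if "invariant_subspace U" "invariant_subspace V" "U \<subset> V" for U V
      using that dim_strict_mono[of U V] by (auto simp: invariant_subspace_def)
    have "(\<lambda>g. 0) = (0 :: 'a \<Rightarrow> 'c)" by auto
    then have "invariant_subspace {0 :: 'a \<Rightarrow> 'c}"
      by (auto simp: invariant_subspace_def carrier_GA group_algebra_def fun_eq_iff)
    moreover have "{0} \<subset> W" using False fun_vs.subspace_0[OF sW(1)] by auto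
    ultimately have "?P {0}" by blast
    moreover have "\<forall>U. ?P U \<longrightarrow> fun_vs.dim U < fun_vs.dim W" using dim_less less.prems by blast
    ultimately have "\<exists>W'. ?P W' \<and> (\<forall>U. ?P U \<longrightarrow> fun_vs.dim U \<le> fun_vs.dim W')"
      by (rule ex_has_greatest_nat)
    then obtain W' where W': "?P W'" and max: "\<And>U. ?P U \<Longrightarrow> fun_vs.dim U \<le> fun_vs.dim W'"
      by blast
    have simple: "U = W' \<or> U = W" if U: "invariant_subspace U" "W' \<subseteq> U" "U \<subseteq> W" for U
      using max[of U] dim_less[of W' U] W' U by fastforce
    obtain n and \<sigma> :: "'a \<Rightarrow> 'c mat" where irr: "irreducible_rep G n \<sigma>"
      and step: "\<And>a w. rep_algebra G n \<sigma> a = 0\<^sub>m n n \<Longrightarrow> w \<in> W \<Longrightarrow> a \<star> w \<in> W'"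
      by (rule simple_quotient_rep[OF conjunct1[OF W'] less.prems conjunct2[OF W'] simple], assumption+)
         (rule that)
    obtain k where "\<forall>w \<in> W'. ((\<lambda>v. a \<star> v) ^^ k) w = 0"
      using less.hyps[OF dim_less[OF conjunct1[OF W'] less.prems conjunct2[OF W']] conjunct1[OF W']] by blast
    then have "\<forall>w \<in> W. ((\<lambda>v. a \<star> v) ^^ Suc k) w = 0"
      using step[OF a[OF irr]] by (simp only: funpow_Suc_right o_apply) blast
    then show ?thesis by (rule exI)
  qed
qed

lemma invariant_subspace_carrier: "invariant_subspace (carrier (GA :: ('a \<Rightarrow> 'c::field) ring))"
  by (simp add: invariant_subspace_def carrier_GA_subspace GA_mult_closed)

section \<open>Elements acting unipotently on a block\<close>

lemma act_add_scaled:
  "delta x \<star> (\<lambda>g. v g + c * u g) = (\<lambda>g. (delta x \<star> v) g + c * (delta x \<star> u) g)"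
  by (auto simp: group_algebra_def fun_eq_iff distrib_left sum.distrib sum_distrib_left mult_ac)

lemma act_act:
  assumes "x \<in> carrier G" "y \<in> carrier G" "v \<in> carrier GA"
  shows "delta x \<star> (delta y \<star> v) = delta (x \<otimes> y) \<star> v"
  using assms by (simp add: GA.m_assoc[symmetric] delta_closed delta_mult_delta)

lemma act_one: "v \<in> carrier GA \<Longrightarrow> delta \<one> \<star> v = v"
  using GA.l_one[of v] by (simp add: GA_one)

definition shift_diff :: "'a \<Rightarrow> ('a \<Rightarrow> 'c::comm_ring_1) \<Rightarrow> 'a \<Rightarrow> 'c" where
  "shift_diff x v = (delta x \<star> v) \<ominus>\<^bsub>GA\<^esub> v"

lemma shift_diff_apply: "v \<in> carrier GA \<Longrightarrow> shift_diff x v = (\<lambda>g. (delta x \<star> v) g - v g)"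
  by (simp add: shift_diff_def GA_minus GA_mult_closed)

lemma shift_diff_closed: "v \<in> carrier GA \<Longrightarrow> shift_diff x v \<in> carrier GA"
  by (simp add: shift_diff_def GA_mult_closed)

lemma act_pow_fixed:
  assumes "x \<in> carrier G" "v \<in> carrier GA" "delta x \<star> v = v"
  shows "delta (x [^] (i::nat)) \<star> v = v"
proof (induction i)
  case (Suc i)
  have "delta (x [^] Suc i) \<star> v = delta (x [^] i) \<star> (delta x \<star> v)"
    using act_act[OF nat_pow_closed[OF assms(1)] assms(1,2), of i] by simp
  then show ?case by (simp only: assms(3) Suc.IH)
qed (use assms in \<open>simp add: act_one\<close>)

text \<open>
  If \<open>(y - 1)\<^sup>2 v = 0\<close>, each factor \<open>y\<close> adds the same term \<open>(y - 1) v\<close>. The exponent \<open>p\<close> in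
  characteristic \<open>p\<close>, and the order of the group in characteristic 0, are used in the next two lemmas.
\<close>

lemma act_pow_unipotent:
  assumes y: "y \<in> carrier G" and v: "v \<in> carrier GA"
    and fixd: "delta y \<star> shift_diff y v = shift_diff y v"
  shows "delta (y [^] (i::nat)) \<star> v = (\<lambda>g. v g + of_nat i * shift_diff y v g)"
proof (induction i)
  case (Suc i)
  have "y [^] Suc i = y \<otimes> y [^] i" using y by (rule nat_pow_Suc2)
  then have "delta (y [^] Suc i) \<star> v = delta y \<star> (delta (y [^] i) \<star> v)"
    using y v by (simp add: act_act)
  also have "\<dots> = (\<lambda>g. (delta y \<star> v) g + of_nat i * shift_diff y v g)"
    unfolding Suc.IH act_add_scaled fixd ..
  also have "\<dots> = (\<lambda>g. v g + of_nat (Suc i) * shift_diff y v g)"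
    by (auto simp: shift_diff_apply[OF v] algebra_simps)
  finally show ?case .
qed (use v in \<open>simp add: act_one\<close>)

text \<open>
  By induction some power \<open>y\<close> of \<open>x\<close> with exponent a power of \<open>p\<close> fixes \<open>(x - 1) v\<close>. As \<open>x\<close> and \<open>y\<close>
  commute, \<open>x\<close> and hence also \<open>y\<close> fixes \<open>(y - 1) v\<close>, and \<open>y\<^sup>p v = v + p (y - 1) v = v\<close>.
\<close>

lemma unipotent_char_p:
  fixes v :: "'a \<Rightarrow> 'c::field"
  assumes x: "x \<in> carrier G" and p: "of_nat p = (0 :: 'c)"
    and "v \<in> carrier GA" "((shift_diff x) ^^ k) v = 0"
  shows "\<exists>j. delta (x [^] (p ^ j)) \<star> v = v"
  using assms(3,4)
proof (induction k arbitrary: v)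
  case 0
  then show ?case by (auto simp: group_algebra_def fun_eq_iff)
next
  case (Suc k)
  note v = Suc.prems(1)
  let ?d = "shift_diff x v"
  have "((shift_diff x) ^^ k) ?d = 0" using Suc.prems(2) by (simp only: funpow_Suc_right o_apply)
  from Suc.IH[OF shift_diff_closed[OF v] this]
  obtain j where j: "delta (x [^] (p ^ j)) \<star> ?d = ?d" by blast
  define y where "y = x [^] (p ^ j)"
  have y: "y \<in> carrier G" using x by (simp add: y_def)
  have xy: "x \<otimes> y = y \<otimes> x" using nat_pow_Suc2[OF x, of "p ^ j"] by (simp add: y_def)
  let ?u = "shift_diff y v"
  have u: "?u \<in> carrier GA" by (rule shift_diff_closed[OF v])
  have d1: "delta y \<star> ?d = (delta (x \<otimes> y) \<star> v) \<ominus>\<^bsub>GA\<^esub> (delta y \<star> v)"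
    and d2: "delta x \<star> ?u = (delta (x \<otimes> y) \<star> v) \<ominus>\<^bsub>GA\<^esub> (delta x \<star> v)"
    unfolding shift_diff_def a_minus_def using x y v xy
    by (simp_all add: GA.r_distr GA.r_minus delta_closed act_act GA_mult_closed)
  have "delta x \<star> ?u = ?u"
  proof
    fix g
    have "(delta y \<star> ?d) g = ?d g" using j by (simp add: y_def)
    then show "(delta x \<star> ?u) g = ?u g"
      unfolding d1 d2 by (simp add: GA_minus GA_mult_closed shift_diff_apply[OF v] algebra_simps)
  qed
  from act_pow_fixed[OF x u this] have "delta y \<star> ?u = ?u" by (simp add: y_def)
  from act_pow_unipotent[OF y v this, of p] have "delta (y [^] p) \<star> v = v" by (simp add: p)
  moreover have "y [^] p = x [^] (p ^ Suc j)" using x by (simp add: y_def nat_pow_pow mult.commute)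
  ultimately show ?case by metis
qed

text \<open>
  By induction \<open>x\<close> fixes \<open>(x - 1) v\<close>. So \<open>v = x\<^sup>n v = v + n (x - 1) v\<close> for the order \<open>n\<close> of the group.
\<close>

lemma unipotent_char_0:
  fixes v :: "'a \<Rightarrow> 'c::field_char_0"
  assumes x: "x \<in> carrier G" and "v \<in> carrier GA" "((shift_diff x) ^^ k) v = 0"
  shows "delta x \<star> v = v"
  using assms(2,3)
proof (induction k arbitrary: v)
  case 0
  then show ?case by (auto simp: group_algebra_def fun_eq_iff)
next
  case (Suc k)
  note v = Suc.prems(1)
  let ?d = "shift_diff x v"
  have "((shift_diff x) ^^ k) ?d = 0" using Suc.prems(2) by (simp only: funpow_Suc_right o_apply)
  from Suc.IH[OF shift_diff_closed[OF v] this]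
  have "delta x \<star> ?d = ?d" .
  from act_pow_unipotent[OF x v this, of "order G"]
  have "v = (\<lambda>g. v g + of_nat (order G) * ?d g)" using x v by (simp add: pow_order_eq_1 act_one)
  then have "?d g = 0" for g
    using order_gt_0_iff_finite by (auto simp: fun_eq_iff)
  then show ?case by (auto simp: shift_diff_apply[OF v] fun_eq_iff)
qed

text \<open>
  All irreducible representations kill \<open>(x - 1) e\<close>, because either \<open>e\<close> or \<open>x - 1\<close> acts as 0.
\<close>

lemma unipotent_on_block:
  fixes e :: "'a \<Rightarrow> 'c::field"
  assumes e: "central_idempotent GA e" and x: "x \<in> carrier G"
    and triv: "\<And>n \<rho>. irreducible_rep G n \<rho> \<Longrightarrow> rep_algebra G n \<rho> e = 1\<^sub>m n \<Longrightarrow> \<rho> x = 1\<^sub>m n"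
  shows "\<exists>k. ((shift_diff x) ^^ k) e = 0"
proof -
  have ec: "e \<in> carrier GA" and ee: "e \<star> e = e"
    and ez: "\<And>a. a \<in> carrier GA \<Longrightarrow> e \<star> a = a \<star> e"
    using e by (auto simp: central_idempotent_def)
  let ?a = "(delta x \<ominus>\<^bsub>GA\<^esub> \<one>\<^bsub>GA\<^esub>) \<star> e"
  have dx: "(delta x :: 'a \<Rightarrow> 'c) \<in> carrier GA" by (rule delta_closed[OF x])
  have "rep_algebra G n \<rho> ?a = 0\<^sub>m n n" if irr: "irreducible_rep G n \<rho>" for n \<rho>
  proof -
    note rep = irreducible_repD(1)[OF irr]
    have "rep_algebra G n \<rho> ?a = (\<rho> x - \<rho> \<one>) * rep_algebra G n \<rho> e"
      using x dx by (simp add: rep_algebra_mult[OF rep] rep_algebra_minus rep_algebra_delta[OF rep] GA_one delta_closed)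
    moreover have "\<rho> \<one> = 1\<^sub>m n" using rep by (simp add: representation_def)
    ultimately show ?thesis
      using central_idempotent_rep[OF irr e] triv[OF irr] representation_carrier[OF rep x] by auto
  qed
  from nilpotent_if_irreducibles_vanish[OF this invariant_subspace_carrier]
  obtain k where k: "((\<lambda>v. ?a \<star> v) ^^ k) e = 0" using ec by blast
  have "((\<lambda>v. ?a \<star> v) ^^ k) e = ((shift_diff x) ^^ k) e \<and> ((shift_diff x) ^^ k) e \<in> carrier GA
      \<and> e \<star> ((shift_diff x) ^^ k) e = ((shift_diff x) ^^ k) e" for k
  proof (induction k)
    case (Suc k)
    let ?u = "((shift_diff x) ^^ k) e"
    have u: "?u \<in> carrier GA" "e \<star> ?u = ?u" using Suc.IH by auto
    have a: "?a \<star> ?u = shift_diff x ?u"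
      using u ec dx by (simp add: GA.m_assoc shift_diff_def a_minus_def GA.l_distr GA.l_minus)
    have "e \<star> (delta x \<star> ?u) = delta x \<star> ?u"
      using u ec dx ez[OF dx] by (metis GA.m_assoc)
    then have "e \<star> shift_diff x ?u = shift_diff x ?u"
      using u ec dx by (simp add: shift_diff_def a_minus_def GA.r_distr GA.r_minus)
    then show ?case using Suc.IH a shift_diff_closed[OF u(1)] by simp
  qed (use ec ee in auto)
  then show ?thesis using k by metis
qed

text \<open>A central idempotent killed by all irreducible representations would be nilpotent.\<close>

lemma exists_irreducible_in_idempotent:
  fixes e :: "'a \<Rightarrow> 'c::field"
  assumes e: "central_idempotent GA e" and nz: "e \<noteq> \<zero>\<^bsub>GA\<^esub>"
  obtains n and \<rho> :: "'a \<Rightarrow> 'c mat" where "irreducible_rep G n \<rho>" "rep_algebra G n \<rho> e = 1\<^sub>m n"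
proof (rule ccontr)
  assume "\<not> thesis"
  then have "rep_algebra G n \<rho> e = 0\<^sub>m n n" if "irreducible_rep G n \<rho>" for n and \<rho> :: "'a \<Rightarrow> 'c mat"
    using central_idempotent_rep[OF that e] that \<open>\<And>n \<rho>. irreducible_rep G n \<rho> \<Longrightarrow> rep_algebra G n \<rho> e = 1\<^sub>m n \<Longrightarrow> thesis\<close> by blast
  from nilpotent_if_irreducibles_vanish[OF this invariant_subspace_carrier]
  obtain k where "((\<lambda>v. e \<star> v) ^^ k) e = 0" using e by (auto simp: central_idempotent_def)
  moreover have "((\<lambda>v. e \<star> v) ^^ k) e = e"
    by (induction k) (use e in \<open>auto simp: central_idempotent_def\<close>)
  ultimately show False using nz by (simp add: GA_zero zero_fun_def)
qed

section \<open>Stabilizers of central idempotents\<close>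

lemma act_fixed_iff:
  assumes x: "x \<in> carrier G" and v: "v \<in> carrier GA"
  shows "delta x \<star> v = v \<longleftrightarrow> (\<forall>g \<in> carrier G. v (inv x \<otimes> g) = v g)"
proof
  assume "delta x \<star> v = v"
  then show "\<forall>g \<in> carrier G. v (inv x \<otimes> g) = v g" using delta_mult[OF x] by metis
next
  assume "\<forall>g \<in> carrier G. v (inv x \<otimes> g) = v g"
  then show "delta x \<star> v = v" using x by (intro GA_eqI[OF GA_mult_closed v]) (simp add: delta_mult)
qed

lemma rep_trivial_if_fixed:
  assumes \<rho>: "representation G n \<rho>" and e: "rep_algebra G n \<rho> e = 1\<^sub>m n"
    and x: "x \<in> carrier G" and fixed: "delta x \<star> e = e"
  shows "\<rho> x = 1\<^sub>m n"
proof -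
  have "rep_algebra G n \<rho> (delta x \<star> e) = \<rho> x * 1\<^sub>m n"
    unfolding rep_algebra_mult[OF \<rho>] rep_algebra_delta[OF \<rho> x] e ..
  then show ?thesis using representation_carrier[OF \<rho> x] by (simp add: fixed e)
qed

lemma fixed_if_absorbs:
  assumes e: "central_idempotent GA e" and E: "E \<in> carrier GA" "e \<star> E = e"
    and x: "x \<in> carrier G" "delta x \<star> E = E"
  shows "delta x \<star> e = e"
proof -
  have ec: "e \<in> carrier GA" and comm: "e \<star> E = E \<star> e"
    using e E(1) unfolding central_idempotent_def by blast+
  have Ee: "E \<star> e = e" using E(2) comm by metis
  have "delta x \<star> (E \<star> e) = delta x \<star> E \<star> e"
    by (rule GA.m_assoc[OF delta_closed[OF x(1)] E(1) ec, symmetric])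
  then show ?thesis by (simp only: x(2) Ee)
qed

lemma subgroup_stabilizer:
  fixes e :: "'a \<Rightarrow> 'c::comm_ring_1"
  assumes e: "e \<in> carrier GA"
  shows "subgroup {x \<in> carrier G. delta x \<star> e = e} G"
proof (rule subgroup.intro)
  fix x assume x: "x \<in> {x \<in> carrier G. delta x \<star> e = e}"
  then have "delta (inv x) \<star> e = e" using act_act[of "inv x" x e] e by (simp add: act_one)
  then show "inv x \<in> {x \<in> carrier G. delta x \<star> e = e}" using x by auto
next
  fix x y assume xy: "x \<in> {x \<in> carrier G. delta x \<star> e = e}" "y \<in> {x \<in> carrier G. delta x \<star> e = e}"
  then have "delta (x \<otimes> y) \<star> e = e" using act_act[of x y e] e by simp
  then show "x \<otimes> y \<in> {x \<in> carrier G. delta x \<star> e = e}" using xy by simp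
qed (use e in \<open>auto simp: act_one\<close>)

lemma normal_stabilizer:
  fixes e :: "'a \<Rightarrow> 'c::comm_ring_1"
  assumes e: "central_idempotent GA e"
  shows "{x \<in> carrier G. delta x \<star> e = e} \<lhd> G"
proof -
  have ec: "e \<in> carrier GA" and ez: "\<forall>a \<in> carrier GA. e \<star> a = a \<star> e"
    using e unfolding central_idempotent_def by blast+
  have "delta (g \<otimes> x \<otimes> inv g) \<star> e = e"
    if g: "g \<in> carrier G" and x: "x \<in> carrier G" and fixed: "delta x \<star> e = e" for g x
  proof -
    have d: "(delta (inv g) :: 'a \<Rightarrow> 'c) \<in> carrier GA" "(delta x :: 'a \<Rightarrow> 'c) \<in> carrier GA"
      "(delta g :: 'a \<Rightarrow> 'c) \<in> carrier GA" using g x by (auto intro: delta_closed)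
    have "delta (g \<otimes> x \<otimes> inv g) \<star> e = delta g \<star> (delta x \<star> (delta (inv g) \<star> e))"
      using g x ec by (simp add: act_act GA_mult_closed m_assoc)
    also have "delta (inv g) \<star> e = e \<star> delta (inv g)" using ez d(1) by metis
    also have "delta x \<star> (e \<star> delta (inv g)) = e \<star> delta (inv g)"
      unfolding GA.m_assoc[OF d(2) ec d(1), symmetric] fixed ..
    also have "e \<star> delta (inv g) = delta (inv g) \<star> e" using ez d(1) by metis
    also have "delta g \<star> (delta (inv g) \<star> e) = e" using g ec by (simp add: act_act act_one)
    finally show ?thesis .
  qed
  then show ?thesis using subgroup_stabilizer[OF ec] by (simp add: normal_inv_iff)
qed

text \<open>
  Summing \<open>e = e * e\<close> over cosets of a subgroup fixing \<open>e\<close> produces the order of the subgroup as a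
  factor.
\<close>

lemma stabilizer_order_invertible:
  fixes e :: "'a \<Rightarrow> 'c::comm_ring_1"
  assumes e: "central_idempotent GA e" and nz: "e \<noteq> \<zero>\<^bsub>GA\<^esub>"
    and S: "subgroup S G" and fixed: "\<And>x. x \<in> S \<Longrightarrow> delta x \<star> e = e"
  shows "of_nat (card S) \<noteq> (0 :: 'c)"
proof
  assume 0: "of_nat (card S) = (0 :: 'c)"
  have ec: "e \<in> carrier GA" and ee: "e \<star> e = e" using e by (auto simp: central_idempotent_def)
  have Sc: "x \<in> carrier G" if "x \<in> S" for x using subgroup.mem_carrier[OF S that] .
  have inv: "e (x \<otimes> g) = e g" if x: "x \<in> S" and g: "g \<in> carrier G" for x g
    using fun_cong[OF fixed[OF subgroup.m_inv_closed[OF S x]], of g] Sc[OF x] g by (simp add: delta_mult)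
  have "e g = 0" if g: "g \<in> carrier G" for g
  proof -
    let ?t = "\<lambda>h. e h * e (inv h \<otimes> g)"
    have t: "?t (x \<otimes> h) = ?t h" if x: "x \<in> S" and h: "h \<in> carrier G" for x h
    proof -
      have xc: "x \<in> carrier G" by (rule Sc[OF x])
      have "e (inv (x \<otimes> h) \<otimes> g) = e (inv h \<otimes> (inv x \<otimes> g))"
        using xc h g by (simp add: inv_mult_group m_assoc)
      also have "\<dots> = e (inv x \<otimes> g \<otimes> inv h)"
        using central_idempotent_class_function[OF e] xc h g by simp
      also have "\<dots> = e (g \<otimes> inv h)"
        using inv[OF subgroup.m_inv_closed[OF S x], of "g \<otimes> inv h"] xc h g by (simp add: m_assoc)
      also have "\<dots> = e (inv h \<otimes> g)"
        using central_idempotent_class_function[OF e] h g by simp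
      finally show ?thesis using inv[OF x h] by simp
    qed
    have "e g = (e \<star> e) g" by (simp add: ee)
    also have "\<dots> = sum ?t (carrier G)" by (rule GA_mult[OF g])
    also have "\<dots> = sum ?t (\<Union>(rcosets S))" using rcosets_part_G[OF S] by simp
    also have "\<dots> = (\<Sum>C\<in>rcosets S. sum ?t C)"
    proof (subst sum.Union_disjoint)
      show "\<forall>C\<in>rcosets S. finite C"
        using rcosets_part_G[OF S] finite_carrier by (metis Sup_upper finite_subset)
      show "\<forall>A\<in>rcosets S. \<forall>B\<in>rcosets S. A \<noteq> B \<longrightarrow> A \<inter> B = {}"
        using rcos_disjoint[OF S] by (auto simp: pairwise_def disjnt_def)
    qed simp
    also have "\<dots> = 0"
    proof (rule sum.neutral, rule ballI)
      fix C assume C: "C \<in> rcosets S"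
      then obtain h where h: "h \<in> carrier G" "C = S #> h" by (auto simp: RCOSETS_def)
      have "sum ?t C = (\<Sum>_\<in>C. ?t h)"
        by (rule sum.cong) (use t[OF _ h(1)] in \<open>auto simp: h(2) r_coset_def\<close>)
      also have "\<dots> = of_nat (card S) * ?t h"
        using card_rcosets_equal[OF C] Sc by (simp add: subset_iff)
      finally show "sum ?t C = 0" by (simp add: 0)
    qed
    finally show ?thesis .
  qed
  then have "e = \<zero>\<^bsub>GA\<^esub>" using ec by (intro GA_eqI) (auto simp: GA_zero carrier_GA)
  then show False using nz by simp
qed

text \<open>
  The element \<open>E\<close> averages over \<open>N\<close>. The inverse \<open>c\<close> of the order of \<open>N\<close> is a parameter, so that
  coefficients in a valuation ring are covered.
\<close>

lemma subgroup_average: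
  fixes c :: "'c::comm_ring_1"
  assumes N: "N \<lhd> G" and c: "c * of_nat (card N) = 1"
  defines "E \<equiv> \<lambda>g. if g \<in> N then c else 0"
  shows "central_idempotent GA E" "augmentation E = 1"
    "\<And>x. x \<in> N \<Longrightarrow> delta x \<star> E = E"
proof -
  note sN = normal_imp_subgroup[OF N] and Nc = subgroup.mem_carrier[OF normal_imp_subgroup[OF N]]
  have Ec: "E \<in> carrier GA" using Nc by (auto simp: E_def carrier_GA)
  have mem: "x \<otimes> g \<in> N \<longleftrightarrow> g \<in> N" if "x \<in> N" "g \<in> carrier G" for x g
    using that Nc[OF that(1)] subgroup.m_closed[OF sN] subgroup.m_inv_closed[OF sN that(1)] mult_inv_cancel(2) by metis
  have sum: "(\<Sum>h\<in>carrier G. if h \<in> N then c * b else 0) = b" for b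
  proof -
    have "(\<Sum>h\<in>carrier G. if h \<in> N then c * b else 0) = (\<Sum>h\<in>N. c * b)"
      using Nc by (simp add: sum.If_cases Int_absorb1 subset_iff)
    also have "\<dots> = (c * of_nat (card N)) * b" by (simp add: mult_ac)
    finally show ?thesis by (simp add: c)
  qed
  have "\<forall>b \<in> carrier GA. E \<star> b = b \<star> E"
    unfolding central_iff_class_function[OF Ec]
  proof (intro ballI)
    fix g h assume gh: "g \<in> carrier G" "h \<in> carrier G"
    have "g \<otimes> h \<in> N \<Longrightarrow> h \<otimes> g \<in> N" if "g \<in> carrier G" "h \<in> carrier G" for g h
      using normal.inv_op_closed2[OF N that(2), of "g \<otimes> h"] that by (simp add: m_assoc)
    then show "E (g \<otimes> h) = E (h \<otimes> g)" using gh by (auto simp: E_def)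
  qed
  moreover have "E \<star> E = E"
  proof (rule GA_eqI[OF GA_mult_closed Ec])
    fix g assume g: "g \<in> carrier G"
    have "(E \<star> E) g = (\<Sum>h\<in>carrier G. if h \<in> N then c * E g else 0)"
      unfolding GA_mult[OF g]
      by (intro sum.cong refl) (use mem[OF subgroup.m_inv_closed[OF sN] g] in \<open>auto simp: E_def\<close>)
    then show "(E \<star> E) g = E g" by (simp add: sum)
  qed
  ultimately show "central_idempotent GA E" using Ec unfolding central_idempotent_def by blast
  show "augmentation E = 1" using sum[of 1, unfolded mult_1_right] by (simp add: eval_linear_def E_def)
  show "delta x \<star> E = E" if x: "x \<in> N" for x
    unfolding act_fixed_iff[OF Nc[OF x] Ec]
    using mem[OF subgroup.m_inv_closed[OF sN x]] by (simp add: E_def)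
qed

section \<open>Idempotents of augmentation one\<close>

text \<open>The product \<open>e f\<close> is not zero, because it has augmentation 1.\<close>

lemma block_idempotent_one_augmentation_absorb:
  fixes e f :: "'a \<Rightarrow> 'c::field"
  assumes e: "block_idempotent GA e" "augmentation e = 1"
    and f: "central_idempotent GA f" "augmentation f = 1"
  shows "e \<star> f = e"
proof (rule GA.block_idempotent_absorb[OF e(1) f(1)])
  show "e \<star> f \<noteq> \<zero>\<^bsub>GA\<^esub>"
  proof
    assume "e \<star> f = \<zero>\<^bsub>GA\<^esub>"
    then have "augmentation (e \<star> f) = 0" by (simp add: eval_linear_def GA_zero)
    then show False by (simp add: augmentation_mult e f)
  qed
qed

text \<open>
  Among the central idempotents of augmentation 1 choose one whose ideal has least dimension. If it
  split as \<open>e1 + e2\<close>, one of the two augmentations would be 1, and that summand would generate a smaller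
  ideal.
\<close>

lemma principal_idempotent_exists:
  "\<exists>e :: 'a \<Rightarrow> 'c::field. block_idempotent GA e \<and> augmentation e = 1"
proof -
  let ?A = "GA :: ('a \<Rightarrow> 'c) ring"
  let ?P = "\<lambda>e :: 'a \<Rightarrow> 'c. central_idempotent GA e \<and> augmentation e = 1"
  have "?P \<one>\<^bsub>GA\<^esub>" by (simp add: central_idempotent_def) (simp add: GA_one eval_linear_delta)
  then obtain e where e: "?P e"
    and min: "\<And>f. ?P f \<Longrightarrow> fun_vs.dim (block_algebra ?A e) \<le> fun_vs.dim (block_algebra ?A f)"
    using ex_has_least_nat[of ?P "\<one>\<^bsub>GA\<^esub>" "\<lambda>e. fun_vs.dim (block_algebra ?A e)"] by blast
  have ec: "e \<in> carrier GA" using e by (simp add: central_idempotent_def)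
  have sub: "fun_vs.subspace (block_algebra ?A f)" "block_algebra ?A f \<subseteq> carrier GA" for f
  proof -
    have "(\<lambda>g. c * (a \<star> f) g) = (\<lambda>g. c * a g) \<star> f"
      "(a \<star> f) + (b \<star> f) = (\<lambda>g. a g + b g) \<star> f"
      "0 = (\<lambda>g. 0) \<star> f" for c a b
      by (auto simp: group_algebra_def fun_eq_iff sum_distrib_left distrib_right sum.distrib mult.assoc)
    note lin = this
    have I: "a \<star> f \<in> block_algebra ?A f" if "a \<in> carrier GA" for a
      using that by (auto simp: block_algebra_def)
    show "fun_vs.subspace (block_algebra ?A f)"
    proof (rule fun_vs.subspaceI)
      show "0 \<in> block_algebra ?A f" unfolding lin(3) by (rule I) (simp add: carrier_GA)
    next
      fix x y assume "x \<in> block_algebra ?A f" "y \<in> block_algebra ?A f"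
      then obtain a b where ab: "a \<in> carrier GA" "b \<in> carrier GA" "x = a \<star> f" "y = b \<star> f"
        by (auto simp: block_algebra_def)
      show "x + y \<in> block_algebra ?A f" unfolding ab(3,4) lin(2) by (rule I) (use ab in \<open>simp add: carrier_GA\<close>)
    next
      fix c x assume "x \<in> block_algebra ?A f"
      then obtain a where a: "a \<in> carrier GA" "x = a \<star> f" by (auto simp: block_algebra_def)
      show "(\<lambda>g. c * x g) \<in> block_algebra ?A f" unfolding a(2) lin(1) by (rule I) (use a in \<open>simp add: carrier_GA\<close>)
    qed
    show "block_algebra ?A f \<subseteq> carrier GA" by (auto simp: block_algebra_def GA_mult_closed)
  qed
  have no_split: False
    if f: "central_idempotent GA f" "augmentation f = 1" and f': "central_idempotent GA f'" "f' \<noteq> \<zero>\<^bsub>GA\<^esub>"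
      and ff': "f \<star> f' = \<zero>\<^bsub>GA\<^esub>" and e_eq: "e = f \<oplus>\<^bsub>GA\<^esub> f'" for f f'
  proof -
    have c: "f \<in> carrier GA" "f' \<in> carrier GA" "f \<star> f = f" "f' \<star> f' = f'"
      using f f' unfolding central_idempotent_def by blast+
    have c': "f' \<star> f = \<zero>\<^bsub>GA\<^esub>"
      using f c(2) ff' unfolding central_idempotent_def by metis
    have fe: "f \<star> e = f" "f' \<star> e = f'"
      unfolding e_eq using c c' ff' by (simp_all add: GA.r_distr)
    have "block_algebra ?A f \<subseteq> block_algebra ?A e"
    proof
      fix b assume "b \<in> block_algebra ?A f"
      then obtain a where a: "a \<in> carrier GA" "b = a \<star> f" by (auto simp: block_algebra_def)
      then have "b = (a \<star> f) \<star> e" using c ec fe by (simp add: GA.m_assoc)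
      then show "b \<in> block_algebra ?A e" using a c by (auto simp: block_algebra_def GA_mult_closed)
    qed
    moreover have "f' \<in> block_algebra ?A e" using c fe by (force simp: block_algebra_def)
    moreover have "f' \<notin> block_algebra ?A f"
    proof
      assume "f' \<in> block_algebra ?A f"
      then obtain a where a: "a \<in> carrier GA" "f' = a \<star> f" by (auto simp: block_algebra_def)
      then have "f' \<star> f = f'" using c by (simp add: GA.m_assoc)
      then show False using c' f'(2) by simp
    qed
    ultimately have "block_algebra ?A f \<subset> block_algebra ?A e" by (metis psubsetI)
    from dim_strict_mono[OF sub(1) sub(1) this sub(2)] min[OF conjI[OF f]] show False
      by linarith
  qed
  have "block_idempotent GA e"
    unfolding block_idempotent_def
  proof (intro conjI notI)
    show "central_idempotent GA e" by (rule conjunct1[OF e])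
    have "augmentation \<zero>\<^bsub>GA\<^esub> = (0 :: 'c)" by (simp add: eval_linear_def GA_zero)
    then show False if "e = \<zero>\<^bsub>GA\<^esub>" using conjunct2[OF e] unfolding that by simp
    assume "\<exists>e1 e2. central_idempotent ?A e1 \<and> central_idempotent ?A e2 \<and>
               e1 \<noteq> \<zero>\<^bsub>?A\<^esub> \<and> e2 \<noteq> \<zero>\<^bsub>?A\<^esub> \<and> e1 \<otimes>\<^bsub>?A\<^esub> e2 = \<zero>\<^bsub>?A\<^esub> \<and> e = e1 \<oplus>\<^bsub>?A\<^esub> e2"
    then obtain e1 e2 where s: "central_idempotent ?A e1" "central_idempotent ?A e2"
        "e1 \<noteq> \<zero>\<^bsub>?A\<^esub>" "e2 \<noteq> \<zero>\<^bsub>?A\<^esub>" "e1 \<otimes>\<^bsub>?A\<^esub> e2 = \<zero>\<^bsub>?A\<^esub>" "e = e1 \<oplus>\<^bsub>?A\<^esub> e2" by (elim exE conjE) (rule that)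
    have c: "e1 \<in> carrier GA" "e2 \<in> carrier GA" and idem: "e1 \<star> e1 = e1"
      using s(1,2) unfolding central_idempotent_def by blast+
    have s': "e2 \<star> e1 = \<zero>\<^bsub>GA\<^esub>" "e = e2 \<oplus>\<^bsub>GA\<^esub> e1"
      using s(1,5,6) c GA.a_comm[OF c] unfolding central_idempotent_def by metis+
    have "augmentation e = augmentation e1 + augmentation e2"
      unfolding s(6) by (rule eval_linear_add)
    then have sum: "augmentation e1 + augmentation e2 = 1" using conjunct2[OF e] by simp
    have "augmentation e1 * augmentation e1 = augmentation e1"
      unfolding augmentation_mult[symmetric] idem ..
    then consider "augmentation e1 = 0" | "augmentation e1 = 1" by auto
    then show False
    proof cases
      case 1
      then have "augmentation e2 = 1" using sum by simp
      then show False by (rule no_split[OF s(2) _ s(1,3) s'])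
    next
      case 2
      then show False by (rule no_split[OF s(1) _ s(2,4,5,6)])
    qed
  qed
  then show ?thesis using conjunct2[OF e] by (intro exI[of _ e] conjI)
qed

text \<open>
  Multiplying the coefficients by a linear character is an automorphism of the group algebra.
\<close>

lemma twist_central_idempotent:
  fixes l :: "'a \<Rightarrow> 'c::comm_ring_1"
  assumes l: "\<And>g h. g \<in> carrier G \<Longrightarrow> h \<in> carrier G \<Longrightarrow> l (g \<otimes> h) = l g * l h"
    and e: "central_idempotent GA e"
  shows "central_idempotent GA (\<lambda>g. l g * e g)"
proof -
  have ec: "e \<in> carrier GA" and ee: "e \<star> e = e" using e unfolding central_idempotent_def by blast+
  have tc: "(\<lambda>g. l g * e g) \<in> carrier GA" using ec by (simp add: carrier_GA)
  have "(\<lambda>g. l g * e g) \<star> (\<lambda>g. l g * e g) = (\<lambda>g. l g * e g)"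
  proof (rule GA_eqI[OF GA_mult_closed tc])
    fix g assume g: "g \<in> carrier G"
    have "l h * e h * (l (inv h \<otimes> g) * e (inv h \<otimes> g)) = l g * (e h * e (inv h \<otimes> g))"
      if h: "h \<in> carrier G" for h
    proof -
      have "l h * l (inv h \<otimes> g) = l g" using l[of h "inv h \<otimes> g"] g h by (simp add: mult_inv_cancel)
      then show ?thesis by (metis mult.assoc mult.left_commute)
    qed
    then have "((\<lambda>g. l g * e g) \<star> (\<lambda>g. l g * e g)) g = l g * (e \<star> e) g"
      by (simp add: GA_mult[OF g] sum_distrib_left)
    then show "((\<lambda>g. l g * e g) \<star> (\<lambda>g. l g * e g)) g = l g * e g" by (simp only: ee)
  qed
  moreover have "\<forall>b \<in> carrier GA. (\<lambda>g. l g * e g) \<star> b = b \<star> (\<lambda>g. l g * e g)"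
    unfolding central_iff_class_function[OF tc]
    by (intro ballI) (simp add: l central_idempotent_class_function[OF e] mult.commute)
  ultimately show ?thesis using tc unfolding central_idempotent_def by blast
qed

text \<open>
  Twisting a module has the same effect as twisting the elements of the algebra that act on it.
\<close>

lemma twist_irreducible:
  fixes l :: "'a \<Rightarrow> 'c::field"
  assumes l: "\<And>g h. g \<in> carrier G \<Longrightarrow> h \<in> carrier G \<Longrightarrow> l (g \<otimes> h) = l g * l h"
    and l1: "l \<one> = 1" and \<rho>: "irreducible_rep G n \<rho>"
  shows "irreducible_rep G n (\<lambda>g. l g \<cdot>\<^sub>m \<rho> g)"
    and "rep_algebra G n (\<lambda>g. l g \<cdot>\<^sub>m \<rho> g) a = rep_algebra G n \<rho> (\<lambda>g. l g * a g)"
proof -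
  note rep = irreducible_repD(1)[OF \<rho>] and rc = representation_carrier[OF irreducible_repD(1)[OF \<rho>]]
  have "representation G n (\<lambda>g. l g \<cdot>\<^sub>m \<rho> g)"
    unfolding representation_def
  proof (intro conjI ballI)
    fix g h assume g: "g \<in> carrier G" and h: "h \<in> carrier G"
    show "l g \<cdot>\<^sub>m \<rho> g \<in> carrier_mat n n" using rc[OF g] by simp
    show "l (g \<otimes> h) \<cdot>\<^sub>m \<rho> (g \<otimes> h) = l g \<cdot>\<^sub>m \<rho> g * (l h \<cdot>\<^sub>m \<rho> h)"
      unfolding l[OF g h] representation_mult[OF rep g h] using rc[OF g] rc[OF h]
      by (intro eq_matI) (auto simp: scalar_prod_def sum_distrib_left mult_ac)
  qed (use rep l1 in \<open>auto simp: representation_def\<close>)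
  moreover have "W = {0\<^sub>v n} \<or> W = carrier_vec n"
    if W: "VectorSpace.subspace class_ring W (module_vec TYPE('c) n)"
      and inv: "\<forall>g\<in>carrier G. \<forall>w\<in>W. (l g \<cdot>\<^sub>m \<rho> g) *\<^sub>v w \<in> W" for W
  proof -
    note Ws = subspace_module_vecD[OF W]
    show ?thesis
    proof (rule irreducible_invariant[OF \<rho> Ws])
      fix g w assume g: "g \<in> carrier G" and w: "w \<in> W"
      have "l (inv g) * l g = 1" using l[of "inv g" g] g l1 by simp
      moreover have "(l g \<cdot>\<^sub>m \<rho> g) *\<^sub>v w = l g \<cdot>\<^sub>v (\<rho> g *\<^sub>v w)"
        using rc[OF g] Ws(1) w by (intro eq_vecI) (auto simp: scalar_prod_def sum_distrib_left mult.assoc)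
      ultimately have "\<rho> g *\<^sub>v w = l (inv g) \<cdot>\<^sub>v ((l g \<cdot>\<^sub>m \<rho> g) *\<^sub>v w)"
        by (simp add: smult_smult_assoc)
      then show "\<rho> g *\<^sub>v w \<in> W" using inv g w Ws(4) by metis
    qed
  qed
  ultimately show "irreducible_rep G n (\<lambda>g. l g \<cdot>\<^sub>m \<rho> g)"
    using irreducible_repD(2)[OF \<rho>] unfolding irreducible_rep_def by blast
  show "rep_algebra G n (\<lambda>g. l g \<cdot>\<^sub>m \<rho> g) a = rep_algebra G n \<rho> (\<lambda>g. l g * a g)"
    by (rule eq_matI) (auto simp: rep_algebra_def mult_ac intro!: sum.cong dest: rc)
qed

end

section \<open>Complete discrete valuation rings\<close>

lemma ideal_prod_principal:
  fixes a b :: "'r::idom"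
  shows "ideal_prod class_ring {x. a dvd x} {x. b dvd x} = {x. a * b dvd x}"
proof (intro equalityI subsetI)
  fix x assume "x \<in> ideal_prod class_ring {x. a dvd x} {x. b dvd x}"
  then show "x \<in> {x. a * b dvd x}"
    by (induction rule: ideal_prod.induct) (auto simp: mult_dvd_mono)
next
  fix x assume "x \<in> {x. a * b dvd x}"
  then obtain k where "x = (a * k) * b" by (auto simp: dvd_def mult_ac)
  moreover have "(a * k) \<otimes>\<^bsub>class_ring\<^esub> b \<in> ideal_prod class_ring {x. a dvd x} {x. b dvd x}"
    by (rule ideal_prod.prod) auto
  ultimately show "x \<in> ideal_prod class_ring {x. a dvd x} {x. b dvd x}" by simp
qed

lemma ideal_class_ringI:
  fixes I :: "'r::idom set"
  assumes "0 \<in> I" "\<And>x y. x \<in> I \<Longrightarrow> y \<in> I \<Longrightarrow> x + y \<in> I" "\<And>r x. x \<in> I \<Longrightarrow> r * x \<in> I"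
  shows "ideal I class_ring"
proof (rule idealI)
  show "ring (class_ring :: 'r ring)" by (rule class_ring.ring_axioms)
  show "subgroup I (add_monoid class_ring)"
  proof (rule group.subgroupI)
    show "group (add_monoid (class_ring :: 'r ring))"
      using class_ring.add.group_axioms by (simp add: class_ring_simps)
    fix a assume a: "a \<in> I"
    have "inv\<^bsub>add_monoid class_ring\<^esub> a = - a"
      using class_ring_simps(8) unfolding a_inv_def by metis
    then show "inv\<^bsub>add_monoid class_ring\<^esub> a \<in> I" using assms(3)[OF a, of "- 1"] by simp
  qed (use assms in auto)
qed (use assms in \<open>auto simp: mult.commute\<close>)

locale complete_dvr_residue =
  fixes \<pp> :: "'r::idom set" and red :: "'r \<Rightarrow> 'f::field"
  assumes dvr: "discrete_valuation_ring (class_ring :: 'r ring) \<pp>"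
    and complete: "adically_complete (class_ring :: 'r ring) \<pp>"
    and red_hom: "comm_ring_hom red" and red_surj: "surj red"
    and red_kernel: "\<pp> = {a. red a = 0}"

begin

sublocale red: comm_ring_hom red by (rule red_hom)

definition uniformizer :: 'r where "uniformizer = (SOME a. \<pp> = {x. a dvd x})"

lemma ideal_principal: "ideal I (class_ring :: 'r ring) \<Longrightarrow> \<exists>a. I = {x. a dvd x}"
proof -
  assume I: "ideal I (class_ring :: 'r ring)"
  have "principal_domain (class_ring :: 'r ring)" using dvr by (simp add: discrete_valuation_ring_def)
  from principal_domain.exists_gen[OF this I] obtain a where "I = PIdl\<^bsub>class_ring\<^esub> a" by blast
  also have "\<dots> = {x. a dvd x}" by (auto simp: cgenideal_def dvd_def mult.commute)
  finally show ?thesis by blast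
qed

lemma \<pp>_uniformizer: "\<pp> = {x. uniformizer dvd x}"
proof -
  have "ideal \<pp> (class_ring :: 'r ring)"
    using dvr by (simp add: discrete_valuation_ring_def maximalideal_def)
  then have "\<exists>a. \<pp> = {x. a dvd x}" by (rule ideal_principal)
  then show ?thesis unfolding uniformizer_def by (rule someI_ex)
qed

lemma red_eq_0_iff: "red a = 0 \<longleftrightarrow> uniformizer dvd a"
  using trans[OF red_kernel[symmetric] \<pp>_uniformizer] unfolding set_eq_iff mem_Collect_eq by (rule spec)

lemma uniformizer_nonzero: "uniformizer \<noteq> 0"
proof
  assume "uniformizer = 0"
  then have "\<pp> = {0}" by (intro trans[OF \<pp>_uniformizer]) simp
  then show False using dvr by (simp add: discrete_valuation_ring_def)
qed

lemma \<pp>_power: "\<pp> [^]\<^bsub>ideals_set class_ring\<^esub> (n::nat) = {x. uniformizer ^ n dvd x}"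
proof (induction n)
  case 0
  show ?case by (simp add: nat_pow_def ideals_set_def)
next
  case (Suc n)
  have "\<pp> [^]\<^bsub>ideals_set class_ring\<^esub> Suc n = ideal_prod class_ring (\<pp> [^]\<^bsub>ideals_set class_ring\<^esub> n) \<pp>"
    by (simp add: nat_pow_def ideals_set_def)
  also have "\<dots> = ideal_prod class_ring {x. uniformizer ^ n dvd x} {x. uniformizer dvd x}"
    by (rule arg_cong2[where f = "ideal_prod class_ring", OF Suc.IH \<pp>_uniformizer])
  finally show ?case by (simp add: ideal_prod_principal mult.commute)
qed

text \<open>
  If \<open>d\<close> generates the intersection of all powers of the maximal ideal, then \<open>d = uniformizer * c\<close> with \<open>c\<close>
  again in the intersection, so \<open>d\<close> divides \<open>c\<close>; unless \<open>d = 0\<close>, the uniformizer would be a unit.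
\<close>

lemma eq_0_if_infinitely_divisible:
  assumes x: "\<And>n. uniformizer ^ n dvd x"
  shows "x = 0"
proof -
  have "ideal {x. \<forall>n. uniformizer ^ n dvd x} (class_ring :: 'r ring)"
    by (rule ideal_class_ringI) auto
  then obtain d where d: "{x. \<forall>n. uniformizer ^ n dvd x} = {x. d dvd x}" using ideal_principal by blast
  have "d \<in> {x. \<forall>n. uniformizer ^ n dvd x}" unfolding d by simp
  then have dn: "uniformizer ^ n dvd d" for n by simp
  obtain c where c: "d = uniformizer * c" using dn[of 1] unfolding power_one_right by (rule dvdE)
  have "uniformizer ^ n dvd c" for n
  proof -
    have "uniformizer * uniformizer ^ n dvd uniformizer * c" using dn[of "Suc n"] unfolding c[symmetric] by (simp only: power_Suc)
    then show ?thesis unfolding dvd_mult_cancel_left using uniformizer_nonzero by blast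
  qed
  then have "d dvd c" using d by blast
  then obtain r where r: "c = d * r" by (auto elim: dvdE)
  have "d = 0"
  proof (rule ccontr)
    assume "d \<noteq> 0"
    have "d * (uniformizer * r) = d * 1" using c r by (metis mult.assoc mult.commute mult.right_neutral)
    then have "uniformizer * r = 1" unfolding mult_left_cancel[OF \<open>d \<noteq> 0\<close>] .
    then have "red uniformizer * red r = 1" by (metis red.hom_mult red.hom_one)
    then show False using red_eq_0_iff[of uniformizer] by simp
  qed
  then show ?thesis using d x by auto
qed

lemma limit_exists:
  assumes s: "\<And>n. uniformizer ^ n dvd s (Suc n) - s n"
  shows "\<exists>x. \<forall>n. uniformizer ^ n dvd s n - x"
proof -
  have step: "uniformizer ^ n dvd s (n + k) - s n" for n k
  proof (induction k)
    case (Suc k)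
    have "uniformizer ^ n dvd uniformizer ^ (n + k)" by (simp add: le_imp_power_dvd)
    then have "uniformizer ^ n dvd s (Suc (n + k)) - s (n + k)" using s dvd_trans by blast
    from dvd_add[OF this Suc.IH] show ?case by simp
  qed simp
  have minus: "a \<ominus>\<^bsub>class_ring\<^esub> b = a - b" for a b :: 'r by (simp add: class_ring_simps)
  have cau: "\<forall>n. \<exists>N. \<forall>i\<ge>N. \<forall>j\<ge>N. s i \<ominus>\<^bsub>class_ring\<^esub> s j \<in> \<pp> [^]\<^bsub>ideals_set class_ring\<^esub> (n::nat)"
    unfolding \<pp>_power minus
  proof (intro allI exI impI)
    fix n i j :: nat assume "n \<le> i" "n \<le> j"
    then show "s i - s j \<in> {x. uniformizer ^ n dvd x}"
      using dvd_diff[OF step[of n "i - n"] step[of n "j - n"]] by simp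
  qed
  have "range s \<subseteq> carrier class_ring" by simp
  from complete[unfolded adically_complete_def, THEN spec, THEN mp, OF conjI[OF this cau]]
  obtain x where x: "\<forall>n. \<exists>N. \<forall>i\<ge>N. s i \<ominus>\<^bsub>class_ring\<^esub> x \<in> \<pp> [^]\<^bsub>ideals_set class_ring\<^esub> (n::nat)"
    by blast
  have "uniformizer ^ n dvd s n - x" for n
  proof -
    obtain N where N: "\<forall>i\<ge>N. uniformizer ^ n dvd s i - x" using x unfolding \<pp>_power minus by blast
    from dvd_diff[OF N[rule_format, of "n + N"] step[of n N]] show ?thesis by simp
  qed
  then show ?thesis by blast
qed

text \<open>
  If \<open>b\<close> is inverse to \<open>a\<close> modulo the maximal ideal, then \<open>a b = 1 - z\<close> with \<open>z\<close> in the maximal ideal,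
  and the geometric series in \<open>z\<close> converges.
\<close>

lemma unit_if_red_nonzero:
  assumes "red a \<noteq> 0"
  obtains b where "a * b = 1"
proof -
  obtain b where b: "red b = inverse (red a)" using red_surj by (metis surjD)
  then have "red a * red b = 1" using assms by simp
  then have "red (1 - a * b) = 0" by (simp add: red.hom_minus red.hom_mult)
  then obtain y where y: "1 - a * b = uniformizer * y" using red_eq_0_iff by (auto elim: dvdE)
  define z where "z = uniformizer * y"
  define s where "s n = (\<Sum>i<n. z ^ i)" for n
  have zn: "uniformizer ^ n dvd z ^ n" for n by (simp add: z_def power_mult_distrib)
  then obtain x where x: "\<And>n. uniformizer ^ n dvd s n - x" using limit_exists[of s] by (auto simp: s_def)
  have "uniformizer ^ n dvd 1 - (1 - z) * x" for n
  proof -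
    have "1 - (1 - z) * x = (1 - z) * (s n - x) + z ^ n"
      using one_diff_power_eq[of z n] by (simp add: s_def algebra_simps)
    then show ?thesis using x[of n] zn[of n] by simp
  qed
  from eq_0_if_infinitely_divisible[OF this] have "(1 - z) * x = 1" by simp
  moreover have "a * b = 1 - z" using y by (simp add: z_def algebra_simps)
  ultimately have "a * (b * x) = 1" by (simp only: mult.assoc[symmetric])
  then show thesis by (rule that)
qed

lemma one_plus_power_mod_square: "\<exists>r. (1 + x) ^ m = 1 + of_nat m * x + x ^ 2 * (r :: 'r)"
proof (induction m)
  case (Suc m)
  then obtain r where r: "(1 + x) ^ m = 1 + of_nat m * x + x ^ 2 * r" by blast
  have "(1 + x) ^ Suc m = 1 + of_nat (Suc m) * x + x ^ 2 * (of_nat m + r + x * r)"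
    by (simp add: r algebra_simps power2_eq_square)
  then show ?case by blast
qed (auto intro: exI[of _ 0])

text \<open>
  Newton iteration for \<open>X\<^sup>m - 1\<close>, whose derivative is a unit at every root of unity. The step is
  \<open>x \<mapsto> x - (x\<^sup>m - 1) x / m\<close>: the exact Newton quotient has \<open>x\<^bsup>1-m\<^esup>\<close> in place of \<open>x\<close>, which agrees with
  it to the precision reached.
\<close>

lemma lift_root_of_unity:
  assumes c: "c ^ m = 1" and m: "of_nat m \<noteq> (0 :: 'f)"
  obtains a where "red a = c" "a ^ m = 1"
proof -
  have "red (of_nat m) \<noteq> 0" using m by (simp add: red.hom_of_nat)
  then obtain u :: 'r where u: "of_nat m * u = 1" by (rule unit_if_red_nonzero)
  obtain b0 where b0: "red b0 = c" using red_surj by (metis surjD)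
  define b where "b = rec_nat b0 (\<lambda>_ x. x * (1 - u * (x ^ m - 1)))"
  have b_Suc: "b (Suc n) = b n * (1 - u * (b n ^ m - 1))" and b_0: "b 0 = b0" for n
    by (simp_all add: b_def)
  have t: "uniformizer ^ Suc n dvd b n ^ m - 1" for n
  proof (induction n)
    case 0
    have "red (b0 ^ m - 1) = 0" using b0 c by (simp add: red.hom_minus red.hom_power)
    then show ?case by (simp add: b_0 red_eq_0_iff)
  next
    case (Suc n)
    define t where "t = b n ^ m - 1"
    obtain r where r: "(1 + (- (u * t))) ^ m = 1 + of_nat m * (- (u * t)) + (- (u * t)) ^ 2 * r"
      using one_plus_power_mod_square by blast
    have "b (Suc n) ^ m - 1 = (1 + t) * (1 - of_nat m * u * t + u ^ 2 * t ^ 2 * r) - 1"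
      using r unfolding b_Suc power_mult_distrib by (simp add: t_def power_mult_distrib mult.assoc)
    also have "\<dots> = t ^ 2 * ((1 + t) * u ^ 2 * r - 1)"
      by (simp only: u mult_1_left) (simp add: algebra_simps power2_eq_square)
    finally have "t * t dvd b (Suc n) ^ m - 1" by (simp add: power2_eq_square)
    moreover have "uniformizer ^ Suc n * uniformizer ^ Suc n dvd t * t" using Suc.IH by (auto simp: t_def intro: mult_dvd_mono)
    moreover have "uniformizer ^ Suc (Suc n) dvd uniformizer ^ Suc n * uniformizer ^ Suc n"
      unfolding power_add[symmetric] by (rule le_imp_power_dvd) simp
    ultimately show ?case using dvd_trans by blast
  qed
  have diff: "uniformizer ^ Suc n dvd b (Suc n) - b n" for n
  proof -
    have "b (Suc n) - b n = - (b n * u) * (b n ^ m - 1)" by (simp add: b_Suc algebra_simps)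
    then show ?thesis using t[of n] by (metis dvd_mult)
  qed
  then have "uniformizer ^ n dvd b (Suc n) - b n" for n by (meson dvd_trans le_imp_power_dvd le_SucI order_refl)
  from limit_exists[OF this] obtain a where a: "\<And>n. uniformizer ^ n dvd b n - a" by blast
  have "uniformizer ^ n dvd a ^ m - 1" for n
  proof -
    have "b n - a dvd b n ^ m - a ^ m" by (simp add: power_diff_sumr2)
    then have "uniformizer ^ n dvd b n ^ m - a ^ m" using a dvd_trans by blast
    moreover have "uniformizer ^ n dvd b n ^ m - 1" using t[of n] by (meson dvd_trans le_imp_power_dvd le_SucI order_refl)
    ultimately have "uniformizer ^ n dvd (b n ^ m - 1) - (b n ^ m - a ^ m)" by (rule dvd_diff[rotated])
    then show ?thesis by simp
  qed
  from eq_0_if_infinitely_divisible[OF this] have am: "a ^ m = 1" by simp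
  have "red (b 1 - a) = 0" "red (b 1 - b 0) = 0"
    using a[of 1] diff[of 0] by (simp_all add: red_eq_0_iff)
  then have "red a = c" using b0 b_0 by (simp add: red.hom_minus)
  then show thesis using am that by blast
qed

end

section \<open>Lifting idempotents\<close>

locale modular_group_algebra = finite_group G + complete_dvr_residue \<pp> red
  for G (structure) and \<pp> :: "'r::idom set" and red :: "'r \<Rightarrow> 'f::field"

begin

definition coeffs_dvd :: "'r \<Rightarrow> ('a \<Rightarrow> 'r) \<Rightarrow> bool" where
  "coeffs_dvd d v \<longleftrightarrow> (\<forall>g \<in> carrier G. d dvd v g)"

lemma coeffs_dvd_mult: "coeffs_dvd c a \<Longrightarrow> coeffs_dvd d b \<Longrightarrow> coeffs_dvd (c * d) (a \<star> b)"
  by (auto simp: coeffs_dvd_def GA_mult intro!: dvd_sum mult_dvd_mono)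

lemma coeffs_dvd_mult_left: "coeffs_dvd d b \<Longrightarrow> coeffs_dvd d (a \<star> b)"
  by (auto simp: coeffs_dvd_def GA_mult intro!: dvd_sum dvd_mult)

lemma coeffs_dvd_mult_right: "coeffs_dvd d a \<Longrightarrow> coeffs_dvd d (a \<star> b)"
  by (auto simp: coeffs_dvd_def GA_mult intro!: dvd_sum dvd_mult2)

lemma coeffs_dvd_trans: "c dvd d \<Longrightarrow> coeffs_dvd d v \<Longrightarrow> coeffs_dvd c v"
  unfolding coeffs_dvd_def by (blast intro: dvd_trans)

lemma coeffs_dvd_add: "coeffs_dvd d a \<Longrightarrow> coeffs_dvd d b \<Longrightarrow> coeffs_dvd d (a \<oplus>\<^bsub>GA\<^esub> b)"
  by (simp add: coeffs_dvd_def GA_add)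

lemma coeffs_dvd_minus:
  assumes "a \<in> carrier GA" "b \<in> carrier GA" "coeffs_dvd d a" "coeffs_dvd d b"
  shows "coeffs_dvd d (a \<ominus>\<^bsub>GA\<^esub> b)"
  using assms(3,4) by (simp add: coeffs_dvd_def GA_minus[OF assms(1,2)])

lemma coeffs_eqI:
  assumes "a \<in> carrier GA" "b \<in> carrier GA" "\<And>n. coeffs_dvd (uniformizer ^ n) (a \<ominus>\<^bsub>GA\<^esub> b)"
  shows "a = b"
proof (rule GA_eqI[OF assms(1,2)])
  fix g assume g: "g \<in> carrier G"
  have "a g - b g = 0"
    using assms g by (intro eq_0_if_infinitely_divisible) (simp add: coeffs_dvd_def GA_minus)
  then show "a g = b g" by simp
qed

text \<open>
  Idempotents lift along the Newton iteration \<open>a \<mapsto> 3a\<^sup>2 - 2a\<^sup>3\<close>, which doubles the precision of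
  \<open>a\<^sup>2 = a\<close> at every step; it stays in the centre, and its limit exists by completeness.
\<close>

lemma lift_central_idempotent:
  fixes e :: "'a \<Rightarrow> 'f"
  assumes e: "central_idempotent GA e"
  obtains e' :: "'a \<Rightarrow> 'r" where "central_idempotent GA e'" "red \<circ> e' = e"
proof -
  have ec: "e \<in> carrier GA" and ee: "e \<star> e = e" using e by (auto simp: central_idempotent_def)
  \<comment> \<open>A section of \<open>red\<close>; its value 0 at 0 keeps the coefficients outside of the group zero.\<close>
  define s where "s c = (if c = 0 then 0 else (SOME a. red a = c))" for c
  have s: "red (s c) = c" for c
    using red_surj someI_ex[of "\<lambda>a. red a = c"] by (auto simp: s_def) (metis surjD)
  define t where "t a = a \<star> a \<ominus>\<^bsub>GA\<^esub> a" for a :: "'a \<Rightarrow> 'r"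
  define u where "u a = a \<oplus>\<^bsub>GA\<^esub> a \<ominus>\<^bsub>GA\<^esub> \<one>\<^bsub>GA\<^esub>" for a :: "'a \<Rightarrow> 'r"
  define a where "a = rec_nat (s \<circ> e) (\<lambda>_ a. a \<ominus>\<^bsub>GA\<^esub> u a \<star> t a)"
  have a_0: "a 0 = s \<circ> e" and a_Suc: "a (Suc n) = a n \<ominus>\<^bsub>GA\<^esub> u (a n) \<star> t (a n)" for n
    by (simp_all add: a_def)
  let ?central = "\<lambda>a :: 'a \<Rightarrow> 'r. \<forall>b \<in> carrier GA. a \<star> b = b \<star> a"
  have a0: "s \<circ> e \<in> carrier GA" using ec by (simp add: carrier_GA s_def)
  have ac: "a n \<in> carrier GA \<and> ?central (a n)" for n
  proof (induction n)
    case 0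
    then show ?case
      unfolding a_0 central_iff_class_function[OF a0]
      by (intro conjI a0 ballI) (simp add: central_idempotent_class_function[OF e])
  next
    case (Suc n)
    then have c: "a n \<in> carrier GA" "?central (a n)" by auto
    have one: "?central \<one>\<^bsub>GA\<^esub>" by simp
    note cd = GA.central_closed[OF c c]
    have tc: "t (a n) \<in> carrier GA" "?central (t (a n))"
      unfolding t_def using c(1) GA.central_closed(1)[OF GA_mult_closed cd(3) c] by simp_all
    have uc: "u (a n) \<in> carrier GA" "?central (u (a n))"
      unfolding u_def using c(1) GA.central_closed(1)[OF GA.a_closed cd(2) GA.one_closed one] by simp_all
    show ?case
      unfolding a_Suc
      by (intro conjI GA.central_closed(1)[OF c GA_mult_closed GA.central_closed(3)[OF uc tc]])
         (simp add: c(1) GA_mult_closed)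
  qed
  have tc: "t (a n) \<in> carrier GA" and uc: "u (a n) \<in> carrier GA" for n
    using conjunct1[OF ac[of n]] by (simp_all add: t_def u_def GA_mult_closed)
  have t: "coeffs_dvd (uniformizer ^ Suc n) (t (a n))" for n
  proof (induction n)
    case 0
    have "red \<circ> t (a 0) = (red \<circ> (s \<circ> e)) \<star> (red \<circ> (s \<circ> e)) \<ominus>\<^bsub>GA\<^esub> (red \<circ> (s \<circ> e))"
      using a0 by (simp only: t_def a_0 map_coeff_minus[OF red_hom GA_mult_closed a0] map_coeff_mult[OF red_hom])
    also have "red \<circ> (s \<circ> e) = e" using s by auto
    finally have *: "red \<circ> t (a 0) = (\<lambda>g. e g - e g)" unfolding ee GA_minus[OF ec ec] .
    have "red (t (a 0) g) = 0" for g using fun_cong[OF *, of g] by simp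
    then show ?case by (simp add: coeffs_dvd_def red_eq_0_iff)
  next
    case (Suc n)
    let ?t = "t (a n)"
    let ?q = "?t \<oplus>\<^bsub>GA\<^esub> ?t \<oplus>\<^bsub>GA\<^esub> ?t \<oplus>\<^bsub>GA\<^esub> ?t"
    have "t (a (Suc n)) = ?t \<star> ((?q \<oplus>\<^bsub>GA\<^esub> \<one>\<^bsub>GA\<^esub>) \<star> ?t \<ominus>\<^bsub>GA\<^esub> ?q)"
      using GA.newton_idempotent[OF conjunct1[OF ac[of n]]] unfolding a_Suc t_def u_def .
    moreover have "coeffs_dvd (uniformizer ^ Suc n) ((?q \<oplus>\<^bsub>GA\<^esub> \<one>\<^bsub>GA\<^esub>) \<star> ?t \<ominus>\<^bsub>GA\<^esub> ?q)"
      by (intro coeffs_dvd_minus coeffs_dvd_add coeffs_dvd_mult_left Suc.IH GA_mult_closed GA.a_closed tc)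
    ultimately have "coeffs_dvd (uniformizer ^ Suc n * uniformizer ^ Suc n) (t (a (Suc n)))"
      using coeffs_dvd_mult[OF Suc.IH] by metis
    moreover have "uniformizer ^ Suc (Suc n) dvd uniformizer ^ Suc n * uniformizer ^ Suc n"
      unfolding power_add[symmetric] by (rule le_imp_power_dvd) simp
    ultimately show ?case by (rule coeffs_dvd_trans[rotated])
  qed
  have diff: "uniformizer ^ Suc n dvd a (Suc n) g - a n g" if "g \<in> carrier G" for n g
  proof -
    have "a (Suc n) g - a n g = - ((u (a n) \<star> t (a n)) g)"
      using ac[of n] by (simp add: a_Suc GA_minus GA_mult_closed)
    moreover have "coeffs_dvd (uniformizer ^ Suc n) (u (a n) \<star> t (a n))" by (rule coeffs_dvd_mult_left[OF t])
    ultimately show ?thesis using that by (simp only: coeffs_dvd_def dvd_minus_iff)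
  qed
  have "\<exists>x. \<forall>n. uniformizer ^ n dvd a n g - x" if g: "g \<in> carrier G" for g
  proof (rule limit_exists)
    fix n
    have "uniformizer ^ n dvd uniformizer ^ Suc n" by (rule le_imp_power_dvd) simp
    then show "uniformizer ^ n dvd a (Suc n) g - a n g" using diff[OF g] dvd_trans by blast
  qed
  then have "\<forall>g \<in> carrier G. \<exists>x. \<forall>n. uniformizer ^ n dvd a n g - x" by (rule ballI)
  from bchoice[OF this] obtain l where "\<forall>g \<in> carrier G. \<forall>n. uniformizer ^ n dvd a n g - l g" by (rule exE)
  note l = this[rule_format]
  define e' where "e' g = (if g \<in> carrier G then l g else 0)" for g
  have e'c: "e' \<in> carrier GA" by (simp add: carrier_GA e'_def)
  have lim: "coeffs_dvd (uniformizer ^ n) (a n \<ominus>\<^bsub>GA\<^esub> e')" for n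
    using l ac[of n] e'c by (simp add: coeffs_dvd_def GA_minus e'_def)
  have "e' (g \<otimes> h) = e' (h \<otimes> g)" if gh: "g \<in> carrier G" "h \<in> carrier G" for g h
  proof -
    have "uniformizer ^ n dvd e' (g \<otimes> h) - e' (h \<otimes> g)" for n
    proof -
      have "a n (g \<otimes> h) = a n (h \<otimes> g)"
        using ac[of n] gh central_iff_class_function[of "a n"] by blast
      then show ?thesis
        using dvd_diff[OF l[of "h \<otimes> g" n] l[of "g \<otimes> h" n]] gh by (simp add: e'_def)
    qed
    from eq_0_if_infinitely_divisible[OF this] show ?thesis by simp
  qed
  then have e'z: "?central e'" unfolding central_iff_class_function[OF e'c] by blast
  have "e' \<star> e' = e'"
  proof (rule coeffs_eqI[OF GA_mult_closed e'c])
    fix n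
    let ?d = "a n \<ominus>\<^bsub>GA\<^esub> e'"
    have anc: "a n \<in> carrier GA" using ac[of n] by blast
    have *: "e' \<star> e' \<ominus>\<^bsub>GA\<^esub> e' = t (a n) \<ominus>\<^bsub>GA\<^esub> a n \<star> ?d \<ominus>\<^bsub>GA\<^esub> ?d \<star> e' \<oplus>\<^bsub>GA\<^esub> ?d"
      using anc e'c unfolding t_def GA.minus_eq by algebra
    have t': "coeffs_dvd (uniformizer ^ n) (t (a n))"
      by (rule coeffs_dvd_trans[OF _ t[of n]]) (rule le_imp_power_dvd, simp)
    show "coeffs_dvd (uniformizer ^ n) (e' \<star> e' \<ominus>\<^bsub>GA\<^esub> e')"
      unfolding *
      by (intro coeffs_dvd_add coeffs_dvd_minus t' lim coeffs_dvd_mult_left coeffs_dvd_mult_right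
          GA.minus_closed GA_mult_closed tc anc e'c)
  qed
  then have "central_idempotent GA e'" using e'c e'z unfolding central_idempotent_def by blast
  moreover have "red \<circ> e' = e"
  proof
    fix g
    show "(red \<circ> e') g = e g"
    proof (cases "g \<in> carrier G")
      case True
      have "uniformizer dvd a 1 g - l g" using l[OF True, of 1] by simp
      then have "red (a 1 g) = red (l g)" by (simp add: red.hom_minus flip: red_eq_0_iff)
      moreover have "uniformizer dvd a 1 g - a 0 g" using diff[OF True, of 0] by simp
      then have "red (a 1 g) = red (a 0 g)" by (simp add: red.hom_minus flip: red_eq_0_iff)
      ultimately show ?thesis using True s by (simp add: e'_def a_0)
    next
      case False
      then show ?thesis using ec by (simp add: e'_def carrier_GA)
    qed
  qed
  ultimately show thesis by (rule that)
qed

text \<open>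
  The coefficients of \<open>f\<close> are divisible by the uniformizer, and those of \<open>f = f\<^sup>n\<close> by its \<open>n\<close>-th power.
\<close>

lemma idempotent_reducing_to_zero:
  assumes f: "f \<in> carrier GA" "f \<star> f = f" and 0: "red \<circ> f = (\<lambda>_. 0)"
  shows "f = \<zero>\<^bsub>GA\<^esub>"
proof (rule coeffs_eqI[OF f(1)])
  have "red (f g) = 0" for g using 0 by (metis comp_apply)
  then have f1: "coeffs_dvd uniformizer f" by (simp add: coeffs_dvd_def red_eq_0_iff)
  fix n
  have "coeffs_dvd (uniformizer ^ n) f"
  proof (induction n)
    case (Suc n)
    from coeffs_dvd_mult[OF f1 Suc.IH] show ?case by (simp add: f(2))
  qed (simp add: coeffs_dvd_def)
  then show "coeffs_dvd (uniformizer ^ n) (f \<ominus>\<^bsub>GA\<^esub> \<zero>\<^bsub>GA\<^esub>)" using f(1) by (simp add: GA.minus_eq)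
qed simp

end

section \<open>Brauer characters\<close>

locale modular_system = modular_group_algebra G \<pp> red
  for G (structure) and \<pp> :: "'r::idom set" and red :: "'r \<Rightarrow> 'f::field" +
  fixes p :: nat and \<iota> :: "'r \<Rightarrow> 'k::field_char_0"
  assumes prime_p: "prime p"
    and \<iota>_inj_hom: "inj_comm_ring_hom \<iota>"
    and char_F: "CHAR('f) = p"
    and splitting_K: "splitting_field TYPE('k) G" and splitting_F: "splitting_field TYPE('f) G"

begin

abbreviation \<iota>_ac :: "'r \<Rightarrow> 'k alg_closure" where "\<iota>_ac a \<equiv> to_ac (\<iota> a)"

lemma \<iota>_ac_hom: "inj_idom_hom \<iota>_ac"
proof -
  interpret inj_comm_ring_hom \<iota> by (rule \<iota>_inj_hom)
  show ?thesis by unfold_locales (auto simp: hom_distribs)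
qed

sublocale \<iota>: inj_comm_ring_hom \<iota> by (rule \<iota>_inj_hom)

sublocale \<iota>_ac: inj_idom_hom \<iota>_ac by (rule \<iota>_ac_hom)

sublocale map_\<iota>_ac: map_poly_inj_idom_hom \<iota>_ac ..

sublocale map_red: map_poly_comm_ring_hom red ..

lemma of_nat_F_eq_0_iff: "of_nat m = (0 :: 'f) \<longleftrightarrow> p dvd m"
  by (simp add: of_nat_eq_0_iff_char_dvd char_F)

lemma of_nat_nonzero_if_coprime: "coprime m p \<Longrightarrow> of_nat m \<noteq> (0 :: 'f)"
  using prime_p by (auto simp: of_nat_F_eq_0_iff dest: coprime_common_divisor[of m p p])

text \<open>
  The polynomial \<open>Q\<close> over \<open>R\<close> separates \<open>a\<close>, even after reduction, from the roots of unity in \<open>L\<close>. A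
  single \<open>\<zeta> \<noteq> a\<close> with \<open>\<zeta>\<^sup>M = a\<^sup>M = 1\<close> is a root of \<open>(X\<^sup>M - a\<^sup>M) / (X - a)\<close>, whose value at \<open>a\<close> is
  \<open>M a\<^bsup>M-1\<^esup>\<close>: a unit when \<open>M\<close> is prime to \<open>p\<close>.
\<close>

lemma annihilator_of_other_roots:
  assumes a: "a ^ m = 1" "m > 0" "coprime m p"
    and "\<forall>\<zeta> \<in># L. \<zeta> \<noteq> \<iota>_ac a \<and> (\<exists>k. k > 0 \<and> coprime k p \<and> \<zeta> ^ k = 1)"
  shows "\<exists>Q. (\<Prod>\<zeta>\<in>#L. [:- \<zeta>, 1:]) dvd map_poly \<iota>_ac Q \<and> red (poly Q a) \<noteq> 0"
  using assms(4)
proof (induction L)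
  case empty
  show ?case by (intro exI[of _ 1]) simp
next
  case (add \<zeta> L)
  then obtain Q where Q: "(\<Prod>\<zeta>\<in>#L. [:- \<zeta>, 1:]) dvd map_poly \<iota>_ac Q" "red (poly Q a) \<noteq> 0" by auto
  from add.prems obtain k where \<zeta>: "\<zeta> \<noteq> \<iota>_ac a" and k: "k > 0" "coprime k p" "\<zeta> ^ k = 1" by auto
  define M where "M = m * k"
  have M: "M > 0" "coprime M p" using a k by (auto simp: M_def)
  have aM: "a ^ M = 1" and \<zeta>M: "\<zeta> ^ M = 1"
    using a k by (simp add: M_def power_mult, simp add: M_def mult.commute[of m] power_mult)
  define \<Phi> where "\<Phi> = (\<Sum>i<M. monom (a ^ (M - Suc i)) i)"
  have "(\<zeta> - \<iota>_ac a) * (\<Sum>i<M. \<iota>_ac a ^ (M - Suc i) * \<zeta> ^ i) = \<zeta> ^ M - \<iota>_ac a ^ M"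
    by (rule power_diff_sumr2[symmetric])
  also have "\<dots> = 0" using aM \<zeta>M by (simp flip: \<iota>_ac.hom_power)
  finally have "(\<Sum>i<M. \<iota>_ac a ^ (M - Suc i) * \<zeta> ^ i) = 0" using \<zeta> by simp
  then have "poly (map_poly \<iota>_ac \<Phi>) \<zeta> = 0"
    by (simp add: \<Phi>_def map_\<iota>_ac.hom_sum poly_sum poly_monom \<iota>_ac.hom_power)
  then have "[:- \<zeta>, 1:] dvd map_poly \<iota>_ac \<Phi>" by (simp add: poly_eq_0_iff_dvd)
  then have "(\<Prod>\<zeta>\<in>#add_mset \<zeta> L. [:- \<zeta>, 1:]) dvd map_poly \<iota>_ac (\<Phi> * Q)"
    unfolding map_\<iota>_ac.hom_mult image_mset_add_mset prod_mset.add_mset by (rule mult_dvd_mono[OF _ Q(1)])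
  moreover have "red (poly \<Phi> a) \<noteq> 0"
  proof -
    have "poly \<Phi> a = (\<Sum>i<M. a ^ (M - 1))"
      unfolding \<Phi>_def poly_sum poly_monom by (intro sum.cong refl) (simp flip: power_add)
    then have "red (poly \<Phi> a) = of_nat M * red a ^ (M - 1)" by (simp add: red.hom_mult red.hom_power red.hom_of_nat)
    moreover have "red a \<noteq> 0"
      using a(2) arg_cong[OF a(1), of red] by (auto simp: red.hom_power zero_power)
    ultimately show ?thesis using of_nat_nonzero_if_coprime[OF M(2)] by simp
  qed
  ultimately show ?case using Q(2) by (intro exI[of _ "\<Phi> * Q"]) (simp add: red.hom_mult)
qed

text \<open>Division with remainder by a monic polynomial can be done over \<open>R\<close>.\<close>

lemma monic_dvd_if_map_dvd:
  assumes g: "lead_coeff g = 1" and dvd: "map_poly \<iota>_ac g dvd map_poly \<iota>_ac Q"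
  shows "g dvd Q"
proof -
  have g0: "g \<noteq> 0" using g by auto
  obtain q r where "pseudo_divmod Q g = (q, r)" by fastforce
  from pseudo_divmod[OF g0 this] have Q: "Q = g * q + r" and r: "r = 0 \<or> degree r < degree g"
    using g by simp_all
  have "map_poly \<iota>_ac g dvd map_poly \<iota>_ac r"
    using dvd by (simp add: Q map_\<iota>_ac.hom_add map_\<iota>_ac.hom_mult dvd_add_right_iff)
  then have "r \<noteq> 0 \<Longrightarrow> degree g \<le> degree r"
    using dvd_imp_degree_le[of "map_poly \<iota>_ac g" "map_poly \<iota>_ac r"] by simp
  then have "r = 0" using r by linarith
  then show ?thesis using Q by simp
qed

lemma monic_linear_prod:
  "lead_coeff (\<Prod>\<zeta>\<in>#L. [:- \<zeta>, 1:]) = (1 :: 'x::idom)" "degree (\<Prod>\<zeta>\<in>#L. [:- \<zeta>, 1:]) = size L"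
proof -
  have "lead_coeff (\<Prod>\<zeta>\<in>#L. [:- \<zeta>, 1:]) = (1 :: 'x) \<and> degree (\<Prod>\<zeta>\<in>#L. [:- \<zeta>, 1:]) = size L"
  proof (induction L)
    case (add \<zeta> L)
    let ?P = "\<Prod>\<zeta>\<in>#L. [:- \<zeta>, 1:]"
    have "?P \<noteq> 0" using add.IH by auto
    then have "degree ([:- \<zeta>, 1:] * ?P) = Suc (size L)" using add.IH by (simp add: degree_mult_eq del: mult_pCons_left)
    moreover have "lead_coeff ([:- \<zeta>, 1:] * ?P) = 1" unfolding lead_coeff_mult conjunct1[OF add.IH] by simp
    ultimately show ?case by (simp del: mult_pCons_left)
  qed simp
  then show "lead_coeff (\<Prod>\<zeta>\<in>#L. [:- \<zeta>, 1:]) = (1 :: 'x)" "degree (\<Prod>\<zeta>\<in>#L. [:- \<zeta>, 1:]) = size L" by blast+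
qed

lemma char_poly_scalar: "char_poly (c \<cdot>\<^sub>m 1\<^sub>m n :: 'f mat) = [:- c, 1:] ^ n"
proof -
  have "diag_mat (c \<cdot>\<^sub>m 1\<^sub>m n) = replicate n c"
    by (auto simp: diag_mat_def intro!: nth_equalityI)
  then show ?thesis
    by (subst char_poly_upper_triangular[of _ n]) (auto simp: upper_triangular_def)
qed

text \<open>
  Let \<open>f\<close> be the polynomial over \<open>R\<close> with root multiset \<open>L\<close>, and split off the factors \<open>X - a\<close> to get
  \<open>f = (X - a)\<^sup>k g\<close>. The roots of \<open>g\<close> are the members of \<open>L\<close> other than \<open>a\<close>, so \<open>g\<close> divides a polynomial
  that has a unit as value at \<open>a\<close>. But \<open>g\<close> reduces to a power of \<open>X - red a\<close>, so it must be constant.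
\<close>

lemma eigenvalue_lifts_scalar:
  assumes a: "a ^ m = 1" "m > 0" "coprime m p"
  shows "eigenvalue_lifts p \<iota> red (red a \<cdot>\<^sub>m 1\<^sub>m n) L \<longleftrightarrow> L = replicate_mset n (\<iota>_ac a)"
proof
  assume "L = replicate_mset n (\<iota>_ac a)"
  moreover have "\<iota>_ac a ^ m = 1" using a by (simp flip: \<iota>_ac.hom_power)
  moreover have "map_poly \<iota>_ac ([:- a, 1:] ^ n) = [:- \<iota>_ac a, 1:] ^ n" "map_poly red ([:- a, 1:] ^ n) = [:- red a, 1:] ^ n"
    by (simp_all add: map_\<iota>_ac.hom_power map_red.hom_power \<iota>_ac.map_poly_pCons_hom red.map_poly_pCons_hom \<iota>_ac.hom_uminus red.hom_uminus)
  ultimately show "eigenvalue_lifts p \<iota> red (red a \<cdot>\<^sub>m 1\<^sub>m n) L"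
    unfolding eigenvalue_lifts_def char_poly_scalar using a
    by (auto simp: in_replicate_mset intro!: exI[of _ "[:- a, 1:] ^ n"])
next
  assume "eigenvalue_lifts p \<iota> red (red a \<cdot>\<^sub>m 1\<^sub>m n) L"
  then obtain f where roots: "\<forall>\<zeta> \<in># L. \<exists>k. k > 0 \<and> coprime k p \<and> \<zeta> ^ k = 1"
    and f: "map_poly \<iota>_ac f = (\<Prod>\<zeta>\<in>#L. [:- \<zeta>, 1:])" and redf: "map_poly red f = [:- red a, 1:] ^ n"
    unfolding eigenvalue_lifts_def char_poly_scalar by blast
  let ?\<alpha> = "\<iota>_ac a"
  have "lead_coeff (map_poly \<iota>_ac f) = 1" unfolding f by (rule monic_linear_prod(1))
  then have lf: "lead_coeff f = 1" by simp
  then have f0: "f \<noteq> 0" by auto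
  obtain g where g: "f = [:- a, 1:] ^ Polynomial.order a f * g" "\<not> [:- a, 1:] dvd g"
    using order_decomp[OF f0] by blast
  define k where "k = Polynomial.order a f"
  have fg: "f = [:- a, 1:] ^ k * g" using g(1) by (simp add: k_def)
  have lin: "map_poly \<iota>_ac [:- a, 1:] = [:- ?\<alpha>, 1:]" "map_poly red [:- a, 1:] = [:- red a, 1:]"
    by (simp_all add: \<iota>_ac.map_poly_pCons_hom red.map_poly_pCons_hom \<iota>_ac.hom_uminus red.hom_uminus)
  have lg: "lead_coeff g = 1" using lf by (simp add: fg lead_coeff_mult lead_coeff_power del: mult_pCons_left)
  have "coeff (map_poly red g) (degree g) = 1" using lg by simp
  then have dg: "degree (map_poly red g) = degree g" and rg0: "map_poly red g \<noteq> 0"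
    using le_degree[of "map_poly red g" "degree g"] degree_map_poly_le[of red g]
    by (simp, metis coeff_0 zero_neq_one)
  have "[:- red a, 1:] ^ k * map_poly red g = [:- red a, 1:] ^ n"
    using redf by (simp only: fg map_red.hom_mult map_red.hom_power lin)
  moreover from arg_cong[OF this, of degree] have "n = k + degree g"
    using rg0 dg by (simp add: degree_mult_eq degree_linear_power del: mult_pCons_left)
  ultimately have rg: "map_poly red g = [:- red a, 1:] ^ degree g" by (simp add: power_add del: mult_pCons_left)
  have "degree g = 0"
  proof (rule ccontr)
    assume "degree g \<noteq> 0"
    then have "poly (map_poly red g) (red a) = 0" unfolding rg by simp
    then have root: "red (poly g a) = 0" by simp
    let ?L = "filter_mset (\<lambda>\<zeta>. \<zeta> \<noteq> ?\<alpha>) L"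
    have L: "L = replicate_mset (count L ?\<alpha>) ?\<alpha> + ?L"
      using multiset_partition[of L "\<lambda>\<zeta>. \<zeta> = ?\<alpha>"] by (simp add: filter_eq_replicate_mset)
    have "(\<Prod>\<zeta>\<in>#L. [:- \<zeta>, 1:]) = (\<Prod>\<zeta>\<in>#replicate_mset (count L ?\<alpha>) ?\<alpha> + ?L. [:- \<zeta>, 1:])"
      by (rule arg_cong[OF L])
    also have "\<dots> = [:- ?\<alpha>, 1:] ^ count L ?\<alpha> * (\<Prod>\<zeta>\<in>#?L. [:- \<zeta>, 1:])"
      by (simp only: image_mset_union image_replicate_mset prod_mset.union prod_mset_replicate_mset)
    finally have eq: "[:- ?\<alpha>, 1:] ^ k * map_poly \<iota>_ac g = [:- ?\<alpha>, 1:] ^ count L ?\<alpha> * (\<Prod>\<zeta>\<in>#?L. [:- \<zeta>, 1:])"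
      using f by (simp only: fg map_\<iota>_ac.hom_mult map_\<iota>_ac.hom_power lin)
    have "poly g a \<noteq> 0" using g(2) by (simp add: poly_eq_0_iff_dvd)
    then have v1: "poly (map_poly \<iota>_ac g) ?\<alpha> \<noteq> 0" by simp
    have v2: "poly (\<Prod>\<zeta>\<in>#?L. [:- \<zeta>, 1:]) ?\<alpha> \<noteq> 0" by (auto simp: poly_prod_mset prod_mset_zero_iff)
    have o: "Polynomial.order ?\<alpha> ([:- ?\<alpha>, 1:] ^ j * q) = j" if "poly q ?\<alpha> \<noteq> 0" for j and q :: "'k alg_closure poly"
    proof -
      have "q \<noteq> 0" using that by auto
      then show ?thesis using that by (simp add: order_mult order_power_n_n order_0I del: mult_pCons_left)
    qed
    have "k = count L ?\<alpha>" using o[OF v1, of k] o[OF v2, of "count L ?\<alpha>"] eq by simp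
    then have "map_poly \<iota>_ac g = (\<Prod>\<zeta>\<in>#?L. [:- \<zeta>, 1:])" using eq by (simp del: mult_pCons_left)
    moreover obtain Q where Q: "(\<Prod>\<zeta>\<in>#?L. [:- \<zeta>, 1:]) dvd map_poly \<iota>_ac Q" "red (poly Q a) \<noteq> 0"
      using annihilator_of_other_roots[OF a, of ?L] roots by auto
    ultimately have "g dvd Q" by (intro monic_dvd_if_map_dvd lg) simp
    then obtain q where "Q = g * q" by (rule dvdE)
    then have "red (poly Q a) = 0" using root by (simp add: red.hom_mult)
    then show False using Q(2) by simp
  qed
  then have "g = 1" using lg by (metis degree_eq_zeroE lead_coeff_pCons(2) one_pCons)
  then have P: "(\<Prod>\<zeta>\<in>#L. [:- \<zeta>, 1:]) = [:- ?\<alpha>, 1:] ^ k" and "k = n"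
    using f fg \<open>n = k + degree g\<close> by (simp_all only: map_\<iota>_ac.hom_power lin mult_1_right) simp
  have "\<zeta> = ?\<alpha>" if "\<zeta> \<in># L" for \<zeta>
  proof -
    have "poly (\<Prod>\<zeta>\<in>#L. [:- \<zeta>, 1:]) \<zeta> = 0" using that by (auto simp: poly_prod_mset prod_mset_zero_iff)
    then show ?thesis unfolding P by simp
  qed
  then have "set_mset L \<subseteq> {?\<alpha>}" by blast
  then have "L = replicate_mset (size L) ?\<alpha>" by (rule set_mset_subset_singletonD)
  moreover have "size L = n"
    using arg_cong[OF P, of degree] \<open>k = n\<close> by (simp add: monic_linear_prod degree_linear_power)
  ultimately show "L = replicate_mset n ?\<alpha>" by simp
qed

lemma brauer_character_scalar:
  assumes "a ^ m = 1" "m > 0" "coprime m p" and "g \<in> p_regular p G" and "\<rho> g = red a \<cdot>\<^sub>m 1\<^sub>m n"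
  shows "brauer_character p \<iota> red G \<rho> g = of_nat n * \<iota>_ac a"
proof -
  have "eigenvalue_lifts p \<iota> red (red a \<cdot>\<^sub>m 1\<^sub>m n) = (\<lambda>L. L = replicate_mset n (\<iota>_ac a))"
    by (intro ext eigenvalue_lifts_scalar[OF assms(1-3)])
  then show ?thesis using assms(4,5) by (simp add: brauer_character_def)
qed

lemma one_p_regular: "\<one> \<in> p_regular p G"
  using prime_p by (auto simp: p_regular_def)

lemma brauer_character_one:
  fixes \<rho> :: "'a \<Rightarrow> 'f mat"
  assumes "representation G n \<rho>"
  shows "brauer_character p \<iota> red G \<rho> \<one> = of_nat n"
proof -
  have "\<rho> \<one> = red 1 \<cdot>\<^sub>m 1\<^sub>m n" using assms by (intro eq_matI) (auto simp: representation_def)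
  then show ?thesis using brauer_character_scalar[of 1 1, OF _ _ _ one_p_regular] by simp
qed

lemma brauer_character_in_LBr_iff:
  fixes \<rho> :: "'a \<Rightarrow> 'f mat"
  assumes "irreducible_rep G n \<rho>"
  shows "brauer_character p \<iota> red G \<rho> \<in> LBr p \<iota> red G \<longleftrightarrow> n = 1"
proof -
  have "brauer_character p \<iota> red G \<rho> \<in> IBr p \<iota> red G" using assms by (auto simp: IBr_def)
  then show ?thesis
    using brauer_character_one[OF irreducible_repD(1)[OF assms]] by (simp add: LBr_def)
qed

text \<open>
  A linear Brauer character determines its representation on \<open>p\<close>-regular elements: the scalar by which
  \<open>x\<close> acts is a root of unity of order prime to \<open>p\<close>, and the value of the Brauer character is its lift.
\<close>

lemma linear_brauer_character_trivial:
  fixes \<rho> \<rho>' :: "'a \<Rightarrow> 'f mat"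
  assumes \<rho>: "representation G 1 \<rho>" and \<rho>': "representation G 1 \<rho>'"
    and eq: "brauer_character p \<iota> red G \<rho> = brauer_character p \<iota> red G \<rho>'"
    and x: "x \<in> p_regular p G" and \<rho>x: "\<rho> x = 1\<^sub>m 1"
  shows "\<rho>' x = 1\<^sub>m 1"
proof -
  have xc: "x \<in> carrier G" and xp: "\<not> p dvd ord x" using x by (auto simp: p_regular_def)
  let ?c = "\<rho>' x $$ (0, 0)"
  have "ord x \<ge> 1" by (rule ord_ge_1[OF finite_carrier xc])
  then have m: "ord x > 0" "coprime (ord x) p"
    using prime_imp_coprime[OF prime_p xp] by (simp_all add: coprime_commute)
  have "?c ^ ord x \<cdot>\<^sub>m 1\<^sub>m 1 = \<rho>' \<one>"
    using linear_rep_pow[OF \<rho>' xc, of "ord x"] xc by simp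
  also have "\<dots> = 1\<^sub>m 1" using \<rho>' by (simp add: representation_def)
  finally have "?c ^ ord x = 1" by (auto dest!: arg_cong[of _ _ "\<lambda>A. A $$ (0, 0)"])
  then obtain a where a: "red a = ?c" "a ^ ord x = 1"
    by (rule lift_root_of_unity[OF _ of_nat_nonzero_if_coprime[OF m(2)]])
  have \<rho>'x: "\<rho>' x = red a \<cdot>\<^sub>m 1\<^sub>m 1" using linear_rep_pow[OF \<rho>' xc, of 1] xc a(1) by simp
  have "\<rho> x = red 1 \<cdot>\<^sub>m 1\<^sub>m 1" unfolding \<rho>x by (intro eq_matI) auto
  then have "brauer_character p \<iota> red G \<rho> x = of_nat 1 * \<iota>_ac 1"
    by (intro brauer_character_scalar[of 1 1] x) simp_all
  moreover have "brauer_character p \<iota> red G \<rho>' x = of_nat 1 * \<iota>_ac a"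
    by (intro brauer_character_scalar[OF a(2) m x] \<rho>'x)
  ultimately have "\<iota>_ac a = 1" by (simp add: eq)
  then have "a = 1" by simp
  then show ?thesis unfolding \<rho>'x by (intro eq_matI) auto
qed

section \<open>The principal block\<close>

lemma subgroup_order_prime_to_p:
  fixes e :: "'a \<Rightarrow> 'f"
  assumes e: "central_idempotent GA e" "e \<noteq> \<zero>\<^bsub>GA\<^esub>" and S: "subgroup S G"
    and fixed: "\<And>x. x \<in> S \<Longrightarrow> delta x \<star> e = e"
  shows "\<not> p dvd card S"
  using stabilizer_order_invertible[OF e S fixed] by (simp add: of_nat_F_eq_0_iff)

lemma block_idempotentD:
  "block_idempotent GA e \<Longrightarrow> central_idempotent GA e" "block_idempotent GA e \<Longrightarrow> e \<noteq> \<zero>\<^bsub>GA\<^esub>"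
  "block_idempotent GA e \<Longrightarrow> e \<in> block_algebra GA e" "block_idempotent GA e \<Longrightarrow> block_algebra GA e \<in> blocks G"
proof -
  assume e: "block_idempotent GA e"
  then show c: "central_idempotent GA e" "e \<noteq> \<zero>\<^bsub>GA\<^esub>" by (simp_all add: block_idempotent_def)
  have "e \<in> carrier GA" "e \<star> e = e" using c(1) by (simp_all add: central_idempotent_def)
  then show "e \<in> block_algebra GA e" unfolding block_algebra_def by (metis (mono_tags, lifting) mem_Collect_eq)
  show "block_algebra GA e \<in> blocks G" using e unfolding blocks_def by blast
qed

lemma block_cases:
  fixes B :: "('a \<Rightarrow> 'f) set"
  assumes "B \<in> blocks G"
  obtains e where "block_idempotent GA e" "B = block_algebra GA e"
    "\<And>f. f \<in> B \<Longrightarrow> block_idempotent GA f \<Longrightarrow> f = e"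
proof -
  obtain e :: "'a \<Rightarrow> 'f" where e: "block_idempotent GA e" "B = block_algebra GA e"
    using assms unfolding blocks_def by blast
  then show thesis using that[OF e] GA.block_idempotent_in_block[OF e(1)] by blast
qed

text \<open>
  The identity element of the principal block: it acts as the identity on the trivial module.
\<close>

definition principal_idem :: "'a \<Rightarrow> 'f" where
  "principal_idem = (SOME e. block_idempotent GA e \<and> augmentation e = 1)"

lemma principal_idem: "block_idempotent GA principal_idem" "augmentation principal_idem = 1"
proof -
  have "\<exists>e :: 'a \<Rightarrow> 'f. block_idempotent GA e \<and> augmentation e = 1" by (rule principal_idempotent_exists)
  then have "block_idempotent GA principal_idem \<and> augmentation principal_idem = 1" unfolding principal_idem_def by (rule someI_ex)
  then show "block_idempotent GA principal_idem" "augmentation principal_idem = 1" by simp_all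
qed

lemmas principal_idem_central = block_idempotentD(1)[OF principal_idem(1)]

lemma principal_idem_absorb:
  "central_idempotent GA f \<Longrightarrow> augmentation f = 1 \<Longrightarrow> principal_idem \<star> f = principal_idem"
  by (rule block_idempotent_one_augmentation_absorb[OF principal_idem])

lemma principal_idem_unique:
  assumes f: "block_idempotent GA f" "augmentation f = 1"
  shows "f = principal_idem"
proof -
  have fc: "f \<in> carrier GA" using block_idempotentD(1)[OF f(1)] by (simp add: central_idempotent_def)
  have "principal_idem \<star> f = principal_idem" by (rule principal_idem_absorb[OF block_idempotentD(1)[OF f(1)] f(2)])
  moreover have "f \<star> principal_idem = f"
    by (rule block_idempotent_one_augmentation_absorb[OF f principal_idem_central principal_idem(2)])
  moreover have "principal_idem \<star> f = f \<star> principal_idem" using principal_idem_central fc unfolding central_idempotent_def by blast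
  ultimately show ?thesis by metis
qed

lemma augmentation_lift:
  assumes e': "central_idempotent GA e'" and "red \<circ> e' = e" "augmentation e = 1"
  shows "augmentation e' = 1"
proof -
  have "augmentation e' * augmentation e' = augmentation e'"
    using e' by (simp add: central_idempotent_def flip: augmentation_mult)
  moreover have "red (augmentation e') = 1" using augmentation_map[OF red_hom, of e'] assms(2,3) by simp
  then have "augmentation e' \<noteq> 0" by auto
  ultimately show ?thesis by simp
qed

text \<open>
  A lift \<open>e'\<close> of a block idempotent acts as the identity on the trivial module over \<open>K\<close> iff its
  augmentation is 1. For an idempotent this can be tested after reduction to \<open>F\<close>.
\<close>

lemma principal_block_eq: "principal_block \<iota> red G = block_algebra GA principal_idem"
  unfolding principal_block_def
proof (rule the_equality, intro conjI)
  have \<iota>_hom: "comm_ring_hom \<iota>" ..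
  show "block_algebra GA principal_idem \<in> blocks G" by (rule block_idempotentD(4)[OF principal_idem(1)])
  obtain e' where e': "central_idempotent GA e'" "red \<circ> e' = principal_idem" by (rule lift_central_idempotent[OF principal_idem_central])
  let ?\<tau> = "\<lambda>_ :: 'a. 1\<^sub>m 1 :: 'k mat"
  have "augmentation (\<iota> \<circ> e') = 1"
    using augmentation_map[OF \<iota>_hom, of e'] augmentation_lift[OF e' principal_idem(2)] by simp
  then have "rep_algebra G 1 ?\<tau> (\<iota> \<circ> e') $$ (0, 0) = 1"
    using rep_algebra_linear_entry[of ?\<tau> "\<lambda>_. 1" "\<iota> \<circ> e'"] by simp
  then have "rep_algebra G 1 ?\<tau> (\<iota> \<circ> e') = 1\<^sub>m 1"
    using rep_algebra_carrier[of 1 ?\<tau> "\<iota> \<circ> e'"] by (intro eq_matI) auto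
  moreover have "(\<lambda>g\<in>carrier G. 1) = character G ?\<tau>" by (auto simp: character_def restrict_def fun_eq_iff)
  ultimately show "(\<lambda>g\<in>carrier G. 1) \<in> Irr_block \<iota> red G (block_algebra GA principal_idem)"
    unfolding Irr_block_def
    using irreducible_linear_rep[OF trivial_rep] principal_idem(1) block_idempotentD(3)[OF principal_idem(1)] e' by blast
next
  fix B :: "('a \<Rightarrow> 'f) set"
  assume "B \<in> blocks G \<and> (\<lambda>g\<in>carrier G. 1) \<in> Irr_block \<iota> red G B"
  then have B: "B \<in> blocks G" and triv: "(\<lambda>g\<in>carrier G. 1) \<in> Irr_block \<iota> red G B" by auto
  obtain e where e: "block_idempotent GA e" "B = block_algebra GA e"
    and uniq: "\<And>f. f \<in> B \<Longrightarrow> block_idempotent GA f \<Longrightarrow> f = e"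
    by (rule block_cases[OF B]) (rule that)
  from triv[unfolded Irr_block_def mem_Collect_eq]
  obtain n and \<rho> :: "'a \<Rightarrow> 'k mat" where chi: "(\<lambda>g\<in>carrier G. 1) = character G \<rho>"
    and \<rho>: "irreducible_rep G n \<rho>"
    and "\<exists>f\<in>B. block_idempotent GA f \<and>
      (\<exists>e'. central_idempotent GA e' \<and> red \<circ> e' = f \<and> rep_algebra G n \<rho> (\<iota> \<circ> e') = 1\<^sub>m n)"
    by (elim exE conjE) (rule that)
  then obtain f e' where f: "f \<in> B" "block_idempotent GA f"
    and e': "central_idempotent GA e'" "red \<circ> e' = f" "rep_algebra G n \<rho> (\<iota> \<circ> e') = 1\<^sub>m n"
    by (elim bexE exE conjE) (rule that)
  note rep = irreducible_repD(1)[OF \<rho>]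
  have "of_nat n = (1 :: 'k)" using character_one[OF rep] by (simp flip: chi)
  then have n: "n = 1" by simp
  have "\<rho> g $$ (0, 0) = 1" if g: "g \<in> carrier G" for g
    using fun_cong[OF chi, of g] g representation_carrier[OF rep g] by (simp add: character_def n)
  then have "augmentation (\<iota> \<circ> e') = 1"
    using rep_algebra_linear_entry[of \<rho> "\<lambda>_. 1" "\<iota> \<circ> e'"] e'(3) by (simp add: n)
  then have "augmentation e' = 1" using augmentation_map[of \<iota> e'] \<iota>.comm_ring_hom_axioms by simp
  then have "augmentation f = 1" using augmentation_map[OF red_hom, of e'] e'(2) by simp
  then have "f = principal_idem" by (rule principal_idem_unique[OF f(2)])
  then show "B = block_algebra GA principal_idem" using uniq[OF f] e(2) by simp
qed

text \<open>
  The subgroup fixes the average over itself, which has augmentation 1 and so is absorbed.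
\<close>

lemma normal_p'_subgroup_fixes_principal_idem:
  assumes N: "N \<lhd> G" "\<not> p dvd card N" and x: "x \<in> N"
  shows "delta x \<star> principal_idem = principal_idem"
proof -
  have "of_nat (card N) \<noteq> (0 :: 'f)" using N(2) by (simp add: of_nat_F_eq_0_iff)
  then have c: "inverse (of_nat (card N)) * of_nat (card N) = (1 :: 'f)" by simp
  let ?E = "\<lambda>g. if g \<in> N then inverse (of_nat (card N)) else (0 :: 'f)"
  note E = subgroup_average[OF N(1) c]
  show ?thesis
    by (rule fixed_if_absorbs[OF principal_idem_central _ principal_idem_absorb[OF E(1,2)] _ E(3)[OF x]])
       (use E(1) x subgroup.mem_carrier[OF normal_imp_subgroup[OF N(1)]] in \<open>auto simp: central_idempotent_def\<close>)
qed

section \<open>Blocks with linear ordinary characters\<close>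

text \<open>
  The derived subgroup acts trivially in the irreducible representations over \<open>K\<close> of the block, so it
  fixes the lift of \<open>e\<close>: in characteristic 0 an element of finite order that acts unipotently acts
  trivially.
\<close>

lemma derived_fixes_block_idempotent:
  assumes B: "block_idempotent GA e" and lin: "Irr_block \<iota> red G (block_algebra GA e) \<subseteq> Lrr G"
    and x: "x \<in> derived G (carrier G)"
  shows "delta x \<star> e = e"
proof -
  have xc: "x \<in> carrier G" using x derived_in_carrier[of "carrier G"] by blast
  note ce = block_idempotentD(1)[OF B]
  obtain e' where e': "central_idempotent GA e'" "red \<circ> e' = e" by (rule lift_central_idempotent[OF ce])
  have ec: "e' \<in> carrier GA" "e \<in> carrier GA" using e'(1) ce by (auto simp: central_idempotent_def)
  have \<iota>e': "central_idempotent GA (\<iota> \<circ> e')"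
    by (rule map_coeff_central_idempotent[OF \<iota>.comm_ring_hom_axioms e'(1)])
  have \<iota>c: "\<iota> \<circ> e' \<in> carrier GA" using \<iota>e' by (simp add: central_idempotent_def)
  have triv: "\<rho> x = 1\<^sub>m n"
    if \<rho>: "irreducible_rep G n \<rho>" and 1: "rep_algebra G n \<rho> (\<iota> \<circ> e') = 1\<^sub>m n" for n and \<rho> :: "'a \<Rightarrow> 'k mat"
  proof -
    note rep = irreducible_repD(1)[OF \<rho>]
    have "character G \<rho> \<in> Irr_block \<iota> red G (block_algebra GA e)"
      unfolding Irr_block_def using \<rho> 1 e' B block_idempotentD(3)[OF B] by blast
    then have "character G \<rho> \<one> = 1" using lin by (auto simp: Lrr_def)
    then have "of_nat n = (1 :: 'k)" by (simp add: character_one[OF rep])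
    then have n: "n = 1" by simp
    show ?thesis
      by (rule derived_in_kernel[OF rep _ x]) (use rep in \<open>simp add: n linear_rep_commute\<close>)
  qed
  have "\<exists>k. (shift_diff x ^^ k) (\<iota> \<circ> e') = 0" by (rule unipotent_on_block[OF \<iota>e' xc]) (rule triv)
  then obtain k where "(shift_diff x ^^ k) (\<iota> \<circ> e') = 0" by (rule exE)
  from unipotent_char_0[OF xc \<iota>c this]
  have "\<forall>g \<in> carrier G. \<iota> (e' (inv x \<otimes> g)) = \<iota> (e' g)"
    unfolding act_fixed_iff[OF xc \<iota>c] by simp
  then have "\<forall>g \<in> carrier G. e' (inv x \<otimes> g) = e' g" by simp
  then have "\<forall>g \<in> carrier G. e (inv x \<otimes> g) = e g" using e'(2) by (auto simp flip: e'(2))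
  then show ?thesis unfolding act_fixed_iff[OF xc ec(2)] .
qed

text \<open>
  The average \<open>E\<close> over the derived subgroup has coefficients in \<open>R\<close>. If \<open>e'\<close> lifts the principal
  idempotent, then \<open>e' - e' E\<close> is an idempotent that reduces to 0. So \<open>e' = e' E\<close> is fixed by the derived
  subgroup, which must act trivially.
\<close>

lemma linear_ordinary_if_derived_p':
  assumes D: "\<not> p dvd card (derived G (carrier G))"
  shows "Irr_block \<iota> red G (block_algebra GA principal_idem) \<subseteq> Lrr G"
proof
  let ?D = "derived G (carrier G)"
  fix \<chi> assume "\<chi> \<in> Irr_block \<iota> red G (block_algebra GA principal_idem)"
  then obtain n and \<rho> :: "'a \<Rightarrow> 'k mat" and e e' where \<chi>: "\<chi> = character G \<rho>" and \<rho>: "irreducible_rep G n \<rho>"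
    and e: "e \<in> block_algebra GA principal_idem" "block_idempotent GA e"
    and e': "central_idempotent GA e'" "red \<circ> e' = e" "rep_algebra G n \<rho> (\<iota> \<circ> e') = 1\<^sub>m n"
    unfolding Irr_block_def by blast
  note rep = irreducible_repD(1)[OF \<rho>]
  have "e = principal_idem" by (rule GA.block_idempotent_in_block[OF principal_idem(1) e(2,1)])
  have N: "?D \<lhd> G" by (rule derived_is_normal) (simp add: normal_inv_iff subgroup_self)
  have "red (of_nat (card ?D)) \<noteq> 0" using D by (simp add: red.hom_of_nat of_nat_F_eq_0_iff)
  then obtain c :: 'r where c': "of_nat (card ?D) * c = 1" by (rule unit_if_red_nonzero)
  then have c: "c * of_nat (card ?D) = 1" by (simp add: mult.commute)
  let ?E = "\<lambda>g. if g \<in> ?D then c else 0"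
  note E = subgroup_average[OF N c]
  have Ec: "?E \<in> carrier GA" using E(1) by (simp add: central_idempotent_def)
  have e'c: "e' \<in> carrier GA" using e'(1) by (simp add: central_idempotent_def)
  have "augmentation (red \<circ> ?E) = 1" using augmentation_map[OF red_hom, of ?E] E(2) by simp
  then have absorb: "principal_idem \<star> (red \<circ> ?E) = principal_idem"
    by (intro principal_idem_absorb map_coeff_central_idempotent[OF red_hom E(1)])
  let ?f = "e' \<ominus>\<^bsub>GA\<^esub> e' \<star> ?E"
  have f: "central_idempotent GA ?f" by (rule GA.central_idempotent_diff(1)[OF e'(1) E(1)])
  have "red \<circ> ?f = principal_idem \<ominus>\<^bsub>GA\<^esub> principal_idem \<star> (red \<circ> ?E)"
    by (simp only: map_coeff_minus[OF red_hom e'c GA_mult_closed] map_coeff_mult[OF red_hom] e'(2) \<open>e = principal_idem\<close>)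
  also have "\<dots> = (\<lambda>_. 0)" unfolding absorb using principal_idem_central by (simp add: central_idempotent_def GA_minus)
  finally have "?f = \<zero>\<^bsub>GA\<^esub>"
    using f by (intro idempotent_reducing_to_zero) (simp_all add: central_idempotent_def)
  then have "e' \<star> ?E = e'" using e'c GA_mult_closed[of e' ?E] by (metis GA.r_right_minus_eq)
  note fixed = fixed_if_absorbs[OF e'(1) Ec this _ E(3)]
  have "\<rho> x = 1\<^sub>m n" if x: "x \<in> ?D" for x
  proof (rule rep_trivial_if_fixed[OF rep e'(3)])
    show xc: "x \<in> carrier G" using x derived_in_carrier[of "carrier G"] by blast
    have \<iota>c: "\<iota> \<circ> e' \<in> carrier GA" by (rule map_coeff_closed[OF \<iota>.comm_ring_hom_axioms e'c])
    show "delta x \<star> (\<iota> \<circ> e') = \<iota> \<circ> e'"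
      using fixed[OF xc x] unfolding act_fixed_iff[OF xc e'c] act_fixed_iff[OF xc \<iota>c] by simp
  qed
  from commuting_if_trivial_on_derived[OF rep this]
  have "n = 1" by (intro splitting_commuting_imp_linear[OF splitting_K \<rho>])
  then show "\<chi> \<in> Lrr G" using \<chi> \<rho> character_one[OF rep] by (auto simp: Lrr_def Irr_def)
qed

lemma ordinary_linear_block_iff:
  "(\<exists>B \<in> blocks G. Irr_block \<iota> red G B \<subseteq> Lrr G) \<longleftrightarrow>
     p_nilpotent p G \<and> (\<exists>P. sylow_subgroup p G P \<and> comm_group (G\<lparr>carrier := P\<rparr>))"
  unfolding p_nilpotent_abelian_sylow_iff[OF prime_p]
proof
  assume "\<exists>B \<in> blocks G. Irr_block \<iota> red G B \<subseteq> Lrr G"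
  then obtain B where B: "B \<in> blocks G" and lin: "Irr_block \<iota> red G B \<subseteq> Lrr G" by blast
  obtain e where e: "block_idempotent GA e" "B = block_algebra GA e" using block_cases[OF B] by blast
  show "\<not> p dvd card (derived G (carrier G))"
    by (rule subgroup_order_prime_to_p[OF block_idempotentD(1,2)[OF e(1)] derived_is_subgroup])
       (use derived_fixes_block_idempotent[OF e(1) lin[unfolded e(2)]] in auto)
next
  assume "\<not> p dvd card (derived G (carrier G))"
  then show "\<exists>B \<in> blocks G. Irr_block \<iota> red G B \<subseteq> Lrr G"
    using linear_ordinary_if_derived_p' block_idempotentD(4)[OF principal_idem(1)] by blast
qed

section \<open>Blocks with linear Brauer characters\<close>

text \<open>
  Let \<open>l\<close> be the character of a linear module of the block of \<open>e\<close>. The twist of \<open>e\<close> by \<open>l\<close> has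
  augmentation 1 and is absorbed by the principal idempotent. Hence twisting by \<open>l\<close> turns simple modules
  of the principal block into modules of the block of \<open>e\<close>.
\<close>

lemma principal_block_linear_if_block_linear:
  assumes e: "block_idempotent GA e" and lin: "IBr_block p \<iota> red G (block_algebra GA e) \<subseteq> LBr p \<iota> red G"
    and \<rho>: "irreducible_rep G n \<rho>" and \<rho>e0: "rep_algebra G n \<rho> principal_idem = 1\<^sub>m n"
  shows "n = 1"
proof -
  have linear: "m = 1"
    if "irreducible_rep G m \<sigma>" and "rep_algebra G m \<sigma> e = 1\<^sub>m m" for m and \<sigma> :: "'a \<Rightarrow> 'f mat"
  proof -
    have "brauer_character p \<iota> red G \<sigma> \<in> IBr_block p \<iota> red G (block_algebra GA e)"
      unfolding IBr_block_def using that e block_idempotentD(3)[OF e] by blast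
    then show ?thesis using lin brauer_character_in_LBr_iff[OF that(1)] by blast
  qed
  note ce = block_idempotentD(1)[OF e]
  obtain m and \<sigma> :: "'a \<Rightarrow> 'f mat" where \<sigma>: "irreducible_rep G m \<sigma>" "rep_algebra G m \<sigma> e = 1\<^sub>m m"
    by (rule exists_irreducible_in_idempotent[OF ce block_idempotentD(2)[OF e]])
  have m: "m = 1" by (rule linear[OF \<sigma>])
  have rep: "representation G 1 \<sigma>" using irreducible_repD(1)[OF \<sigma>(1)] m by simp
  define l where "l g = \<sigma> g $$ (0, 0)" for g
  have l: "l (g \<otimes> h) = l g * l h" if "g \<in> carrier G" "h \<in> carrier G" for g h
    using representation_mult[OF rep that] representation_carrier[OF rep that(1)] representation_carrier[OF rep that(2)]
    by (simp add: l_def scalar_prod_def)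
  have l1: "l \<one> = 1" using rep by (simp add: l_def representation_def)
  have "eval_linear l e = rep_algebra G 1 \<sigma> e $$ (0, 0)"
    by (rule rep_algebra_linear_entry[symmetric]) (simp add: l_def)
  then have "augmentation (\<lambda>g. l g * e g) = 1"
    using \<sigma>(2) m by (simp add: eval_linear_def mult.commute)
  with twist_central_idempotent[OF _ ce, of l] have absorb: "principal_idem \<star> (\<lambda>g. l g * e g) = principal_idem"
    by (intro principal_idem_absorb) (simp_all add: l)
  have "rep_algebra G n \<rho> principal_idem * rep_algebra G n \<rho> (\<lambda>g. l g * e g) = rep_algebra G n \<rho> principal_idem"
    unfolding rep_algebra_mult[OF irreducible_repD(1)[OF \<rho>], symmetric] absorb ..
  then have "rep_algebra G n \<rho> (\<lambda>g. l g * e g) = 1\<^sub>m n"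
    unfolding \<rho>e0 using rep_algebra_carrier[of n \<rho> "\<lambda>g. l g * e g"] by simp
  then have "rep_algebra G n (\<lambda>g. l g \<cdot>\<^sub>m \<rho> g) e = 1\<^sub>m n"
    by (simp only: twist_irreducible(2)[OF l l1 \<rho>])
  moreover have "irreducible_rep G n (\<lambda>g. l g \<cdot>\<^sub>m \<rho> g)"
    by (intro twist_irreducible(1)[where l = l] l l1 \<rho>)
  ultimately show ?thesis by (intro linear)
qed

text \<open>
  The common kernel of the simple modules of the principal block. The function \<open>block_kernel\<close> takes all
  modules with the same Brauer characters instead; the two are compared in
  \<open>block_kernel_principal_block\<close>.
\<close>

definition principal_kernel :: "'a set" where
  "principal_kernel = {x \<in> carrier G. \<forall>n (\<rho> :: 'a \<Rightarrow> 'f mat).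
     irreducible_rep G n \<rho> \<and> rep_algebra G n \<rho> principal_idem = 1\<^sub>m n \<longrightarrow> \<rho> x = 1\<^sub>m n}"

lemma principal_kernelD:
  "x \<in> principal_kernel \<Longrightarrow> x \<in> carrier G"
  "x \<in> principal_kernel \<Longrightarrow> irreducible_rep G n \<rho> \<Longrightarrow> rep_algebra G n \<rho> principal_idem = 1\<^sub>m n \<Longrightarrow> \<rho> x = 1\<^sub>m n"
  unfolding principal_kernel_def by blast+

lemma principal_kernelI:
  "x \<in> carrier G \<Longrightarrow> (\<And>n \<rho>. irreducible_rep G n \<rho> \<Longrightarrow> rep_algebra G n \<rho> principal_idem = 1\<^sub>m n \<Longrightarrow> \<rho> x = 1\<^sub>m n)
    \<Longrightarrow> x \<in> principal_kernel"
  unfolding principal_kernel_def by blast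

lemma principal_kernel_normal: "principal_kernel \<lhd> G"
proof -
  have s: "subgroup principal_kernel G"
  proof (rule subgroup.intro)
    show "principal_kernel \<subseteq> carrier G" using principal_kernelD(1) by blast
    show "\<one> \<in> principal_kernel"
      by (rule principal_kernelI) (auto dest: irreducible_repD simp: representation_def)
    fix x assume x: "x \<in> principal_kernel"
    show "inv x \<in> principal_kernel"
    proof (rule principal_kernelI)
      fix n and \<rho> :: "'a \<Rightarrow> 'f mat" assume \<rho>: "irreducible_rep G n \<rho>" "rep_algebra G n \<rho> principal_idem = 1\<^sub>m n"
      from subgroup.m_inv_closed[OF subgroup_rep_kernel[OF irreducible_repD(1)[OF \<rho>(1)]]]
      show "\<rho> (inv x) = 1\<^sub>m n" using principal_kernelD[OF x] \<rho> by blast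
    qed (use principal_kernelD(1)[OF x] in simp)
    fix y assume y: "y \<in> principal_kernel"
    show "x \<otimes> y \<in> principal_kernel"
    proof (rule principal_kernelI)
      fix n and \<rho> :: "'a \<Rightarrow> 'f mat" assume \<rho>: "irreducible_rep G n \<rho>" "rep_algebra G n \<rho> principal_idem = 1\<^sub>m n"
      from subgroup.m_closed[OF subgroup_rep_kernel[OF irreducible_repD(1)[OF \<rho>(1)]]]
      show "\<rho> (x \<otimes> y) = 1\<^sub>m n" using principal_kernelD[OF x] principal_kernelD[OF y] \<rho> by blast
    qed (use principal_kernelD(1)[OF x] principal_kernelD(1)[OF y] in simp)
  qed
  have "g \<otimes> x \<otimes> inv g \<in> principal_kernel" if g: "g \<in> carrier G" and x: "x \<in> principal_kernel" for g x
  proof (rule principal_kernelI)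
    note xc = principal_kernelD(1)[OF x]
    show "g \<otimes> x \<otimes> inv g \<in> carrier G" using g xc by simp
    fix n and \<rho> :: "'a \<Rightarrow> 'f mat" assume \<rho>: "irreducible_rep G n \<rho>" "rep_algebra G n \<rho> principal_idem = 1\<^sub>m n"
    note rep = irreducible_repD(1)[OF \<rho>(1)]
    have "\<rho> (g \<otimes> x \<otimes> inv g) = \<rho> g * \<rho> x * \<rho> (inv g)"
      using g xc by (simp add: representation_mult[OF rep])
    also have "\<dots> = \<rho> g * \<rho> (inv g)"
      using principal_kernelD(2)[OF x \<rho>] representation_carrier[OF rep g] by simp
    also have "\<dots> = 1\<^sub>m n"
      using representation_mult[OF rep g, of "inv g"] g rep by (simp add: representation_def)
    finally show "\<rho> (g \<otimes> x \<otimes> inv g) = 1\<^sub>m n" .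
  qed
  then show ?thesis using s by (simp add: normal_inv_iff)
qed

lemma O_p'_subset_principal_kernel: "O_p' p G \<subseteq> principal_kernel"
proof
  fix x assume x: "x \<in> O_p' p G"
  note N = O_p'_largest(1,2)[OF prime_p]
  have xc: "x \<in> carrier G" using x subgroup.mem_carrier[OF normal_imp_subgroup[OF N(1)]] by blast
  show "x \<in> principal_kernel"
  proof (rule principal_kernelI[OF xc])
    fix n and \<rho> :: "'a \<Rightarrow> 'f mat" assume \<rho>: "irreducible_rep G n \<rho>" "rep_algebra G n \<rho> principal_idem = 1\<^sub>m n"
    show "\<rho> x = 1\<^sub>m n"
      by (rule rep_trivial_if_fixed[OF irreducible_repD(1)[OF \<rho>(1)] \<rho>(2) xc normal_p'_subgroup_fixes_principal_idem[OF N x]])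
  qed
qed

text \<open>
  Since \<open>x\<close> acts unipotently on the principal idempotent, some power of \<open>x\<close> with exponent a power of
  \<open>p\<close> lies in its stabilizer, a normal subgroup of order prime to \<open>p\<close>.
\<close>

lemma principal_kernel_power:
  assumes x: "x \<in> principal_kernel"
  shows "\<exists>k. x [^] (p ^ k) \<in> O_p' p G"
proof -
  note xc = principal_kernelD(1)[OF x]
  have e0c: "principal_idem \<in> carrier GA" using principal_idem_central by (simp add: central_idempotent_def)
  have "\<exists>k. (shift_diff x ^^ k) principal_idem = 0"
    by (rule unipotent_on_block[OF principal_idem_central xc]) (rule principal_kernelD(2)[OF x])
  then obtain k where "(shift_diff x ^^ k) principal_idem = 0" by (rule exE)
  moreover have "of_nat p = (0 :: 'f)" by (simp add: of_nat_F_eq_0_iff)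
  ultimately obtain j where j: "delta (x [^] (p ^ j)) \<star> principal_idem = principal_idem"
    using unipotent_char_p[OF xc _ e0c] by blast
  let ?S = "{x \<in> carrier G. delta x \<star> principal_idem = principal_idem}"
  note S = normal_stabilizer[OF principal_idem_central]
  have "\<not> p dvd card ?S"
    by (rule subgroup_order_prime_to_p[OF principal_idem_central block_idempotentD(2)[OF principal_idem(1)] normal_imp_subgroup[OF S]]) simp
  from O_p'_largest(3)[OF prime_p S this] have "?S \<subseteq> O_p' p G" .
  then have "x [^] (p ^ j) \<in> O_p' p G" using j xc by auto
  then show ?thesis by (rule exI)
qed

lemma in_residual_mult_O_p':
  assumes "x \<in> carrier G" "x [^] (p ^ k) \<in> O_p' p G"
  shows "x \<in> p'_residual p G <#> O_p' p G"
  by (rule p_part_decomposition[OF prime_p normal_imp_subgroup[OF O_p'_largest(1)[OF prime_p]]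
        O_p'_largest(2)[OF prime_p] assms])

context
  assumes linear: "\<And>n (\<rho> :: 'a \<Rightarrow> 'f mat). irreducible_rep G n \<rho> \<Longrightarrow> rep_algebra G n \<rho> principal_idem = 1\<^sub>m n \<Longrightarrow> n = 1"
begin

lemma derived_subset_principal_kernel: "derived G (carrier G) \<subseteq> principal_kernel"
proof
  fix x assume x: "x \<in> derived G (carrier G)"
  show "x \<in> principal_kernel"
  proof (rule principal_kernelI)
    show "x \<in> carrier G" using x derived_in_carrier[of "carrier G"] by blast
    fix n and \<rho> :: "'a \<Rightarrow> 'f mat" assume \<rho>: "irreducible_rep G n \<rho>" "rep_algebra G n \<rho> principal_idem = 1\<^sub>m n"
    note rep = irreducible_repD(1)[OF \<rho>(1)]
    show "\<rho> x = 1\<^sub>m n"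
      by (rule derived_in_kernel[OF rep _ x]) (use rep linear[OF \<rho>] linear_rep_commute in blast)
  qed
qed

lemma residual_subset_principal_kernel: "p'_residual p G \<subseteq> principal_kernel"
proof
  fix x assume x: "x \<in> p'_residual p G"
  show "x \<in> principal_kernel"
  proof (rule principal_kernelI)
    have "subgroup (p'_residual p G) G" unfolding p'_residual_def by (rule generate_is_subgroup) auto
    then show "x \<in> carrier G" using x subgroup.mem_carrier by metis
    fix n and \<rho> :: "'a \<Rightarrow> 'f mat" assume \<rho>: "irreducible_rep G n \<rho>" "rep_algebra G n \<rho> principal_idem = 1\<^sub>m n"
    have n: "n = 1" by (rule linear[OF \<rho>])
    show "\<rho> x = 1\<^sub>m n"
      unfolding n by (rule residual_in_linear_kernel[OF prime_p char_F irreducible_repD(1)[OF \<rho>(1)[unfolded n]] x])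
  qed
qed

lemma principal_kernel_eq_O_p'p: "principal_kernel = O_p'p p G"
proof
  show "principal_kernel \<subseteq> O_p'p p G"
    by (rule subset_O_p'pI[OF prime_p principal_kernel_normal principal_kernel_power])
  show "O_p'p p G \<subseteq> principal_kernel"
  proof
    fix x assume x: "x \<in> O_p'p p G"
    obtain k where "x [^] (p ^ k) \<in> O_p' p G" using O_p'p_power(2)[OF prime_p x] by blast
    then have "x \<in> p'_residual p G <#> O_p' p G" by (rule in_residual_mult_O_p'[OF O_p'p_power(1)[OF prime_p x]])
    then obtain h y where "h \<in> p'_residual p G" "y \<in> O_p' p G" "x = h \<otimes> y" by (auto simp: set_mult_def)
    then show "x \<in> principal_kernel"
      using residual_subset_principal_kernel O_p'_subset_principal_kernel
        subgroup.m_closed[OF normal_imp_subgroup[OF principal_kernel_normal]] by blast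
  qed
qed

lemma principal_kernel_eq_mult:
  "(derived G (carrier G) <#> p'_residual p G) <#> O_p' p G = principal_kernel"
proof
  note m_closed = subgroup.m_closed[OF normal_imp_subgroup[OF principal_kernel_normal]]
  show "(derived G (carrier G) <#> p'_residual p G) <#> O_p' p G \<subseteq> principal_kernel"
  proof
    fix x assume "x \<in> (derived G (carrier G) <#> p'_residual p G) <#> O_p' p G"
    then obtain d h y where dhy: "d \<in> derived G (carrier G)" "h \<in> p'_residual p G" "y \<in> O_p' p G" "x = d \<otimes> h \<otimes> y"
      by (auto simp: set_mult_def)
    have "d \<in> principal_kernel" "h \<in> principal_kernel" "y \<in> principal_kernel"
      using dhy derived_subset_principal_kernel residual_subset_principal_kernel O_p'_subset_principal_kernel by blast+
    then show "x \<in> principal_kernel" unfolding dhy(4) by (intro m_closed)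
  qed
  show "principal_kernel \<subseteq> (derived G (carrier G) <#> p'_residual p G) <#> O_p' p G"
  proof
    fix x assume x: "x \<in> principal_kernel"
    obtain k where "x [^] (p ^ k) \<in> O_p' p G" using principal_kernel_power[OF x] by blast
    then have "x \<in> p'_residual p G <#> O_p' p G" by (rule in_residual_mult_O_p'[OF principal_kernelD(1)[OF x]])
    then obtain h y where hy: "h \<in> p'_residual p G" "y \<in> O_p' p G" "x = h \<otimes> y" by (auto simp: set_mult_def)
    have "h \<in> carrier G" using hy(1) residual_subset_principal_kernel principal_kernelD(1) by blast
    then have "h = \<one> \<otimes> h" by simp
    moreover have "\<one> \<in> derived G (carrier G)" by (rule subgroup.one_closed[OF derived_is_subgroup[OF subset_refl]])
    ultimately have "h \<in> derived G (carrier G) <#> p'_residual p G" using hy(1) unfolding set_mult_def by blast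
    then show "x \<in> (derived G (carrier G) <#> p'_residual p G) <#> O_p' p G"
      using hy(2,3) unfolding set_mult_def by blast
  qed
qed

text \<open>
  Let \<open>\<rho>\<close> have the Brauer character of a simple module \<open>\<sigma>\<close> of the principal block. Both are linear. An
  element of the principal kernel is a product of \<open>p\<close>-elements, which act trivially in any linear
  module, and a \<open>p\<close>-regular element, on which \<open>\<rho>\<close> is determined by \<open>\<sigma>\<close>.
\<close>

lemma block_kernel_principal_block: "block_kernel p \<iota> red G (principal_block \<iota> red G) = principal_kernel"
  unfolding principal_block_eq
proof
  show "block_kernel p \<iota> red G (block_algebra GA principal_idem) \<subseteq> principal_kernel"
  proof
    fix x assume x: "x \<in> block_kernel p \<iota> red G (block_algebra GA principal_idem)"
    show "x \<in> principal_kernel"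
    proof (rule principal_kernelI)
      show "x \<in> carrier G" using x by (simp add: block_kernel_def)
      fix n and \<rho> :: "'a \<Rightarrow> 'f mat" assume \<rho>: "irreducible_rep G n \<rho>" "rep_algebra G n \<rho> principal_idem = 1\<^sub>m n"
      then have "brauer_character p \<iota> red G \<rho> \<in> IBr_block p \<iota> red G (block_algebra GA principal_idem)"
        unfolding IBr_block_def using principal_idem(1) block_idempotentD(3)[OF principal_idem(1)] by blast
      then show "\<rho> x = 1\<^sub>m n" using x \<rho>(1) unfolding block_kernel_def by blast
    qed
  qed
  show "principal_kernel \<subseteq> block_kernel p \<iota> red G (block_algebra GA principal_idem)"
  proof
    fix x assume x: "x \<in> principal_kernel"
    have "\<rho> x = 1\<^sub>m n"
      if \<phi>: "\<phi> \<in> IBr_block p \<iota> red G (block_algebra GA principal_idem)"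
        and \<rho>: "irreducible_rep G n \<rho>" "brauer_character p \<iota> red G \<rho> = \<phi>" for \<phi> n and \<rho> :: "'a \<Rightarrow> 'f mat"
    proof -
      obtain m and \<sigma> :: "'a \<Rightarrow> 'f mat" and e where \<sigma>: "irreducible_rep G m \<sigma>" "\<phi> = brauer_character p \<iota> red G \<sigma>"
        and e: "e \<in> block_algebra GA principal_idem" "block_idempotent GA e" and \<sigma>e: "rep_algebra G m \<sigma> e = 1\<^sub>m m"
        using \<phi> unfolding IBr_block_def by blast
      have "e = principal_idem" by (rule GA.block_idempotent_in_block[OF principal_idem(1) e(2,1)])
      then have \<sigma>e0: "rep_algebra G m \<sigma> principal_idem = 1\<^sub>m m" using \<sigma>e by simp
      have m: "m = 1" by (rule linear[OF \<sigma>(1) \<sigma>e0])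
      then have "\<phi> \<in> LBr p \<iota> red G" using brauer_character_in_LBr_iff[OF \<sigma>(1)] \<sigma>(2) by simp
      then have n: "n = 1" using brauer_character_in_LBr_iff[OF \<rho>(1)] \<rho>(2) by simp
      have rep: "representation G 1 \<rho>" "representation G 1 \<sigma>"
        using irreducible_repD(1)[OF \<rho>(1)] irreducible_repD(1)[OF \<sigma>(1)] n m by simp_all
      obtain k where "x [^] (p ^ k) \<in> O_p' p G" using principal_kernel_power[OF x] by blast
      then have "x \<in> p'_residual p G <#> O_p' p G" by (rule in_residual_mult_O_p'[OF principal_kernelD(1)[OF x]])
      then obtain h y where hy: "h \<in> p'_residual p G" "y \<in> O_p' p G" "x = h \<otimes> y" by (auto simp: set_mult_def)
      have yk: "y \<in> principal_kernel" using hy(2) O_p'_subset_principal_kernel by blast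
      have hc: "h \<in> carrier G" "y \<in> carrier G"
        using hy(1) residual_subset_principal_kernel principal_kernelD(1) yk by blast+
      have sN: "subgroup (O_p' p G) G" by (rule normal_imp_subgroup[OF O_p'_largest(1)[OF prime_p]])
      have "ord y dvd card (O_p' p G)" using subgroup_pow_card[OF sN hy(2)] pow_eq_id[OF hc(2)] by blast
      then have "y \<in> p_regular p G"
        using O_p'_largest(2)[OF prime_p] hc(2) dvd_trans unfolding p_regular_def by blast
      moreover have "\<sigma> y = 1\<^sub>m 1" using principal_kernelD(2)[OF yk \<sigma>(1) \<sigma>e0] m by simp
      moreover have "brauer_character p \<iota> red G \<sigma> = brauer_character p \<iota> red G \<rho>" using \<sigma>(2) \<rho>(2) by simp
      ultimately have "\<rho> y = 1\<^sub>m 1" by (intro linear_brauer_character_trivial[OF rep(2,1)])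
      moreover have "\<rho> h = 1\<^sub>m 1" by (rule residual_in_linear_kernel[OF prime_p char_F rep(1) hy(1)])
      ultimately show ?thesis using representation_mult[OF rep(1) hc] hy(3) n by simp
    qed
    then show "x \<in> block_kernel p \<iota> red G (block_algebra GA principal_idem)"
      using principal_kernelD(1)[OF x] unfolding block_kernel_def by blast
  qed
qed

lemma group_structure_if_principal_block_linear:
  assumes H: "H = derived G (carrier G) <#> p'_residual p G"
  shows "O_p' p G \<lhd> G\<lparr>carrier := O_p'p p G\<rparr> \<and> O_p'p p G = H <#> O_p' p G \<and>
    H <#> O_p' p G = block_kernel p \<iota> red G (principal_block \<iota> red G) \<and>
    block_kernel p \<iota> red G (principal_block \<iota> red G) \<lhd> G\<lparr>carrier := O_p'pp' p G\<rparr> \<and>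
    O_p'pp' p G = carrier G"
proof -
  have top: "O_p'pp' p G = carrier G"
    by (rule O_p'pp'_eq_carrier[OF prime_p]) (use residual_subset_principal_kernel principal_kernel_eq_O_p'p in simp)
  have "O_p' p G \<lhd> G\<lparr>carrier := O_p'p p G\<rparr>"
    by (rule normal_restrict_supergroup[OF normal_imp_subgroup[OF O_p'p_normal[OF prime_p]] O_p'_largest(1)[OF prime_p]])
       (use O_p'_subset_principal_kernel principal_kernel_eq_O_p'p in simp)
  moreover have "principal_kernel \<lhd> G\<lparr>carrier := carrier G\<rparr>"
    using principal_kernel_normal by simp
  ultimately show ?thesis
    using top principal_kernel_eq_O_p'p principal_kernel_eq_mult block_kernel_principal_block by (simp add: H)
qed

end

text \<open>
  The kernel contains the derived subgroup, so the operators of a simple module of the principal block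
  commute.
\<close>

lemma principal_block_linear_if_kernel:
  assumes H: "H = derived G (carrier G) <#> p'_residual p G"
    and ker: "H <#> O_p' p G = block_kernel p \<iota> red G (principal_block \<iota> red G)"
  shows "IBr_block p \<iota> red G (principal_block \<iota> red G) \<subseteq> LBr p \<iota> red G"
proof
  fix \<phi> assume \<phi>: "\<phi> \<in> IBr_block p \<iota> red G (principal_block \<iota> red G)"
  then obtain n and \<rho> :: "'a \<Rightarrow> 'f mat" where \<rho>: "irreducible_rep G n \<rho>" "\<phi> = brauer_character p \<iota> red G \<rho>"
    unfolding IBr_block_def by blast
  have "\<rho> x = 1\<^sub>m n" if x: "x \<in> derived G (carrier G)" for x
  proof -
    have xc: "x \<in> carrier G" using x derived_in_carrier[of "carrier G"] by blast
    have "\<one> \<in> p'_residual p G" unfolding p'_residual_def by (rule generate.one)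
    moreover have "\<one> \<in> O_p' p G"
      by (rule subgroup.one_closed[OF normal_imp_subgroup[OF O_p'_largest(1)[OF prime_p]]])
    moreover have "x = x \<otimes> \<one> \<otimes> \<one>" using xc by simp
    ultimately have "x \<in> H <#> O_p' p G" using x unfolding H set_mult_def by blast
    then show ?thesis using \<phi> \<rho> unfolding ker block_kernel_def by blast
  qed
  from commuting_if_trivial_on_derived[OF irreducible_repD(1)[OF \<rho>(1)] this]
  have "n = 1" by (intro splitting_commuting_imp_linear[OF splitting_F \<rho>(1)])
  then show "\<phi> \<in> LBr p \<iota> red G" using brauer_character_in_LBr_iff[OF \<rho>(1)] \<rho>(2) by simp
qed

lemma brauer_linear_block_iff:
  assumes H: "H = derived G (carrier G) <#> p'_residual p G"
  shows "(\<exists>B \<in> blocks G. IBr_block p \<iota> red G B \<subseteq> LBr p \<iota> red G) \<longleftrightarrow>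
    O_p' p G \<lhd> G\<lparr>carrier := O_p'p p G\<rparr> \<and> O_p'p p G = H <#> O_p' p G \<and>
    H <#> O_p' p G = block_kernel p \<iota> red G (principal_block \<iota> red G) \<and>
    block_kernel p \<iota> red G (principal_block \<iota> red G) \<lhd> G\<lparr>carrier := O_p'pp' p G\<rparr> \<and>
    O_p'pp' p G = carrier G" (is "_ \<longleftrightarrow> ?structure")
proof
  assume "\<exists>B \<in> blocks G. IBr_block p \<iota> red G B \<subseteq> LBr p \<iota> red G"
  then obtain B where B: "B \<in> blocks G" and lin: "IBr_block p \<iota> red G B \<subseteq> LBr p \<iota> red G" by blast
  obtain e where e: "block_idempotent GA e" "B = block_algebra GA e" using block_cases[OF B] by blast
  show ?structure
    by (rule group_structure_if_principal_block_linear[OF _ H])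
       (rule principal_block_linear_if_block_linear[OF e(1) lin[unfolded e(2)]])
next
  assume ?structure
  then have "IBr_block p \<iota> red G (principal_block \<iota> red G) \<subseteq> LBr p \<iota> red G"
    by (intro principal_block_linear_if_kernel[OF H]) blast
  moreover have "principal_block \<iota> red G \<in> blocks G"
    unfolding principal_block_eq by (rule block_idempotentD(4)[OF principal_idem(1)])
  ultimately show "\<exists>B \<in> blocks G. IBr_block p \<iota> red G B \<subseteq> LBr p \<iota> red G" by blast
qed

end

theorem theorem2p4:
  fixes G :: "('g, 'm) monoid_scheme" (structure)
    and p :: nat
    and \<pp> :: "'r::idom set"
    and \<iota> :: "'r \<Rightarrow> 'k::field_char_0"
    and red :: "'r \<Rightarrow> 'f::field"
    and H :: "'g set"
  assumes "group G" and "finite (carrier G)"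
    and "prime p"
    and "splitting_p_modular_system p \<pp> \<iota> red G"
    and "H = derived G (carrier G) <#>\<^bsub>G\<^esub> p'_residual p G"
  shows "((\<exists>B \<in> blocks G. Irr_block \<iota> red G B \<subseteq> Lrr G) \<longleftrightarrow>
           p_nilpotent p G \<and> (\<exists>P. sylow_subgroup p G P \<and> comm_group (G\<lparr>carrier := P\<rparr>))) \<and>
         ((\<exists>B \<in> blocks G. IBr_block p \<iota> red G B \<subseteq> LBr p \<iota> red G) \<longleftrightarrow>
           O_p' p G \<lhd> G\<lparr>carrier := O_p'p p G\<rparr> \<and>
           O_p'p p G = H <#>\<^bsub>G\<^esub> O_p' p G \<and>
           H <#>\<^bsub>G\<^esub> O_p' p G = block_kernel p \<iota> red G (principal_block \<iota> red G) \<and>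
           block_kernel p \<iota> red G (principal_block \<iota> red G) \<lhd> G\<lparr>carrier := O_p'pp' p G\<rparr> \<and>
           O_p'pp' p G = carrier G)"
proof -
  interpret modular_system G \<pp> red p \<iota>
    using assms(1-4)
    unfolding modular_system_def modular_system_axioms_def modular_group_algebra_def finite_group_def
      finite_group_axioms_def complete_dvr_residue_def splitting_p_modular_system_def
    by blast
  show ?thesis using ordinary_linear_block_iff brauer_linear_block_iff[OF assms(5)] by blast
qed

end
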